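(* Let $n\ge2$, $m=(m_1,\dots,m_n)\in\mathbb{N}^n$, $|M|=m_1+\cdots+m_n$, and let $\vec v={}^t[s,c_0,c_1,c_2,d_0,d_1,d_2,\delta]$ and $x=(x_1,\dots,x_n)$ be generic complex parameters satisfying the balancing condition $$(c_0+c_1+c_2)+(d_0+d_1+d_2)=(2+|M|)\delta+3s .$$ Let $$\widetilde E^{n,3}(\vec v,x):=\frac{\prod_{0\le k\le2}\Bigl([[\delta+s-c_k]]_{|M|}\prod_{1\le i\le n}[[\delta+s-d_k+x_i]]_{m_i}\Bigr)}{\prod_{1\le i\le n}[[\delta+s+x_i]]_{m_i}}\;E(\vec v,x),$$ where $E(\vec v,x)$ is the $A_n$ elliptic hypergeometric series of rectangular type defined in the context. Then $\widetilde E^{n,3}(\vec v,x)$ is invariant under the action of the direct product $\mathfrak{S}_6\times\mathfrak{S}_2$ realized on $(\vec v,x)$ by letting the adjacent transpositions $\sigma_1,\sigma_2,\sigma_3,\sigma_4,\sigma_5$ of $\mathfrak{S}_6$ act as $s_1,s_0,b_1,t_0,t_1$ respectively, and the generator $\tau$ of $\mathfrak{S}_2$ act as $b_2$ (that is, these assignments define an action of $\mathfrak{S}_6\times\mathfrak{S}_2$, and $\widetilde E^{n,3}$ is invariant under it).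
   Context: $[[x]]=\sigma(x;\omega_1,\omega_2)$ is the Weierstrass sigma function with periods $(\omega_1,\omega_2)$ (an odd holomorphic function), $\delta\in\mathbb{C}$ is a fixed constant with $\delta\notin\mathbb{Q}\omega_1+\mathbb{Q}\omega_2$, and $[[z]]_k=[[z]]\,[[z+\delta]]\cdots[[z+(k-1)\delta]]$ for $k=0,1,2,\dots$. For $\gamma\in\mathbb{N}^n$, $|\gamma|=\gamma_1+\cdots+\gamma_n$, $\Delta[x]=\prod_{i<j}[[x_i-x_j]]$, $\Delta[x+\gamma\delta]=\prod_{i<j}[[x_i+\gamma_i\delta-x_j-\gamma_j\delta]]$. With $a_j=-m_j\delta$, the series is $$E(\vec v,x)=\sum_{\gamma\in\mathbb{N}^n}\frac{\Delta[x+\gamma\delta]}{\Delta[x]}\prod_{1\le i\le n}\frac{[[(|\gamma|+\gamma_i)\delta+s+x_i]]}{[[s+x_i]]}\prod_{1\le j\le n}\left(\frac{[[s+x_j]]_{|\gamma|}}{[[\delta+s-a_j+x_j]]_{|\gamma|}}\prod_{1\le i\le n}\frac{[[a_j+x_i-x_j]]_{\gamma_i}}{[[\delta+x_i-x_j]]_{\gamma_i}}\right)\prod_{0\le k\le2}\left(\frac{[[d_k]]_{|\gamma|}}{[[\delta+s-c_k]]_{|\gamma|}}\prod_{1\le i\le n}\frac{[[c_k+x_i]]_{\gamma_i}}{[[\delta+s-d_k+x_i]]_{\gamma_i}}\right),$$ which terminates. The multi-index $m$ is fixed. The transformations (all fixing $\delta$) are: $s_i$ ($i=0,1$) exchanges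 $c_i$ and $c_{i+1}$; $t_i$ ($i=0,1$) exchanges $d_i$ and $d_{i+1}$; these fix everything else; $b_1$ sends $(s,c_0,c_1,c_2,d_0,d_1,d_2)$ to $(2s+\delta-c_0-d_1-d_2,\ s+\delta-d_1-d_2,\ c_1,\ c_2,\ d_0,\ s+\delta-c_0-d_2,\ s+\delta-c_0-d_1)$ and fixes $x$; $b_2$ sends $(s,c_0,c_1,c_2,d_0,d_1,d_2)$ to $(2s+\delta-c_0-c_1-c_2,\ s+\delta-c_1-c_2,\ s+\delta-c_0-c_2,\ s+\delta-c_0-c_1,\ d_0,\ d_1,\ d_2)$ and sends $x_i$ to $\tilde x_i=-m_i\delta-x_i+|M|\delta$ for $1\le i\le n$. "Generic" means that all denominators occurring are nonzero. *)

theory Defs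
  imports
    "HOL-Analysis.Analysis"
    "HOL-Algebra.Group_Action"
    "HOL-Algebra.Sym_Groups"
begin

definition period_lattice :: "complex \<Rightarrow> complex \<Rightarrow> complex set" where
  "period_lattice \<omega>1 \<omega>2 = {of_int a * \<omega>1 + of_int b * \<omega>2 | a b. True}"

(* The Weierstrass product over the lattice with periods \<omega>1, \<omega>2 (not 2\<omega>1, 2\<omega>2).  It converges
   absolutely, so it is written as a limit along the finite sets of nonzero periods, which
   avoids choosing an enumeration of the lattice. *)
definition weierstrass_sigma :: "complex \<Rightarrow> complex \<Rightarrow> complex \<Rightarrow> complex" where
  "weierstrass_sigma \<omega>1 \<omega>2 z =
     z * Lim (finite_subsets_at_top (period_lattice \<omega>1 \<omega>2 - {0}))
           (\<lambda>F. \<Prod>\<omega>\<in>F. (1 - z / \<omega>) * exp (z / \<omega> + (z / \<omega>)\<^sup>2 / 2))"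

(* Below, br stands for the odd function z \<mapsto> [[z]], instantiated with weierstrass_sigma. *)

definition shifted_prod :: "(complex \<Rightarrow> complex) \<Rightarrow> complex \<Rightarrow> complex \<Rightarrow> nat \<Rightarrow> complex" where
  "shifted_prod br \<delta> z k = (\<Prod>l<k. br (z + of_nat l * \<delta>))"

definition Delta :: "(complex \<Rightarrow> complex) \<Rightarrow> nat \<Rightarrow> (nat \<Rightarrow> complex) \<Rightarrow> complex" where
  "Delta br n x = (\<Prod>j=1..n. \<Prod>i=1..<j. br (x i - x j))"

definition msize :: "nat \<Rightarrow> (nat \<Rightarrow> nat) \<Rightarrow> nat" where
  "msize n \<gamma> = (\<Sum>i=1..n. \<gamma> i)"

(* (s, c, d, x) with c, d indexed by {0..2} and x by {1..n}.  The remaining entry \<delta> of the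
   vector v is a fixed constant and is passed separately. *)
type_synonym params = "complex \<times> (nat \<Rightarrow> complex) \<times> (nat \<Rightarrow> complex) \<times> (nat \<Rightarrow> complex)"

(* Extensionality makes this a copy of the balancing hyperplane in C^(7+n). *)
definition balanced_params :: "complex \<Rightarrow> nat \<Rightarrow> (nat \<Rightarrow> nat) \<Rightarrow> params set" where
  "balanced_params \<delta> n m =
     {(s, c, d, x). c \<in> {0..2} \<rightarrow>\<^sub>E UNIV \<and> d \<in> {0..2} \<rightarrow>\<^sub>E UNIV \<and> x \<in> {1..n} \<rightarrow>\<^sub>E UNIV \<and>
        (c 0 + c 1 + c 2) + (d 0 + d 1 + d 2) = (2 + of_nat (msize n m)) * \<delta> + 3 * s}"

(* The summand vanishes unless \<gamma> i \<le> m i for all i, because of the factors [[a i]]_(\<gamma> i);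
   the sum over all multi-indices is therefore a finite one.  (This includes multi-indices
   outside that box at which a denominator also vanishes, as 0 / 0 = 0.) *)
fun E_series :: "(complex \<Rightarrow> complex) \<Rightarrow> complex \<Rightarrow> nat \<Rightarrow> (nat \<Rightarrow> nat) \<Rightarrow> params \<Rightarrow> complex" where
  "E_series br \<delta> n m (s, c, d, x) =
    (let a = (\<lambda>j. - of_nat (m j) * \<delta>); sp = shifted_prod br \<delta> in
     \<Sum>\<^sub>\<infinity>\<gamma> \<in> {1..n} \<rightarrow>\<^sub>E (UNIV :: nat set).
       Delta br n (\<lambda>i. x i + of_nat (\<gamma> i) * \<delta>) / Delta br n x
       * (\<Prod>i=1..n. br (of_nat (msize n \<gamma> + \<gamma> i) * \<delta> + s + x i) / br (s + x i))
       * (\<Prod>j=1..n.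
            sp (s + x j) (msize n \<gamma>) / sp (\<delta> + s - a j + x j) (msize n \<gamma>)
            * (\<Prod>i=1..n. sp (a j + x i - x j) (\<gamma> i) / sp (\<delta> + x i - x j) (\<gamma> i)))
       * (\<Prod>k=0..2.
            sp (d k) (msize n \<gamma>) / sp (\<delta> + s - c k) (msize n \<gamma>)
            * (\<Prod>i=1..n. sp (c k + x i) (\<gamma> i) / sp (\<delta> + s - d k + x i) (\<gamma> i))))"

fun E_tilde :: "(complex \<Rightarrow> complex) \<Rightarrow> complex \<Rightarrow> nat \<Rightarrow> (nat \<Rightarrow> nat) \<Rightarrow> params \<Rightarrow> complex" where
  "E_tilde br \<delta> n m (s, c, d, x) =
    (let sp = shifted_prod br \<delta> in
     (\<Prod>k=0..2. sp (\<delta> + s - c k) (msize n m) * (\<Prod>i=1..n. sp (\<delta> + s - d k + x i) (m i)))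
     / (\<Prod>i=1..n. sp (\<delta> + s + x i) (m i))
     * E_series br \<delta> n m (s, c, d, x))"

(* All denominators occurring in E_tilde are nonzero, where \<gamma> runs over the multi-indices at
   which the series has not terminated. *)
fun generic :: "(complex \<Rightarrow> complex) \<Rightarrow> complex \<Rightarrow> nat \<Rightarrow> (nat \<Rightarrow> nat) \<Rightarrow> params \<Rightarrow> bool" where
  "generic br \<delta> n m (s, c, d, x) \<longleftrightarrow>
    (let a = (\<lambda>j. - of_nat (m j) * \<delta>); sp = shifted_prod br \<delta> in
     Delta br n x \<noteq> 0 \<and>
     (\<forall>i\<in>{1..n}. br (s + x i) \<noteq> 0 \<and> sp (\<delta> + s + x i) (m i) \<noteq> 0) \<and>
     (\<forall>\<gamma> \<in> {1..n} \<rightarrow>\<^sub>E UNIV. (\<forall>i\<in>{1..n}. \<gamma> i \<le> m i) \<longrightarrow>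
        (\<forall>j\<in>{1..n}. sp (\<delta> + s - a j + x j) (msize n \<gamma>) \<noteq> 0 \<and>
           (\<forall>i\<in>{1..n}. sp (\<delta> + x i - x j) (\<gamma> i) \<noteq> 0)) \<and>
        (\<forall>k\<in>{0..2}. sp (\<delta> + s - c k) (msize n \<gamma>) \<noteq> 0 \<and>
           (\<forall>i\<in>{1..n}. sp (\<delta> + s - d k + x i) (\<gamma> i) \<noteq> 0))))"

fun s_map :: "nat \<Rightarrow> params \<Rightarrow> params" where
  "s_map i (s, c, d, x) = (s, c(i := c (i + 1), i + 1 := c i), d, x)"

fun t_map :: "nat \<Rightarrow> params \<Rightarrow> params" where
  "t_map i (s, c, d, x) = (s, c, d(i := d (i + 1), i + 1 := d i), x)"

fun b1_map :: "complex \<Rightarrow> params \<Rightarrow> params" where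
  "b1_map \<delta> (s, c, d, x) =
    (2 * s + \<delta> - c 0 - d 1 - d 2,
     c(0 := s + \<delta> - d 1 - d 2),
     d(1 := s + \<delta> - c 0 - d 2, 2 := s + \<delta> - c 0 - d 1),
     x)"

fun b2_map :: "complex \<Rightarrow> nat \<Rightarrow> (nat \<Rightarrow> nat) \<Rightarrow> params \<Rightarrow> params" where
  "b2_map \<delta> n m (s, c, d, x) =
    (2 * s + \<delta> - c 0 - c 1 - c 2,
     c(0 := s + \<delta> - c 1 - c 2, 1 := s + \<delta> - c 0 - c 2, 2 := s + \<delta> - c 0 - c 1),
     d,
     (\<lambda>i\<in>{1..n}. - of_nat (m i) * \<delta> - x i + of_nat (msize n m) * \<delta>))"

(* Transpositions in the symmetric group; the bare name may denote matrix transposition. *)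
abbreviation perm_swap :: "nat \<Rightarrow> nat \<Rightarrow> nat \<Rightarrow> nat" where
  "perm_swap \<equiv> Transposition.transpose"

end

theory Submission
  imports Defs "HOL-Complex_Analysis.Complex_Analysis" "HOL-Real_Asymp.Real_Asymp"
begin

text \<open>Write \<open>[z]\<close> for the sigma function, \<open>[z]\<^sub>k\<close> for the shifted product and \<open>M\<close> for the size of \<open>m\<close>.
Apart from continuity, the series sees \<open>[z]\<close> only through oddness, the countability of its zeros and the
three-term relation. The locale \<open>three_term_function\<close> collects these properties; the sigma function
has them by \<open>three_term_function_sigma\<close>.

\<^bold>\<open>Reduction to subsets.\<close> Replace each \<open>x\<^sub>i\<close> by the block of points \<open>x\<^sub>i, x\<^sub>i + \<delta>, \<dots>, x\<^sub>i + (m\<^sub>i - 1) \<delta>\<close>.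
The normalised series equals a sum over all subsets \<open>I\<close> of the \<open>M\<close> points, of the shape that the
series takes for \<open>m = (1, \<dots>, 1)\<close>. A subset that is not a union of initial segments of the blocks has weight
zero, and the unions of initial segments correspond to the multi-indices (\<open>E_tilde_eq_subset_series\<close>).
In the subset sum (\<open>subset_series\<close>) the \<open>c\<^sub>k\<close> and \<open>d\<^sub>k\<close> occur only in numerators.

\<^bold>\<open>The transformation b1.\<close> For fixed \<open>c\<^sub>1 + c\<^sub>2\<close> both sides are combinations of products of \<open>M\<close> factors
\<open>[c\<^sub>1 + a] [c\<^sub>2 + a]\<close>. By the three-term relation these factors span a plane, so both sides are
determined by their values at \<open>M + 1\<close> points, as polynomials of degree \<open>M\<close> are
(\<open>theta_form_interpolation\<close>). At \<open>c\<^sub>1 = - x\<^sub>y\<close> the subsets containing \<open>y\<close> drop out and what is left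
is the same identity with one point fewer. At \<open>c\<^sub>1 = s + M \<delta>\<close> the left side reduces to one term and the right side to
a Jackson sum. The latter is evaluated by the same induction (\<open>jackson_subsets\<close>, \<open>bailey_subsets\<close>).

\<^bold>\<open>The group.\<close> In the coordinates \<open>(u\<^sub>1, \<dots>, u\<^sub>6) = (c\<^sub>2, c\<^sub>1, c\<^sub>0, d\<^sub>0 + e, d\<^sub>1 + e, d\<^sub>2 + e)\<close>, where
\<open>e = c\<^sub>0 + c\<^sub>1 + c\<^sub>2 - 2 s - (1 + M) \<delta>\<close>, the adjacent transpositions of the first factor act as adjacent
transpositions of the \<open>u\<^sub>i\<close>, and b2 adds one number, depending only on the sum of the \<open>u\<^sub>i\<close>, to all of them.
This gives the action of the direct product. Replacing \<open>I\<close> by its complement is a termwise symmetry of the subset sum,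
and it is b2 composed with the permutation \<open>(1 6)(2 5)(3 4)\<close>
(\<open>coord_series_reverse\<close>); so b2 needs no separate summation theorem.

\<^bold>\<open>Genericity.\<close> A group element is a product of generators, and the parameters in between
may fail to be generic even if both ends are generic. Along a suitable line through the given point only
countably many points have a non-generic parameter anywhere in their orbit; the identity holds off those and extends by continuity
(\<open>coord_series_invariant\<close>, \<open>coord_series_dual_invariant\<close>).

\<^bold>\<open>The sigma function.\<close> The quotient \<open>[x + y] [x - y] / ([x + w] [x - w])\<close> is periodic in \<open>x\<close>, as one sees on
products over finite boxes of periods: a shift by a period changes only the two edges of the box, whose
contribution tends to 1. The three-term relation then follows from Liouville's theorem.\<close>

section \<open>Preliminaries\<close>

lemma countable_avoid:
  fixes Z :: "complex set"
  assumes "countable Z"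
  obtains t where "t \<notin> Z"
proof -
  have "uncountable (UNIV :: complex set)"
    by (rule connected_uncountable[of _ 0 1]) auto
  then have "Z \<noteq> UNIV" using assms by metis
  then show thesis using that by auto
qed

text \<open>Generic means off a countable set throughout; this lemma transports identities from generic to
arbitrary parameters.\<close>
lemma cont_eq_off_countable:
  fixes f g :: "complex \<Rightarrow> complex"
  assumes Z: "countable Z" and f: "isCont f a" and g: "isCont g a"
    and eq: "\<And>t. t \<notin> Z \<Longrightarrow> f t = g t"
  shows "f a = g a"
proof (rule ccontr)
  assume "f a \<noteq> g a"
  moreover have "isCont (\<lambda>t. f t - g t) a" using f g by simp
  ultimately obtain e where e: "e > 0" "\<And>t. dist a t < e \<Longrightarrow> f t - g t \<noteq> 0"
    using continuous_at_avoid[of a "\<lambda>t. f t - g t" 0] by auto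
  have "ball a e \<subseteq> Z"
    using e(2) eq by (force simp: ball_def)
  then show False using Z e(1) uncountable_ball countable_subset by metis
qed

text \<open>Bijectivity is automatic: the inverse of \<open>f g\<close> on \<open>E\<close> is \<open>f\<close> at the inverse of \<open>g\<close>.\<close>
lemma group_actionI:
  fixes G (structure)
  assumes G: "group G"
    and closed: "\<And>g p. \<lbrakk>g \<in> carrier G; p \<in> E\<rbrakk> \<Longrightarrow> f g p \<in> E"
    and one: "\<And>p. p \<in> E \<Longrightarrow> f \<one>\<^bsub>G\<^esub> p = p"
    and mult: "\<And>g h p. \<lbrakk>g \<in> carrier G; h \<in> carrier G; p \<in> E\<rbrakk> \<Longrightarrow> f (g \<otimes>\<^bsub>G\<^esub> h) p = f g (f h p)"
  shows "group_action G E (\<lambda>g. restrict (f g) E)"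
proof -
  interpret group G by (rule G)
  have Bij: "restrict (f g) E \<in> Bij E" if g: "g \<in> carrier G" for g
  proof -
    have "f (inv g) (f g p) = p" "f g (f (inv g) p) = p" if "p \<in> E" for p
      using mult[of "inv g" g p] mult[of g "inv g" p] one[OF that] g that by simp_all
    then have "bij_betw (f g) E E"
      using closed g by (intro bij_betw_byWitness[where f' = "f (inv g)"]) auto
    then show ?thesis by (simp add: Bij_def cong: bij_betw_cong)
  qed
  have "group_hom G (BijGroup E) (\<lambda>g. restrict (f g) E)"
  proof (intro group_hom.intro group_hom_axioms.intro G group_BijGroup homI)
    show "restrict (f g) E \<in> carrier (BijGroup E)" if "g \<in> carrier G" for g
      using Bij[OF that] by (simp add: BijGroup_def)
    show "restrict (f (g \<otimes> h)) E = restrict (f g) E \<otimes>\<^bsub>BijGroup E\<^esub> restrict (f h) E"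
      if "g \<in> carrier G" "h \<in> carrier G" for g h
      using Bij that mult closed by (auto simp: BijGroup_def compose_def fun_eq_iff)
  qed
  then show ?thesis by (simp add: group_action_def)
qed

lemma compose_permutes_extensional:
  assumes "u \<in> extensional S" "p permutes S"
  shows "u \<circ> p \<in> extensional S"
  using assms by (auto simp: extensional_def permutes_def)

lemma permutes_two: "p permutes {1..2 :: nat} \<longleftrightarrow> p = id \<or> p = perm_swap 1 2"
proof
  assume p: "p permutes {1..2}"
  have "{1..2 :: nat} = {1, 2}" by auto
  then have p': "p permutes {1, 2}" using p by simp
  then have "p 1 \<in> {1, 2}" "p 2 \<in> {1, 2}" "p 1 \<noteq> p 2"
    using permutes_in_image[OF p', of 1] permutes_in_image[OF p', of 2] permutes_inj[OF p'] by (auto simp: inj_eq)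
  moreover have "p k = k" if "k \<noteq> 1" "k \<noteq> 2" for k
    using p' that by (auto simp: permutes_def)
  ultimately have "(p 1 = 1 \<and> p 2 = 2 \<or> p 1 = 2 \<and> p 2 = 1) \<and> (\<forall>k. k \<noteq> 1 \<longrightarrow> k \<noteq> 2 \<longrightarrow> p k = k)"
    by auto
  then have "(\<forall>k. p k = id k) \<or> (\<forall>k. p k = perm_swap 1 2 k)"
    unfolding Transposition.transpose_def id_def by metis
  then show "p = id \<or> p = perm_swap 1 2" by blast
next
  show "p = id \<or> p = perm_swap 1 2 \<Longrightarrow> p permutes {1..2}"
    by (auto intro: permutes_id permutes_swap_id)
qed

section \<open>Functions with a three-term relation\<close>

text \<open>The third assumption is the addition formula of the sigma function: the products \<open>[a + q] [a - q]\<close>, for varying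
\<open>a\<close>, lie in a two-dimensional space of functions of \<open>q\<close>.\<close>
locale three_term_function =
  fixes br :: "complex \<Rightarrow> complex" and \<delta> :: complex
  assumes odd: "br (- z) = - br z"
    and three_term: "br (a + b) * br (a - b) * (br (c + q) * br (c - q))
      + br (b + c) * br (b - c) * (br (a + q) * br (a - q))
      + br (c + a) * br (c - a) * (br (b + q) * br (b - q)) = 0"
    and continuous: "isCont br z"
    and countable_zeros: "countable {z. br z = 0}"
begin

abbreviation sp :: "complex \<Rightarrow> nat \<Rightarrow> complex" where "sp \<equiv> shifted_prod br \<delta>"

definition pm_prod :: "complex \<Rightarrow> complex \<Rightarrow> complex" where
  "pm_prod p q = br (p + q) * br (p - q)"

lemma three_term_pm_prod: "pm_prod a b * pm_prod c q + pm_prod b c * pm_prod a q + pm_prod c a * pm_prod b q = 0"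
  using three_term[of a b c q] by (simp add: pm_prod_def)

lemma br_zero [simp]: "br 0 = 0"
  using odd[of 0] by simp

lemma br_minus_commute: "br (a - b) = - br (b - a)"
  using odd[of "b - a"] by simp

lemma countable_affine_zeros:
  assumes "k \<noteq> 0"
  shows "countable {t. br (a + k * t) = 0}"
proof -
  have "{t. br (a + k * t) = 0} \<subseteq> (\<lambda>z. (z - a) / k) ` {z. br z = 0}"
    using assms by (force simp: field_simps)
  then show ?thesis using countable_subset[OF _ countable_image[OF countable_zeros]] by blast
qed

lemma countable_shift_zeros:
  "countable {t. br (a + t) = 0}" "countable {t. br (t + a) = 0}"
  "countable {t. br (a - t) = 0}" "countable {t. br (t - a) = 0}"
  using countable_affine_zeros[of 1 a] countable_affine_zeros[of "-1" a] countable_affine_zeros[of 1 "-a"]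
  by (simp_all add: add.commute)

section \<open>Interpolation by products of a three-term function\<close>

text \<open>A product of \<open>N\<close> factors \<open>[z + a] [\<kappa> - z + a]\<close> is, after centring at \<open>\<kappa> / 2\<close>, a product of \<open>N\<close> factors
\<open>pm_prod a' q\<close>. By the three-term relation each of them is a combination of \<open>pm_prod b q\<close> and \<open>pm_prod c q\<close> for
any admissible \<open>b\<close> and \<open>c\<close>, so the product is a homogeneous polynomial of degree \<open>N\<close> in these two. The
polynomial \<open>P\<close> is its dehomogenisation. Quantifying over all \<open>b\<close> and \<open>c\<close> leaves the reference pair free until
the points of interpolation are known.\<close>
definition theta_form :: "complex \<Rightarrow> nat \<Rightarrow> (complex \<Rightarrow> complex) \<Rightarrow> bool" where
  "theta_form \<kappa> N f \<longleftrightarrow> (\<forall>b c. pm_prod b c \<noteq> 0 \<longrightarrow>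
     (\<exists>P. degree P \<le> N \<and> (\<forall>q. pm_prod c q \<noteq> 0 \<longrightarrow> f (q + \<kappa> / 2) = pm_prod c q ^ N * poly P (pm_prod b q / pm_prod c q))))"

lemma theta_form_factor: "theta_form \<kappa> 1 (\<lambda>z. br (z + a) * br (\<kappa> - z + a))"
  unfolding theta_form_def
proof (intro allI impI)
  fix b c assume bc: "pm_prod b c \<noteq> 0"
  define a' where "a' = \<kappa> / 2 + a"
  have e: "br (q + \<kappa> / 2 + a) * br (\<kappa> - (q + \<kappa> / 2) + a) = pm_prod a' q" for q
  proof -
    have "q + \<kappa> / 2 + a = a' + q" "\<kappa> - (q + \<kappa> / 2) + a = a' - q"
      by (simp_all add: a'_def)
    then show ?thesis by (simp only: pm_prod_def)
  qed
  have "pm_prod a' q = pm_prod c q ^ 1 * poly [:- pm_prod a' b / pm_prod b c, - pm_prod c a' / pm_prod b c:] (pm_prod b q / pm_prod c q)"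
    if "pm_prod c q \<noteq> 0" for q
  proof -
    have "pm_prod b c * pm_prod a' q = - pm_prod a' b * pm_prod c q - pm_prod c a' * pm_prod b q"
      using three_term_pm_prod[of a' b c q] by algebra
    then have "pm_prod a' q = (- pm_prod a' b * pm_prod c q - pm_prod c a' * pm_prod b q) / pm_prod b c"
      using bc by (simp add: field_simps)
    also have "\<dots> = pm_prod c q ^ 1 * poly [:- pm_prod a' b / pm_prod b c, - pm_prod c a' / pm_prod b c:] (pm_prod b q / pm_prod c q)"
      using that bc by (simp add: field_simps)
    finally show ?thesis .
  qed
  then show "\<exists>P. degree P \<le> 1 \<and> (\<forall>q. pm_prod c q \<noteq> 0 \<longrightarrow>
      br (q + \<kappa> / 2 + a) * br (\<kappa> - (q + \<kappa> / 2) + a) = pm_prod c q ^ 1 * poly P (pm_prod b q / pm_prod c q))"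
    unfolding e by (intro exI[of _ "[:- pm_prod a' b / pm_prod b c, - pm_prod c a' / pm_prod b c:]"]) auto
qed

lemma theta_form_const: "theta_form \<kappa> 0 (\<lambda>z. k)"
  unfolding theta_form_def by (auto intro!: exI[of _ "[:k:]"])

lemma theta_form_mult:
  assumes "theta_form \<kappa> M f" "theta_form \<kappa> N g"
  shows "theta_form \<kappa> (M + N) (\<lambda>z. f z * g z)"
  unfolding theta_form_def
proof (intro allI impI)
  fix b c assume bc: "pm_prod b c \<noteq> 0"
  obtain P Q where "degree P \<le> M" "degree Q \<le> N"
    "\<And>q. pm_prod c q \<noteq> 0 \<Longrightarrow> f (q + \<kappa> / 2) = pm_prod c q ^ M * poly P (pm_prod b q / pm_prod c q)"
    "\<And>q. pm_prod c q \<noteq> 0 \<Longrightarrow> g (q + \<kappa> / 2) = pm_prod c q ^ N * poly Q (pm_prod b q / pm_prod c q)"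
    using assms bc unfolding theta_form_def by metis
  then show "\<exists>P. degree P \<le> M + N \<and> (\<forall>q. pm_prod c q \<noteq> 0 \<longrightarrow>
      f (q + \<kappa> / 2) * g (q + \<kappa> / 2) = pm_prod c q ^ (M + N) * poly P (pm_prod b q / pm_prod c q))"
    by (intro exI[of _ "P * Q"])
      (auto simp: power_add intro: order_trans[OF degree_mult_le add_mono])
qed

lemma theta_form_cmult: "theta_form \<kappa> N f \<Longrightarrow> theta_form \<kappa> N (\<lambda>z. k * f z)"
  using theta_form_mult[OF theta_form_const] by fastforce

lemma theta_form_add:
  assumes "theta_form \<kappa> N f" "theta_form \<kappa> N g"
  shows "theta_form \<kappa> N (\<lambda>z. f z + g z)"
  unfolding theta_form_def
proof (intro allI impI)
  fix b c assume bc: "pm_prod b c \<noteq> 0"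
  obtain P Q where "degree P \<le> N" "degree Q \<le> N"
    "\<And>q. pm_prod c q \<noteq> 0 \<Longrightarrow> f (q + \<kappa> / 2) = pm_prod c q ^ N * poly P (pm_prod b q / pm_prod c q)"
    "\<And>q. pm_prod c q \<noteq> 0 \<Longrightarrow> g (q + \<kappa> / 2) = pm_prod c q ^ N * poly Q (pm_prod b q / pm_prod c q)"
    using assms bc unfolding theta_form_def by metis
  then show "\<exists>P. degree P \<le> N \<and> (\<forall>q. pm_prod c q \<noteq> 0 \<longrightarrow>
      f (q + \<kappa> / 2) + g (q + \<kappa> / 2) = pm_prod c q ^ N * poly P (pm_prod b q / pm_prod c q))"
    by (intro exI[of _ "P + Q"]) (auto simp: algebra_simps intro: degree_add_le)
qed

lemma theta_form_zero_fun: "theta_form \<kappa> N (\<lambda>z. 0)"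
  unfolding theta_form_def by (auto intro!: exI[of _ 0])

lemma theta_form_sum:
  "(\<And>i. i \<in> S \<Longrightarrow> theta_form \<kappa> N (f i)) \<Longrightarrow> theta_form \<kappa> N (\<lambda>z. \<Sum>i\<in>S. f i z)"
  by (induction S rule: infinite_finite_induct)
    (auto intro!: theta_form_zero_fun theta_form_add)

lemma theta_form_prod:
  assumes "finite S" "\<And>i. i \<in> S \<Longrightarrow> theta_form \<kappa> 1 (f i)"
  shows "theta_form \<kappa> (card S) (\<lambda>z. \<Prod>i\<in>S. f i z)"
  using assms
proof (induction S rule: finite_induct)
  case empty
  then show ?case using theta_form_const by simp
next
  case (insert i S)
  then show ?case using theta_form_mult[of \<kappa> 1 "f i" "card S"] by auto
qed

text \<open>Choose \<open>c\<close> such that \<open>pm_prod c\<close> vanishes at none of the points. The three-term relation shows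
that two points with the same value of \<open>pm_prod b / pm_prod c\<close> satisfy \<open>[z - w] [\<kappa> - z - w] = 0\<close>, so the points of \<open>Z\<close>
give more than \<open>N\<close> distinct roots of a polynomial of degree at most \<open>N\<close>.\<close>
lemma theta_form_interpolation:
  assumes f: "theta_form \<kappa> N f"
    and Z: "finite Z" "card Z > N" "\<And>z. z \<in> Z \<Longrightarrow> f z = 0"
    and distinct: "\<And>z w. \<lbrakk>z \<in> Z; w \<in> Z; z \<noteq> w\<rbrakk> \<Longrightarrow> br (z - w) \<noteq> 0 \<and> br (\<kappa> - z - w) \<noteq> 0"
  shows "f z = 0"
proof -
  define q where "q w = w - \<kappa> / 2" for w
  have "countable (\<Union>w\<in>insert z Z. {c. br (c + q w) = 0} \<union> {c. br (c - q w) = 0})"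
    using Z(1) by (intro countable_UN countable_Un countable_shift_zeros) (auto simp: countable_finite)
  \<comment> \<open>The point \<open>z\<close> itself must be avoided too, since the conclusion is evaluated there.\<close>
  then obtain c where "c \<notin> (\<Union>w\<in>insert z Z. {c. br (c + q w) = 0} \<union> {c. br (c - q w) = 0})"
    using countable_avoid by blast
  then have c: "pm_prod c (q w) \<noteq> 0" if "w \<in> insert z Z" for w
    using that by (auto simp: pm_prod_def)
  obtain b where "b \<notin> {b. br (b + c) = 0} \<union> {b. br (b - c) = 0}"
    by (rule countable_avoid[OF countable_Un[OF countable_shift_zeros(2)[of c] countable_shift_zeros(4)[of c]]])
  then have b: "pm_prod b c \<noteq> 0" by (auto simp: pm_prod_def)
  obtain P where P: "degree P \<le> N"
    "\<And>w. pm_prod c w \<noteq> 0 \<Longrightarrow> f (w + \<kappa> / 2) = pm_prod c w ^ N * poly P (pm_prod b w / pm_prod c w)"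
    using f b unfolding theta_form_def by metis
  have fP: "f w = pm_prod c (q w) ^ N * poly P (pm_prod b (q w) / pm_prod c (q w))" if "w \<in> insert z Z" for w
    using P(2)[OF c[OF that]] by (simp add: q_def)
  have inj: "inj_on (\<lambda>w. pm_prod b (q w) / pm_prod c (q w)) Z"
  proof (rule inj_onI, rule ccontr)
    fix v w assume vw: "v \<in> Z" "w \<in> Z" "pm_prod b (q v) / pm_prod c (q v) = pm_prod b (q w) / pm_prod c (q w)" "v \<noteq> w"
    have "pm_prod b (q v) * pm_prod c (q w) = pm_prod b (q w) * pm_prod c (q v)"
      using vw c by (simp add: field_simps)
    moreover have "pm_prod (q v) b * pm_prod c (q w) + pm_prod b c * pm_prod (q v) (q w) + pm_prod c (q v) * pm_prod b (q w) = 0"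
      using three_term_pm_prod by blast
    moreover have "pm_prod (q v) b = - pm_prod b (q v)"
      by (simp add: pm_prod_def br_minus_commute[of "q v" b] add.commute)
    ultimately have "pm_prod b c * pm_prod (q v) (q w) = 0" by (simp add: algebra_simps)
    then have "pm_prod (q v) (q w) = 0" using b by simp
    moreover have "q v + q w = - (\<kappa> - v - w)" "q v - q w = v - w"
      by (simp_all add: q_def)
    ultimately show False
      using distinct[OF vw(1,2,4)] by (simp add: pm_prod_def odd del: minus_diff_eq)
  qed
  have "P = 0"
  proof (rule ccontr)
    assume P0: "P \<noteq> 0"
    have "(\<lambda>w. pm_prod b (q w) / pm_prod c (q w)) ` Z \<subseteq> {x. poly P x = 0}"
      using fP Z(3) c by fastforce
    then have "card Z \<le> degree P"
      using card_mono[OF poly_roots_finite[OF P0]] card_image[OF inj] card_poly_roots_bound[OF P0]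
      by (metis order_trans)
    then show False using P(1) Z(2) by simp
  qed
  then show ?thesis using fP[of z] by simp
qed


section \<open>Shifted products\<close>

lemma sp_0 [simp]: "sp z 0 = 1"
  by (simp add: shifted_prod_def)

lemma sp_Suc: "sp z (Suc k) = sp z k * br (z + of_nat k * \<delta>)"
  by (simp add: shifted_prod_def)

lemma sp_add: "sp z (k + l) = sp z k * sp (z + of_nat k * \<delta>) l"
  by (induction l) (simp_all add: sp_Suc algebra_simps)

lemma sp_Suc_left: "sp z (Suc k) = br z * sp (z + \<delta>) k"
  using sp_add[of z 1 k] by (simp add: sp_Suc)

text \<open>The product is read backwards and the sign of every factor is changed.\<close>
lemma sp_reflect: "sp z k = (-1) ^ k * sp (\<delta> - z - of_nat k * \<delta>) k"
proof -
  have "sp z k = (\<Prod>l<k. br (z + of_nat (k - Suc l) * \<delta>))"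
    unfolding shifted_prod_def by (rule prod.nat_diff_reindex[symmetric])
  also have "\<dots> = (\<Prod>l<k. - br (\<delta> - z - of_nat k * \<delta> + of_nat l * \<delta>))"
  proof (rule prod.cong[OF refl])
    fix l assume "l \<in> {..<k}"
    then have "z + of_nat (k - Suc l) * \<delta> = - (\<delta> - z - of_nat k * \<delta> + of_nat l * \<delta>)"
      by (simp add: of_nat_diff algebra_simps)
    then show "br (z + of_nat (k - Suc l) * \<delta>) = - br (\<delta> - z - of_nat k * \<delta> + of_nat l * \<delta>)"
      by (simp only: odd)
  qed
  also have "\<dots> = (-1) ^ k * sp (\<delta> - z - of_nat k * \<delta>) k"
    using prod.distrib[of "\<lambda>_. - 1" "\<lambda>l. br (\<delta> - z - of_nat k * \<delta> + of_nat l * \<delta>)" "{..<k}"]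
    by (simp add: shifted_prod_def)
  finally show ?thesis .
qed

lemma isCont_br [continuous_intros]: "isCont f a \<Longrightarrow> isCont (\<lambda>t. br (f t)) a"
  by (rule isCont_o2[OF _ continuous])

lemma isCont_sp [continuous_intros]: "isCont f a \<Longrightarrow> isCont (\<lambda>t. sp (f t) k) a"
  unfolding shifted_prod_def by (intro continuous_intros)

lemma theta_form_sp: "theta_form \<kappa> k (\<lambda>z. sp (\<alpha> - z) k * sp (\<alpha> - (\<kappa> - z)) k)"
proof -
  have "sp (\<alpha> - z) k * sp (\<alpha> - (\<kappa> - z)) k
      = (\<Prod>l<k. br (z + (- \<alpha> - of_nat l * \<delta>)) * br (\<kappa> - z + (- \<alpha> - of_nat l * \<delta>)))" for z
    unfolding shifted_prod_def prod.distrib[symmetric]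
  proof (rule prod.cong[OF refl])
    fix l
    have "\<alpha> - z + of_nat l * \<delta> = - (z + (- \<alpha> - of_nat l * \<delta>))"
      "\<alpha> - (\<kappa> - z) + of_nat l * \<delta> = - (\<kappa> - z + (- \<alpha> - of_nat l * \<delta>))"
      by simp_all
    then show "br (\<alpha> - z + of_nat l * \<delta>) * br (\<alpha> - (\<kappa> - z) + of_nat l * \<delta>)
        = br (z + (- \<alpha> - of_nat l * \<delta>)) * br (\<kappa> - z + (- \<alpha> - of_nat l * \<delta>))"
      by (simp only: odd) simp
  qed
  moreover have "theta_form \<kappa> (card {..<k})
      (\<lambda>z. \<Prod>l<k. br (z + (- \<alpha> - of_nat l * \<delta>)) * br (\<kappa> - z + (- \<alpha> - of_nat l * \<delta>)))"
    by (rule theta_form_prod) (simp, rule theta_form_factor)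
  ultimately show ?thesis by simp
qed

section \<open>The series over subsets\<close>

text \<open>These are the denominators of \<open>base_weight\<close>: the shift is \<open>card I\<close> for points in \<open>I\<close> and \<open>card I + 1\<close> for points
outside, hence always between 1 and \<open>card A\<close>.\<close>
definition regular :: "('a \<Rightarrow> complex) \<Rightarrow> 'a set \<Rightarrow> complex \<Rightarrow> bool" where
  "regular x A s \<longleftrightarrow> (\<forall>i\<in>A. \<forall>j\<in>A. i \<noteq> j \<longrightarrow> br (x i - x j) \<noteq> 0) \<and>
     (\<forall>i\<in>A. \<forall>r\<in>{1..card A}. br (s + x i + of_nat r * \<delta>) \<noteq> 0)"

text \<open>The term of the normalised series for \<open>m = (1, \<dots>, 1)\<close> splits into a factor free of the \<open>c\<^sub>k\<close> and \<open>d\<^sub>k\<close> and one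
factor for each of them, because the normalisation clears their denominators. Keeping the factors apart lets the summation with two pairs
and the transformation with three pairs share all preparations.\<close>
definition base_weight :: "('a \<Rightarrow> complex) \<Rightarrow> 'a set \<Rightarrow> complex \<Rightarrow> 'a set \<Rightarrow> complex" where
  "base_weight x A s I = (-1) ^ card I * (\<Prod>i\<in>I. \<Prod>j\<in>A-I. br (x i - x j - \<delta>) / br (x i - x j))
     * (\<Prod>i\<in>I. inverse (br (s + x i + of_nat (card I) * \<delta>)))
     * (\<Prod>j\<in>A-I. inverse (br (s + x j + of_nat (Suc (card I)) * \<delta>)))"

definition c_weight :: "('a \<Rightarrow> complex) \<Rightarrow> 'a set \<Rightarrow> complex \<Rightarrow> complex \<Rightarrow> 'a set \<Rightarrow> complex" where
  "c_weight x A s c I = sp (\<delta> + s - c + of_nat (card I) * \<delta>) (card A - card I) * (\<Prod>i\<in>I. br (c + x i))"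

definition d_weight :: "('a \<Rightarrow> complex) \<Rightarrow> 'a set \<Rightarrow> complex \<Rightarrow> complex \<Rightarrow> 'a set \<Rightarrow> complex" where
  "d_weight x A s d I = sp d (card I) * (\<Prod>j\<in>A-I. br (\<delta> + s - d + x j))"

lemma isCont_c_weight: "isCont f a \<Longrightarrow> isCont (\<lambda>t. c_weight x A s (f t) I) a"
  unfolding c_weight_def by (intro continuous_intros)

lemma isCont_d_weight: "isCont f a \<Longrightarrow> isCont (\<lambda>t. d_weight x A s (f t) I) a"
  unfolding d_weight_def by (intro continuous_intros)

lemma regular_subset:
  assumes "regular x A s" "B \<subseteq> A" "finite A"
  shows "regular x B s"
proof -
  have "card B \<le> card A" using assms by (simp add: card_mono)
  then show ?thesis using assms unfolding regular_def by (meson atLeastAtMost_iff order_trans subsetD)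
qed

context
  fixes x :: "'a \<Rightarrow> complex" and A :: "'a set" and y :: 'a and I :: "'a set"
  assumes A: "finite A" and y: "y \<in> A" and I: "I \<subseteq> A - {y}"
begin

lemma card_remove_less: "card I < card A"
  using A y I by (metis Diff_subset card_mono card_Diff1_less finite_Diff order_le_less_trans)

lemma card_remove_diff: "card A - card I = Suc (card (A - {y}) - card I)"
  using card_remove_less A y by (simp add: Suc_diff_Suc)

lemma diff_remove: "A - I = insert y (A - {y} - I)" "y \<notin> A - {y} - I" "finite (A - {y} - I)" "finite I"
  using A y I by (auto intro: finite_subset)

lemma c_weight_remove: "c_weight x A s c I = br (s - c + of_nat (card A) * \<delta>) * c_weight x (A - {y}) s c I"
proof -
  have e: "\<delta> + s - c + of_nat (card I) * \<delta> + of_nat (card (A - {y}) - card I) * \<delta> = s - c + of_nat (card A) * \<delta>"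
  proof -
    have "card A = Suc (card I + (card (A - {y}) - card I))"
      using card_remove_diff card_remove_less by simp
    then have "(of_nat (card A) :: complex) = 1 + of_nat (card I) + of_nat (card (A - {y}) - card I)"
      by (metis of_nat_Suc of_nat_add add.assoc)
    then show ?thesis by (simp add: algebra_simps)
  qed
  then show ?thesis
    unfolding c_weight_def card_remove_diff sp_Suc e by (simp only: mult_ac)
qed

lemma d_weight_remove: "d_weight x A s d I = br (\<delta> + s - d + x y) * d_weight x (A - {y}) s d I"
  unfolding d_weight_def diff_remove(1) using diff_remove by simp

text \<open>The factors \<open>[x\<^sub>i - x\<^sub>y]\<close> of the numerator cancel the denominators that involve \<open>y\<close> and leave \<open>[x\<^sub>i - x\<^sub>y - \<delta>]\<close>;
the first factor of the shifted product cancels the denominator contributed by the point \<open>y\<close> outside \<open>I\<close>. The result is the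
weight for \<open>A - {y}\<close> with \<open>c\<close> lowered by \<open>\<delta>\<close>.\<close>
lemma base_c_weight_remove:
  assumes "regular x A s"
  shows "base_weight x A s I * c_weight x A s (- x y) I = base_weight x (A - {y}) s I * c_weight x (A - {y}) s (- x y - \<delta>) I"
proof -
  define r where "r = card I"
  have ny: "br (s + x y + of_nat (Suc r) * \<delta>) \<noteq> 0"
  proof -
    have "Suc r \<in> {1..card A}" using card_remove_less by (simp add: r_def)
    then show ?thesis using assms y unfolding regular_def by blast
  qed
  have ni: "br (x i - x y) \<noteq> 0" if "i \<in> I" for i
    using assms y I that unfolding regular_def by blast
  have p1: "(\<Prod>i\<in>I. \<Prod>j\<in>A-I. br (x i - x j - \<delta>) / br (x i - x j)) * (\<Prod>i\<in>I. br (- x y + x i))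
      = (\<Prod>i\<in>I. \<Prod>j\<in>A-{y}-I. br (x i - x j - \<delta>) / br (x i - x j)) * (\<Prod>i\<in>I. br (- x y - \<delta> + x i))"
    unfolding prod.distrib[symmetric]
  proof (rule prod.cong[OF refl])
    fix i assume i: "i \<in> I"
    show "(\<Prod>j\<in>A-I. br (x i - x j - \<delta>) / br (x i - x j)) * br (- x y + x i)
        = (\<Prod>j\<in>A-{y}-I. br (x i - x j - \<delta>) / br (x i - x j)) * br (- x y - \<delta> + x i)"
      unfolding diff_remove(1) using ni[OF i] diff_remove by (simp add: algebra_simps)
  qed
  have p2: "(\<Prod>j\<in>A-I. inverse (br (s + x j + of_nat (Suc r) * \<delta>)))
        * sp (\<delta> + s - (- x y) + of_nat r * \<delta>) (card A - card I)
      = (\<Prod>j\<in>A-{y}-I. inverse (br (s + x j + of_nat (Suc r) * \<delta>)))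
        * sp (\<delta> + s - (- x y - \<delta>) + of_nat r * \<delta>) (card (A - {y}) - card I)"
  proof -
    have "\<delta> + s - (- x y) + of_nat r * \<delta> = s + x y + of_nat (Suc r) * \<delta>"
      "\<delta> + s - (- x y - \<delta>) + of_nat r * \<delta> = s + x y + of_nat (Suc r) * \<delta> + \<delta>"
      by (simp_all add: algebra_simps)
    then show ?thesis
      unfolding card_remove_diff sp_Suc_left diff_remove(1) using ny diff_remove by (simp add: field_simps)
  qed
  have "base_weight x A s I * c_weight x A s (- x y) I = (-1) ^ r
      * ((\<Prod>i\<in>I. \<Prod>j\<in>A-I. br (x i - x j - \<delta>) / br (x i - x j)) * (\<Prod>i\<in>I. br (- x y + x i)))
      * (\<Prod>i\<in>I. inverse (br (s + x i + of_nat r * \<delta>)))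
      * ((\<Prod>j\<in>A-I. inverse (br (s + x j + of_nat (Suc r) * \<delta>)))
        * sp (\<delta> + s - (- x y) + of_nat r * \<delta>) (card A - card I))"
    unfolding base_weight_def c_weight_def r_def by (simp only: mult_ac)
  also have "\<dots> = base_weight x (A - {y}) s I * c_weight x (A - {y}) s (- x y - \<delta>) I"
    unfolding p1 p2 unfolding base_weight_def c_weight_def r_def by (simp only: mult_ac)
  finally show ?thesis .
qed

end

text \<open>Subsets containing \<open>y\<close> contribute the factor \<open>[- x\<^sub>y + x\<^sub>y] = 0\<close>.\<close>
lemma sum_remove_point:
  assumes A: "finite A" and y: "y \<in> A" and reg: "regular x A s"
  shows "(\<Sum>I\<in>Pow A. base_weight x A s I * (c_weight x A s (- x y) I * w I))
    = (\<Sum>I\<in>Pow (A - {y}). base_weight x (A - {y}) s I * (c_weight x (A - {y}) s (- x y - \<delta>) I * w I))"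
proof -
  have "(\<Sum>I\<in>Pow A. base_weight x A s I * (c_weight x A s (- x y) I * w I))
      = (\<Sum>I\<in>Pow (A - {y}). base_weight x A s I * (c_weight x A s (- x y) I * w I))"
  proof (rule sum.mono_neutral_right)
    show "\<forall>I\<in>Pow A - Pow (A - {y}). base_weight x A s I * (c_weight x A s (- x y) I * w I) = 0"
    proof
      fix I assume "I \<in> Pow A - Pow (A - {y})"
      then have "y \<in> I" "finite I" using A by (auto intro: finite_subset)
      then have "(\<Prod>i\<in>I. br (- x y + x i)) = 0"
        by (intro prod_zero bexI[of _ y]) auto
      then show "base_weight x A s I * (c_weight x A s (- x y) I * w I) = 0" by (simp add: c_weight_def)
    qed
  qed (use A in auto)
  also have "\<dots> = (\<Sum>I\<in>Pow (A - {y}). base_weight x (A - {y}) s I * (c_weight x (A - {y}) s (- x y - \<delta>) I * w I))"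
    using base_c_weight_remove[OF A y _ reg] by (intro sum.cong refl) (simp add: mult.assoc[symmetric])
  finally show ?thesis .
qed

text \<open>For this \<open>c\<close> the shifted product ends with the factor \<open>[0]\<close>, unless it is empty.\<close>
lemma sum_top_point:
  assumes A: "finite A"
  shows "(\<Sum>I\<in>Pow A. base_weight x A s I * (c_weight x A s (s + of_nat (card A) * \<delta>) I * w I))
    = base_weight x A s A * (c_weight x A s (s + of_nat (card A) * \<delta>) A * w A)"
proof -
  have "(\<Sum>I\<in>Pow A. base_weight x A s I * (c_weight x A s (s + of_nat (card A) * \<delta>) I * w I))
      = (\<Sum>I\<in>{A}. base_weight x A s I * (c_weight x A s (s + of_nat (card A) * \<delta>) I * w I))"
  proof (rule sum.mono_neutral_right)
    show "\<forall>I\<in>Pow A - {A}. base_weight x A s I * (c_weight x A s (s + of_nat (card A) * \<delta>) I * w I) = 0"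
    proof
      fix I assume "I \<in> Pow A - {A}"
      then have lt: "card I < card A" using A by (auto intro: psubset_card_mono)
      then obtain k where k: "card A - card I = Suc k" by (metis Suc_diff_Suc)
      then have "card A = card I + Suc k" using lt by simp
      then have "\<delta> + s - (s + of_nat (card A) * \<delta>) + of_nat (card I) * \<delta> + of_nat k * \<delta> = 0"
        by (simp add: algebra_simps)
      then have "sp (\<delta> + s - (s + of_nat (card A) * \<delta>) + of_nat (card I) * \<delta>) (card A - card I) = 0"
        unfolding k sp_Suc by simp
      then show "base_weight x A s I * (c_weight x A s (s + of_nat (card A) * \<delta>) I * w I) = 0" by (simp add: c_weight_def)
    qed
  qed (use A in auto)
  then show ?thesis by simp
qed

lemma base_weight_top:
  assumes A: "finite A" and reg: "regular x A s"
  shows "base_weight x A s A * c_weight x A s (s + of_nat (card A) * \<delta>) A = (-1) ^ card A"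
proof -
  have "(\<Prod>i\<in>A. inverse (br (s + x i + of_nat (card A) * \<delta>))) * (\<Prod>i\<in>A. br (s + of_nat (card A) * \<delta> + x i)) = 1"
    unfolding prod.distrib[symmetric]
  proof (rule prod.neutral, rule ballI)
    fix i assume i: "i \<in> A"
    then have "card A \<ge> 1" using A by (auto simp: card_gt_0_iff Suc_le_eq)
    then have "br (s + x i + of_nat (card A) * \<delta>) \<noteq> 0" using reg i unfolding regular_def by auto
    then show "inverse (br (s + x i + of_nat (card A) * \<delta>)) * br (s + of_nat (card A) * \<delta> + x i) = 1"
      by (simp add: ac_simps)
  qed
  then show ?thesis by (simp add: base_weight_def c_weight_def)
qed

lemma theta_form_c_weight_pair:
  assumes "finite A" "I \<subseteq> A"
  shows "theta_form \<kappa> (card A) (\<lambda>z. c_weight x A s z I * c_weight x A s (\<kappa> - z) I)"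
proof -
  define \<alpha> where "\<alpha> = \<delta> + s + of_nat (card I) * \<delta>"
  have "finite I" using assms finite_subset by blast
  then have "theta_form \<kappa> (card I) (\<lambda>z. \<Prod>i\<in>I. br (z + x i) * br (\<kappa> - z + x i))"
    by (rule theta_form_prod) (rule theta_form_factor)
  from theta_form_mult[OF theta_form_sp[of \<kappa> "card A - card I" \<alpha>] this]
  have "theta_form \<kappa> (card A) (\<lambda>z. (sp (\<alpha> - z) (card A - card I) * sp (\<alpha> - (\<kappa> - z)) (card A - card I))
      * (\<Prod>i\<in>I. br (z + x i) * br (\<kappa> - z + x i)))"
    using card_mono[OF assms] by simp
  moreover have "c_weight x A s z I = sp (\<alpha> - z) (card A - card I) * (\<Prod>i\<in>I. br (z + x i))" for z
    by (simp add: c_weight_def \<alpha>_def algebra_simps)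
  ultimately show ?thesis by (simp add: prod.distrib mult_ac)
qed

text \<open>The \<open>card A\<close> points \<open>- x\<^sub>y\<close> and the point \<open>s + card A * \<delta>\<close> suffice for interpolation. Regularity separates their
differences; the last two assumptions separate their sums from \<open>\<kappa>\<close>.\<close>
lemma theta_form_eq_generic:
  assumes A: "finite A" and reg: "regular x A s"
    and F: "theta_form \<kappa> (card A) F" and G: "theta_form \<kappa> (card A) G"
    and pts: "\<And>y. y \<in> A \<Longrightarrow> F (- x y) = G (- x y)"
    and top: "F (s + of_nat (card A) * \<delta>) = G (s + of_nat (card A) * \<delta>)"
    and gen1: "\<And>y z. \<lbrakk>y \<in> A; z \<in> A\<rbrakk> \<Longrightarrow> br (\<kappa> + (x y + x z)) \<noteq> 0"
    and gen2: "\<And>y. y \<in> A \<Longrightarrow> br (\<kappa> + (x y - s - of_nat (card A) * \<delta>)) \<noteq> 0"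
  shows "F z = G z"
proof -
  define t where "t = s + of_nat (card A) * \<delta>"
  define Z where "Z = insert t ((\<lambda>y. - x y) ` A)"
  have t: "br (t + x y) \<noteq> 0" if "y \<in> A" for y
  proof -
    have "card A \<ge> 1" using A that by (auto simp: card_gt_0_iff Suc_le_eq)
    then have "br (s + x y + of_nat (card A) * \<delta>) \<noteq> 0" using reg that unfolding regular_def by auto
    then show ?thesis by (simp add: t_def ac_simps)
  qed
  have nz: "br (x i - x j) \<noteq> 0" if "i \<in> A" "j \<in> A" "i \<noteq> j" for i j
    using reg that unfolding regular_def by blast
  have "inj_on (\<lambda>y. - x y) A"
    by (rule inj_onI) (metis nz neg_equal_iff_equal right_minus_eq br_zero)
  moreover have "t \<notin> (\<lambda>y. - x y) ` A"
    using t by force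
  ultimately have card: "card Z = Suc (card A)"
    using A by (simp add: Z_def card_image)
  have FG: "theta_form \<kappa> (card A) (\<lambda>z. F z + (-1) * G z)"
    by (intro theta_form_add theta_form_cmult F G)
  have "F z + (-1) * G z = 0"
  proof (rule theta_form_interpolation[OF FG])
    show "finite Z" using A by (simp add: Z_def)
    show "card A < card Z" using card by simp
    show "F w + (-1) * G w = 0" if "w \<in> Z" for w
      using that pts top by (auto simp: Z_def t_def)
    show "br (v - w) \<noteq> 0 \<and> br (\<kappa> - v - w) \<noteq> 0" if "v \<in> Z" "w \<in> Z" "v \<noteq> w" for v w
    proof -
      consider (xx) i j where "i \<in> A" "j \<in> A" "v = - x i" "w = - x j" "i \<noteq> j"
        | (tx) j where "j \<in> A" "v = t" "w = - x j"
        | (xt) i where "i \<in> A" "v = - x i" "w = t"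
        using \<open>v \<in> Z\<close> \<open>w \<in> Z\<close> \<open>v \<noteq> w\<close> unfolding Z_def by fastforce
      then show ?thesis
      proof cases
        case xx
        have e: "v - w = x j - x i" "\<kappa> - v - w = \<kappa> + (x i + x j)" using xx by simp_all
        show ?thesis unfolding e using nz[of j i] gen1[of i j] xx by blast
      next
        case tx
        have "v - w = t + x j" "\<kappa> - v - w = \<kappa> + (x j - s - of_nat (card A) * \<delta>)"
          using tx by (simp_all add: t_def)
        then show ?thesis using gen2 t tx by metis
      next
        case xt
        have "v - w = - (t + x i)" "\<kappa> - v - w = \<kappa> + (x i - s - of_nat (card A) * \<delta>)"
          using xt by (simp_all add: t_def)
        then show ?thesis using gen2 t xt odd by (metis neg_equal_0_iff_equal)
      qed
    qed
  qed
  then show ?thesis by simp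
qed

text \<open>The genericity of \<open>\<kappa>\<close> is obtained by moving a further parameter \<open>d\<close> on which both sides depend continuously and which
shifts \<open>\<kappa>\<close>.\<close>
lemma theta_form_eq:
  assumes A: "finite A" and reg: "regular x A s"
    and F: "\<And>d. theta_form (\<kappa> - d) (card A) (F d)" and G: "\<And>d. theta_form (\<kappa> - d) (card A) (G d)"
    and pts: "\<And>d y. y \<in> A \<Longrightarrow> F d (- x y) = G d (- x y)"
    and top: "\<And>d. F d (s + of_nat (card A) * \<delta>) = G d (s + of_nat (card A) * \<delta>)"
    and cont: "\<And>d. isCont (\<lambda>d. F d z) d" "\<And>d. isCont (\<lambda>d. G d z) d"
  shows "F d z = G d z"
proof -
  define B where "B = (\<Union>y\<in>A. \<Union>w\<in>A. {d. br (\<kappa> + (x y + x w) - d) = 0})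
     \<union> (\<Union>y\<in>A. {d. br (\<kappa> + (x y - s - of_nat (card A) * \<delta>) - d) = 0})"
  have B: "countable B"
    unfolding B_def using A by (intro countable_Un countable_UN countable_shift_zeros) (auto simp: countable_finite)
  show ?thesis
  proof (rule cont_eq_off_countable[OF B cont])
    fix d assume d: "d \<notin> B"
    show "F d z = G d z"
    proof (rule theta_form_eq_generic[OF A reg F G pts top])
      show "br (\<kappa> - d + (x y + x w)) \<noteq> 0" if "y \<in> A" "w \<in> A" for y w
      proof -
        have "br (\<kappa> + (x y + x w) - d) \<noteq> 0" using d that unfolding B_def by blast
        then show ?thesis by (simp add: algebra_simps)
      qed
      show "br (\<kappa> - d + (x y - s - of_nat (card A) * \<delta>)) \<noteq> 0" if "y \<in> A" for y
      proof -
        have "br (\<kappa> + (x y - s - of_nat (card A) * \<delta>) - d) \<noteq> 0" using d that unfolding B_def by blast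
        then show ?thesis by (simp add: algebra_simps)
      qed
    qed
  qed
qed


section \<open>The Jackson summation\<close>

text \<open>Induction on the number of points, by interpolation in \<open>c0\<close> for fixed \<open>c0 + c1\<close>. At \<open>c0 = - x\<^sub>y\<close> the point \<open>y\<close> is removed and
the remaining factors of both sides agree; at \<open>c0 = s + N \<delta>\<close> only the subset \<open>A\<close> contributes.\<close>
lemma jackson_subsets:
  assumes "finite A" "regular x A s"
    and "c0 + c1 + d0 + d1 = (1 + of_nat (card A)) * \<delta> + 2 * s"
  shows "(\<Sum>I\<in>Pow A. base_weight x A s I * (c_weight x A s c0 I * (c_weight x A s c1 I * (d_weight x A s d0 I * d_weight x A s d1 I))))
    = (-1) ^ card A * sp (\<delta> + s - d0 - c0) (card A) * sp (\<delta> + s - d1 - c0) (card A)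
      * (\<Prod>i\<in>A. br (\<delta> + s - d0 - d1 + x i))"
  using assms
proof (induction "card A" arbitrary: A c0 c1 d0)
  case (0 A)
  then show ?case by (simp add: base_weight_def c_weight_def d_weight_def)
next
  case (Suc n A)
  define N where "N = card A"
  define \<kappa> where "\<kappa> = (1 + of_nat N) * \<delta> + 2 * s - d1"
  define F where "F d z = (\<Sum>I\<in>Pow A. base_weight x A s I *
      (c_weight x A s z I * (c_weight x A s (\<kappa> - d - z) I * (d_weight x A s d I * d_weight x A s d1 I))))" for d z
  define G where "G d z = (-1) ^ N * sp (\<delta> + s - d - z) N * sp (\<delta> + s - d1 - z) N
      * (\<Prod>i\<in>A. br (\<delta> + s - d - d1 + x i))" for d z
  note A = \<open>finite A\<close> and reg = \<open>regular x A s\<close>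
  have "F d0 c0 = G d0 c0"
  proof (rule theta_form_eq[where F = F and G = G and \<kappa> = \<kappa>, OF A reg])
    show "theta_form (\<kappa> - d) (card A) (F d)" for d
    proof -
      have "theta_form (\<kappa> - d) (card A) (\<lambda>z. \<Sum>I\<in>Pow A. (base_weight x A s I * (d_weight x A s d I * d_weight x A s d1 I))
          * (c_weight x A s z I * c_weight x A s (\<kappa> - d - z) I))"
        by (intro theta_form_sum theta_form_cmult theta_form_c_weight_pair A) auto
      then show ?thesis unfolding F_def by (simp only: mult_ac)
    qed
    show "theta_form (\<kappa> - d) (card A) (G d)" for d
    proof -
      define \<alpha> where "\<alpha> = \<delta> + s - d"
      have "G d z = (\<Prod>i\<in>A. br (\<delta> + s - d - d1 + x i)) * (sp (\<alpha> - z) N * sp (\<alpha> - (\<kappa> - d - z)) N)" for z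
      proof -
        have e: "\<delta> - (\<delta> + s - d1 - z) - of_nat N * \<delta> = \<alpha> - (\<kappa> - d - z)"
          by (simp add: \<alpha>_def \<kappa>_def algebra_simps)
        have "sp (\<delta> + s - d1 - z) N = (-1) ^ N * sp (\<alpha> - (\<kappa> - d - z)) N"
          by (subst sp_reflect) (simp only: e)
        moreover have "(-1 :: complex) ^ N * (-1) ^ N = 1"
          by (simp add: power_mult_distrib[symmetric])
        ultimately show ?thesis by (simp add: G_def \<alpha>_def mult_ac)
      qed
      then have "G d = (\<lambda>z. (\<Prod>i\<in>A. br (\<delta> + s - d - d1 + x i)) * (sp (\<alpha> - z) N * sp (\<alpha> - (\<kappa> - d - z)) N))"
        by (rule ext)
      then show ?thesis
        by (simp only: N_def theta_form_cmult[OF theta_form_sp])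
    qed
    show "isCont (\<lambda>d. F d c0) d" for d
      unfolding F_def by (intro continuous_intros isCont_c_weight isCont_d_weight)
    show "isCont (\<lambda>d. G d c0) d" for d
      unfolding G_def by (intro continuous_intros)
    show "F d (s + of_nat (card A) * \<delta>) = G d (s + of_nat (card A) * \<delta>)" for d
    proof -
      define t where "t = s + of_nat N * \<delta>"
      have "F d t = (base_weight x A s A * c_weight x A s t A) * (c_weight x A s (\<kappa> - d - t) A * (d_weight x A s d A * d_weight x A s d1 A))"
        unfolding F_def t_def N_def by (simp only: sum_top_point[OF A] mult.assoc)
      also have "\<dots> = (-1) ^ N * (c_weight x A s (\<kappa> - d - t) A * (d_weight x A s d A * d_weight x A s d1 A))"
        using base_weight_top[OF A reg] by (simp add: t_def N_def)
      also have "\<dots> = (-1) ^ N * ((\<Prod>i\<in>A. br (\<delta> + s - d - d1 + x i)) * (sp d N * sp d1 N))"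
      proof -
        have e: "\<kappa> - d - t = \<delta> + s - d - d1" by (simp add: \<kappa>_def t_def algebra_simps)
        show ?thesis unfolding e by (simp add: c_weight_def d_weight_def N_def)
      qed
      also have "\<dots> = G d t"
      proof -
        have e: "\<delta> - d - of_nat N * \<delta> = \<delta> + s - d - t" for d by (simp add: t_def)
        have sp: "sp d N = (-1) ^ N * sp (\<delta> + s - d - t) N" for d
          by (subst sp_reflect) (simp only: e)
        have "sp d N * sp d1 N = sp (\<delta> + s - d - t) N * sp (\<delta> + s - d1 - t) N"
          by (subst (1 2) sp) (simp add: power_mult_distrib[symmetric])
        then show ?thesis by (simp add: G_def mult_ac)
      qed
      finally show ?thesis by (simp add: t_def N_def)
    qed
    show "F d (- x y) = G d (- x y)" if y: "y \<in> A" for d y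
    proof -
      define A' where "A' = A - {y}"
      have A': "finite A'" "regular x A' s" "card A' = n"
        using A reg y Suc(2) regular_subset[OF reg _ A] by (auto simp: A'_def)
      have N: "N = Suc n" using Suc(2) by (simp add: N_def)
      define c where "c = \<kappa> - d + x y"
      define K where "K = br (s - c + of_nat N * \<delta>) * br (\<delta> + s - d + x y) * br (\<delta> + s - d1 + x y)"
      have "F d (- x y) = (\<Sum>I\<in>Pow A'. base_weight x A' s I * (c_weight x A' s (- x y - \<delta>) I
          * (c_weight x A s (\<kappa> - d - (- x y)) I * (d_weight x A s d I * d_weight x A s d1 I))))"
        unfolding F_def A'_def by (rule sum_remove_point[OF A y reg])
      also have "\<dots> = (\<Sum>I\<in>Pow A'. K * (base_weight x A' s I * (c_weight x A' s (- x y - \<delta>) I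
          * (c_weight x A' s c I * (d_weight x A' s d I * d_weight x A' s d1 I)))))"
      proof (rule sum.cong[OF refl])
        fix I assume "I \<in> Pow A'"
        then have I: "I \<subseteq> A - {y}" by (simp add: A'_def)
        have c: "\<kappa> - d - (- x y) = c" by (simp add: c_def)
        show "base_weight x A' s I * (c_weight x A' s (- x y - \<delta>) I
            * (c_weight x A s (\<kappa> - d - (- x y)) I * (d_weight x A s d I * d_weight x A s d1 I)))
          = K * (base_weight x A' s I * (c_weight x A' s (- x y - \<delta>) I * (c_weight x A' s c I * (d_weight x A' s d I * d_weight x A' s d1 I))))"
          unfolding c c_weight_remove[OF A y I, where c = c] d_weight_remove[OF A y I] K_def N_def A'_def
          by (simp only: mult_ac)
      qed
      also have "\<dots> = K * (\<Sum>I\<in>Pow A'. base_weight x A' s I * (c_weight x A' s (- x y - \<delta>) I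
          * (c_weight x A' s c I * (d_weight x A' s d I * d_weight x A' s d1 I))))"
        by (rule sum_distrib_left[symmetric])
      also have "\<dots> = K * ((-1) ^ card A' * sp (\<delta> + s - d - (- x y - \<delta>)) (card A')
          * sp (\<delta> + s - d1 - (- x y - \<delta>)) (card A') * (\<Prod>i\<in>A'. br (\<delta> + s - d - d1 + x i)))"
      proof -
        have "- x y - \<delta> + c + d + d1 = (1 + of_nat (card A')) * \<delta> + 2 * s"
          by (simp add: c_def \<kappa>_def A'(3) N algebra_simps)
        from Suc(1)[OF A'(3)[symmetric] A'(1,2) this] show ?thesis by simp
      qed
      also have "\<dots> = G d (- x y)"
      proof -
        have sp: "sp (\<delta> + s - e - (- x y)) N = br (\<delta> + s - e + x y) * sp (\<delta> + s - e - (- x y - \<delta>)) n" for e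
          unfolding N sp_Suc_left by (simp add: algebra_simps)
        have "s - c + of_nat N * \<delta> = - (\<delta> + s - d - d1 + x y)"
          by (simp add: c_def \<kappa>_def N algebra_simps)
        then have "br (s - c + of_nat N * \<delta>) = - br (\<delta> + s - d - d1 + x y)" by (simp only: odd)
        moreover have "(\<Prod>i\<in>A. br (\<delta> + s - d - d1 + x i))
            = br (\<delta> + s - d - d1 + x y) * (\<Prod>i\<in>A'. br (\<delta> + s - d - d1 + x i))"
          using A y by (simp add: A'_def prod.remove)
        ultimately show ?thesis
          unfolding G_def sp K_def A'(3) by (simp add: N)
      qed
      finally show ?thesis .
    qed
  qed
  moreover have "\<kappa> - d0 - c0 = c1"
  proof -
    have "c1 = (1 + of_nat (card A)) * \<delta> + 2 * s - c0 - d0 - d1"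
      using Suc.prems(3) by (simp add: eq_diff_eq add_ac)
    then show ?thesis by (simp add: \<kappa>_def N_def)
  qed
  ultimately show ?case by (simp add: F_def G_def N_def)
qed

section \<open>The Bailey transformation\<close>

definition subset_series :: "('a \<Rightarrow> complex) \<Rightarrow> 'a set \<Rightarrow> complex \<Rightarrow> complex \<Rightarrow> complex \<Rightarrow> complex \<Rightarrow> complex \<Rightarrow> complex \<Rightarrow> complex \<Rightarrow> complex" where
  "subset_series x A s c0 c1 c2 d0 d1 d2 = (\<Sum>I\<in>Pow A. base_weight x A s I * (c_weight x A s c1 I * (c_weight x A s c2 I *
     (c_weight x A s c0 I * (d_weight x A s d0 I * (d_weight x A s d1 I * d_weight x A s d2 I))))))"

lemma theta_form_subset_series:
  assumes "finite A"
  shows "theta_form \<kappa> (card A) (\<lambda>z. subset_series x A s c0 z (\<kappa> - z) d0 d1 d2)"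
proof -
  have "theta_form \<kappa> (card A) (\<lambda>z. \<Sum>I\<in>Pow A.
      (base_weight x A s I * (c_weight x A s c0 I * (d_weight x A s d0 I * (d_weight x A s d1 I * d_weight x A s d2 I))))
      * (c_weight x A s z I * c_weight x A s (\<kappa> - z) I))"
    by (intro theta_form_sum theta_form_cmult theta_form_c_weight_pair assms) auto
  then show ?thesis unfolding subset_series_def by (simp only: mult_ac)
qed

lemma isCont_subset_series:
  assumes "isCont f a" "isCont g a"
  shows "isCont (\<lambda>t. subset_series x A s c0 c1 (f t) (g t) d1 d2) a"
  unfolding subset_series_def using assms by (intro continuous_intros isCont_c_weight isCont_d_weight)

lemma subset_series_top:
  assumes A: "finite A" and reg: "regular x A s"
  shows "subset_series x A s c0 (s + of_nat (card A) * \<delta>) c2 d0 d1 d2 = (-1) ^ card A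
    * (\<Prod>i\<in>A. br (c2 + x i)) * (\<Prod>i\<in>A. br (c0 + x i)) * sp d0 (card A) * sp d1 (card A) * sp d2 (card A)"
proof -
  have "subset_series x A s c0 (s + of_nat (card A) * \<delta>) c2 d0 d1 d2 = (base_weight x A s A * c_weight x A s (s + of_nat (card A) * \<delta>) A)
     * (c_weight x A s c2 A * (c_weight x A s c0 A * (d_weight x A s d0 A * (d_weight x A s d1 A * d_weight x A s d2 A))))"
    unfolding subset_series_def sum_top_point[OF A] by (simp only: mult.assoc)
  then show ?thesis
    unfolding base_weight_top[OF A reg] by (simp add: c_weight_def d_weight_def)
qed

lemma subset_series_remove:
  assumes A: "finite A" and y: "y \<in> A" and reg: "regular x A s"
  shows "subset_series x A s c0 (- x y) c2 d0 d1 d2 = br (s - c2 + of_nat (card A) * \<delta>)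
      * br (s - c0 + of_nat (card A) * \<delta>)
      * br (\<delta> + s - d0 + x y) * br (\<delta> + s - d1 + x y) * br (\<delta> + s - d2 + x y)
      * subset_series x (A - {y}) s c0 (- x y - \<delta>) c2 d0 d1 d2"
  unfolding subset_series_def sum_remove_point[OF A y reg] sum_distrib_left
proof (rule sum.cong[OF refl], goal_cases)
  case (1 I)
  then have I: "I \<subseteq> A - {y}" by simp
  show ?case
    unfolding c_weight_remove[OF A y I, where c = c2] c_weight_remove[OF A y I, where c = c0] d_weight_remove[OF A y I]
    by (simp only: mult_ac)
qed

text \<open>If \<open>c + d = s + \<delta>\<close>, the two weights complete each other to products over all indices and all points, and the pair drops
out of the sum.\<close>
lemma complementary_weights:
  assumes A: "finite A" and I: "I \<subseteq> A" and cd: "c + d = s + \<delta>"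
  shows "c_weight x A s c I * d_weight x A s d I = sp d (card A) * (\<Prod>i\<in>A. br (c + x i))"
proof -
  have "\<delta> + s - c = d" "\<delta> + s - d = c"
    using cd by (simp_all add: algebra_simps)
  moreover have "sp d (card A) = sp d (card I) * sp (d + of_nat (card I) * \<delta>) (card A - card I)"
    using sp_add[of d "card I" "card A - card I"] card_mono[OF A I] by simp
  moreover have "(\<Prod>i\<in>A. br (c + x i)) = (\<Prod>i\<in>A-I. br (c + x i)) * (\<Prod>i\<in>I. br (c + x i))"
    using A I by (rule prod.subset_diff[rotated])
  ultimately show ?thesis by (simp add: c_weight_def d_weight_def mult_ac)
qed

text \<open>Induction on the number of points, by interpolation in \<open>c1\<close> for fixed \<open>c1 + c2\<close>. The parameters \<open>s\<close>, \<open>c0\<close>, \<open>d1\<close>, \<open>d2\<close> and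
\<open>\<epsilon>\<close> are not affected by the variation, and balancing ties \<open>c1 + c2\<close> to \<open>d0\<close>, which is therefore the parameter to move.\<close>
lemma bailey_subsets:
  assumes "finite A" "regular x A s" "regular x A (s + \<epsilon>)"
    and "\<epsilon> = s + \<delta> - c0 - d1 - d2"
    and "c0 + c1 + c2 + (d0 + d1 + d2) = (2 + of_nat (card A)) * \<delta> + 3 * s"
  shows "subset_series x A s c0 c1 c2 d0 d1 d2 = subset_series x A (s + \<epsilon>) (c0 + \<epsilon>) c1 c2 d0 (d1 + \<epsilon>) (d2 + \<epsilon>)"
  using assms
proof (induction "card A" arbitrary: A c1 c2 d0)
  case (0 A)
  then show ?case by (simp add: subset_series_def base_weight_def c_weight_def d_weight_def)
next
  case (Suc n A)
  define N where "N = card A"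
  define \<kappa> where "\<kappa> = (2 + of_nat N) * \<delta> + 3 * s - c0 - d1 - d2"
  define F where "F d z = subset_series x A s c0 z (\<kappa> - d - z) d d1 d2" for d z
  define G where "G d z = subset_series x A (s + \<epsilon>) (c0 + \<epsilon>) z (\<kappa> - d - z) d (d1 + \<epsilon>) (d2 + \<epsilon>)" for d z
  note A = \<open>finite A\<close> and reg = \<open>regular x A s\<close> and reg' = \<open>regular x A (s + \<epsilon>)\<close>
    and \<epsilon> = \<open>\<epsilon> = s + \<delta> - c0 - d1 - d2\<close>
  have "F d0 c1 = G d0 c1"
  proof (rule theta_form_eq[where F = F and G = G and \<kappa> = \<kappa>, OF A reg])
    show "theta_form (\<kappa> - d) (card A) (F d)" "theta_form (\<kappa> - d) (card A) (G d)" for d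
      unfolding F_def G_def by (rule theta_form_subset_series[OF A])+
    show "isCont (\<lambda>d. F d c1) d" "isCont (\<lambda>d. G d c1) d" for d
      unfolding F_def G_def by (intro isCont_subset_series continuous_intros)+
    show "F d (s + of_nat (card A) * \<delta>) = G d (s + of_nat (card A) * \<delta>)" for d
    proof -
      define t where "t = s + of_nat N * \<delta>"
      define c2' where "c2' = \<kappa> - d - t"
      \<comment> \<open>Here \<open>c2'\<close> and \<open>d\<close> are complementary for \<open>s + \<epsilon>\<close>, which leaves a Jackson sum on the right.\<close>
      have c2': "c2' + d = s + \<epsilon> + \<delta>"
        by (simp add: c2'_def \<kappa>_def t_def \<epsilon> algebra_simps)
      have "G d t = (\<Sum>I\<in>Pow A. sp d N * (\<Prod>i\<in>A. br (c2' + x i)) * (base_weight x A (s + \<epsilon>) I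
          * (c_weight x A (s + \<epsilon>) (c0 + \<epsilon>) I * (c_weight x A (s + \<epsilon>) t I
          * (d_weight x A (s + \<epsilon>) (d1 + \<epsilon>) I * d_weight x A (s + \<epsilon>) (d2 + \<epsilon>) I)))))"
        unfolding G_def subset_series_def c2'_def[symmetric]
      proof (rule sum.cong[OF refl], goal_cases)
        case (1 I)
        then have "c_weight x A (s + \<epsilon>) c2' I * d_weight x A (s + \<epsilon>) d I = sp d N * (\<Prod>i\<in>A. br (c2' + x i))"
          using complementary_weights[OF A _ c2'] by (simp add: N_def)
        then show ?case by (simp add: mult_ac)
      qed
      also have "\<dots> = sp d N * (\<Prod>i\<in>A. br (c2' + x i)) * (\<Sum>I\<in>Pow A. base_weight x A (s + \<epsilon>) I
          * (c_weight x A (s + \<epsilon>) (c0 + \<epsilon>) I * (c_weight x A (s + \<epsilon>) t I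
          * (d_weight x A (s + \<epsilon>) (d1 + \<epsilon>) I * d_weight x A (s + \<epsilon>) (d2 + \<epsilon>) I))))"
        by (rule sum_distrib_left[symmetric])
      also have "\<dots> = sp d N * (\<Prod>i\<in>A. br (c2' + x i)) * ((-1) ^ N
          * sp (\<delta> + (s + \<epsilon>) - (d1 + \<epsilon>) - (c0 + \<epsilon>)) N * sp (\<delta> + (s + \<epsilon>) - (d2 + \<epsilon>) - (c0 + \<epsilon>)) N
          * (\<Prod>i\<in>A. br (\<delta> + (s + \<epsilon>) - (d1 + \<epsilon>) - (d2 + \<epsilon>) + x i)))"
      proof -
        have "c0 + \<epsilon> + t + (d1 + \<epsilon>) + (d2 + \<epsilon>) = (1 + of_nat (card A)) * \<delta> + 2 * (s + \<epsilon>)"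
          by (simp add: t_def \<epsilon> N_def algebra_simps)
        from jackson_subsets[OF A reg' this] show ?thesis by (simp add: N_def)
      qed
      also have "\<dots> = F d t"
      proof -
        have e: "\<delta> + (s + \<epsilon>) - (d1 + \<epsilon>) - (c0 + \<epsilon>) = d2" "\<delta> + (s + \<epsilon>) - (d2 + \<epsilon>) - (c0 + \<epsilon>) = d1"
          "\<delta> + (s + \<epsilon>) - (d1 + \<epsilon>) - (d2 + \<epsilon>) = c0"
          by (simp_all add: \<epsilon>)
        have "F d t = subset_series x A s c0 (s + of_nat (card A) * \<delta>) c2' d d1 d2"
          by (simp add: F_def c2'_def t_def N_def)
        then show ?thesis
          unfolding e subset_series_top[OF A reg] by (simp only: mult_ac N_def)
      qed
      finally show ?thesis by (simp add: t_def N_def)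
    qed
    show "F d (- x y) = G d (- x y)" if y: "y \<in> A" for d y
    proof -
      define A' where "A' = A - {y}"
      have A': "finite A'" "regular x A' s" "regular x A' (s + \<epsilon>)" "card A' = n"
        using A reg y Suc(2) regular_subset[OF reg _ A] regular_subset[OF reg' _ A] by (auto simp: A'_def)
      have N: "N = Suc n" using Suc(2) by (simp add: N_def)
      define c where "c = \<kappa> - d - (- x y)"
      have "c0 + (- x y - \<delta>) + c + (d + d1 + d2) = (2 + of_nat (card A')) * \<delta> + 3 * s"
        by (simp add: c_def \<kappa>_def A'(4) N algebra_simps)
      from Suc(1)[OF A'(4)[symmetric] A'(1-3) \<epsilon> this]
      have IH: "subset_series x A' s c0 (- x y - \<delta>) c d d1 d2
        = subset_series x A' (s + \<epsilon>) (c0 + \<epsilon>) (- x y - \<delta>) c d (d1 + \<epsilon>) (d2 + \<epsilon>)" .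
      \<comment> \<open>The factors split off on the two sides agree after an exchange of two of them.\<close>
      have e: "s + \<epsilon> - c + of_nat N * \<delta> = - (\<delta> + s - d + x y)"
          "s - c + of_nat N * \<delta> = - (\<delta> + (s + \<epsilon>) - d + x y)"
        by (simp_all add: c_def \<kappa>_def \<epsilon> N algebra_simps)
      have e': "s + \<epsilon> - (c0 + \<epsilon>) = s - c0" "\<delta> + (s + \<epsilon>) - (d1 + \<epsilon>) = \<delta> + s - d1"
          "\<delta> + (s + \<epsilon>) - (d2 + \<epsilon>) = \<delta> + s - d2"
        by simp_all
      show ?thesis
        unfolding F_def G_def c_def[symmetric] subset_series_remove[OF A y reg] subset_series_remove[OF A y reg']
          N_def[symmetric] A'_def[symmetric] IH e e' odd
        by (simp only: mult_ac mult_minus_left mult_minus_right)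
    qed
  qed
  moreover have "\<kappa> - d0 - c1 = c2"
  proof -
    have "c2 = (2 + of_nat (card A)) * \<delta> + 3 * s - c0 - c1 - d0 - d1 - d2"
      using Suc.prems(5) by (simp add: eq_diff_eq add_ac)
    then show ?thesis by (simp add: \<kappa>_def N_def)
  qed
  ultimately show ?case by (simp add: F_def G_def)
qed

section \<open>Reversing the order of summation\<close>

text \<open>Complementing \<open>I\<close> exchanges the two products over points; the reflected parameters exchange the shifts \<open>card I\<close>
and \<open>card I + 1\<close> accordingly, and the signs coming from oddness account for the changed power of \<open>-1\<close>.\<close>
lemma base_weight_reverse:
  assumes A: "finite A" and I: "I \<subseteq> A"
  defines "N \<equiv> card A"
  shows "base_weight (\<lambda>i. (of_nat N - 1) * \<delta> - x i) A (- s - 2 * of_nat N * \<delta>) (A - I) = base_weight x A s I"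
proof -
  define r where "r = card I"
  define X where "X i = (of_nat N - 1) * \<delta> - x i" for i
  have fin: "finite I" "finite (A - I)" and AI: "A - (A - I) = I"
    using A I finite_subset by auto
  have N: "N = r + card (A - I)"
    using card_mono[OF A I] card_Diff_subset[OF fin(1) I] by (simp add: N_def r_def)
  have p1: "(\<Prod>i\<in>A-I. \<Prod>j\<in>I. br (X i - X j - \<delta>) / br (X i - X j))
      = (\<Prod>i\<in>I. \<Prod>j\<in>A-I. br (x i - x j - \<delta>) / br (x i - x j))"
    by (subst prod.swap) (simp add: X_def)
  have neg: "(\<Prod>i\<in>S. inverse (br (- f i))) = (-1) ^ card S * (\<Prod>i\<in>S. inverse (br (f i)))" for S :: "'a set" and f
    using prod.distrib[of "\<lambda>_. - 1" "\<lambda>i. inverse (br (f i))" S] by (simp add: odd)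
  have p2: "(\<Prod>i\<in>A-I. inverse (br (- s - 2 * of_nat N * \<delta> + X i + of_nat (card (A - I)) * \<delta>)))
      = (-1) ^ card (A - I) * (\<Prod>i\<in>A-I. inverse (br (s + x i + of_nat (Suc r) * \<delta>)))"
  proof -
    have "- s - 2 * of_nat N * \<delta> + X i + of_nat (card (A - I)) * \<delta> = - (s + x i + of_nat (Suc r) * \<delta>)" for i
      by (simp add: X_def N algebra_simps)
    then show ?thesis by (simp only: neg)
  qed
  have p3: "(\<Prod>i\<in>I. inverse (br (- s - 2 * of_nat N * \<delta> + X i + of_nat (Suc (card (A - I))) * \<delta>)))
      = (-1) ^ r * (\<Prod>i\<in>I. inverse (br (s + x i + of_nat r * \<delta>)))"
  proof -
    have "- s - 2 * of_nat N * \<delta> + X i + of_nat (Suc (card (A - I))) * \<delta> = - (s + x i + of_nat r * \<delta>)" for i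
      by (simp add: X_def N algebra_simps)
    then show ?thesis by (simp only: neg r_def)
  qed
  have "(-1 :: complex) ^ card (A - I) * (-1) ^ card (A - I) = 1"
    by (simp add: power_mult_distrib[symmetric])
  then show ?thesis
    unfolding base_weight_def AI X_def[symmetric] p1 p2 p3 r_def[symmetric] by (simp add: mult_ac)
qed

lemma c_d_weight_reverse:
  assumes A: "finite A" and I: "I \<subseteq> A"
  defines "N \<equiv> card A"
  shows "c_weight (\<lambda>i. (of_nat N - 1) * \<delta> - x i) A (- s - 2 * of_nat N * \<delta>) (d - s - of_nat N * \<delta>) (A - I)
      = (-1) ^ N * d_weight x A s d I"
    and "d_weight (\<lambda>i. (of_nat N - 1) * \<delta> - x i) A (- s - 2 * of_nat N * \<delta>) (c - s - of_nat N * \<delta>) (A - I)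
      = (-1) ^ N * c_weight x A s c I"
proof -
  define r where "r = card I"
  have fin: "finite I" "finite (A - I)" and AI: "A - (A - I) = I"
    using A I finite_subset by auto
  have N: "N = r + card (A - I)" and Nr: "N - card (A - I) = r" "N - r = card (A - I)"
    using card_mono[OF A I] card_Diff_subset[OF fin(1) I] by (simp_all add: N_def r_def)
  have neg: "(\<Prod>i\<in>S. br (- f i)) = (-1) ^ card S * (\<Prod>i\<in>S. br (f i))" for S :: "'a set" and f
    using prod.distrib[of "\<lambda>_. - 1" "\<lambda>i. br (f i)" S] by (simp add: odd)
  have sq: "(-1 :: complex) ^ k * (-1) ^ k = 1" for k by (simp add: power_mult_distrib[symmetric])
  have e1: "\<delta> + (- s - 2 * of_nat N * \<delta>) - (d - s - of_nat N * \<delta>) + of_nat (card (A - I)) * \<delta> = \<delta> - d - of_nat r * \<delta>"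
    by (simp add: N algebra_simps)
  have e2: "(\<Prod>i\<in>A - I. br (d - s - of_nat N * \<delta> + ((of_nat N - 1) * \<delta> - x i)))
      = (-1) ^ card (A - I) * (\<Prod>i\<in>A - I. br (\<delta> + s - d + x i))"
    unfolding neg[symmetric] by (simp add: algebra_simps)
  have e3: "sp (\<delta> - d - of_nat r * \<delta>) r = (-1) ^ r * sp d r"
    using sp_reflect[of d r] sq[of r] by simp
  show "c_weight (\<lambda>i. (of_nat N - 1) * \<delta> - x i) A (- s - 2 * of_nat N * \<delta>) (d - s - of_nat N * \<delta>) (A - I)
      = (-1) ^ N * d_weight x A s d I"
    unfolding c_weight_def d_weight_def N_def[symmetric] Nr r_def[symmetric] e1 e2 e3 by (simp add: N power_add mult_ac)
  have e: "\<delta> - (\<delta> + s - c + of_nat r * \<delta>) - of_nat (card (A - I)) * \<delta> = c - s - of_nat N * \<delta>"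
    by (simp add: N algebra_simps)
  have "sp (\<delta> + s - c + of_nat r * \<delta>) (card (A - I)) = (-1) ^ card (A - I) * sp (c - s - of_nat N * \<delta>) (card (A - I))"
    by (subst sp_reflect) (simp only: e)
  moreover have "(\<Prod>i\<in>I. br (\<delta> + (- s - 2 * of_nat N * \<delta>) - (c - s - of_nat N * \<delta>) + ((of_nat N - 1) * \<delta> - x i)))
      = (-1) ^ r * (\<Prod>i\<in>I. br (c + x i))"
    unfolding r_def neg[symmetric] by (simp add: algebra_simps)
  ultimately show "d_weight (\<lambda>i. (of_nat N - 1) * \<delta> - x i) A (- s - 2 * of_nat N * \<delta>) (c - s - of_nat N * \<delta>) (A - I)
      = (-1) ^ N * c_weight x A s c I"
    unfolding c_weight_def d_weight_def N_def[symmetric] Nr r_def[symmetric] AI using sq[of "card (A - I)"]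
    by (simp add: N power_add mult_ac)
qed

lemma subset_series_reverse:
  fixes x :: "'a \<Rightarrow> complex" and s c0 c1 c2 d0 d1 d2 :: complex
  assumes A: "finite A"
  defines "N \<equiv> card A"
  defines "\<eta> \<equiv> - s - of_nat N * \<delta>"
  shows "subset_series (\<lambda>i. (of_nat N - 1) * \<delta> - x i) A (- s - 2 * of_nat N * \<delta>)
      (d0 + \<eta>) (d1 + \<eta>) (d2 + \<eta>) (c0 + \<eta>) (c1 + \<eta>) (c2 + \<eta>) = subset_series x A s c0 c1 c2 d0 d1 d2"
proof -
  let ?X = "\<lambda>i. (of_nat N - 1) * \<delta> - x i" and ?s = "- s - 2 * of_nat N * \<delta>"
  have \<eta>: "z + \<eta> = z - s - of_nat N * \<delta>" for z by (simp add: \<eta>_def)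
  have sq: "(-1 :: complex) ^ N * ((-1) ^ N * z) = z" for z by (simp add: power_mult_distrib[symmetric] flip: mult.assoc)
  have bij: "bij_betw (\<lambda>I. A - I) (Pow A) (Pow A)"
    by (rule bij_betw_byWitness[where f' = "\<lambda>I. A - I"]) auto
  show ?thesis
    unfolding subset_series_def
  proof (rule sum.reindex_bij_betw[OF bij, symmetric, THEN trans], rule sum.cong[OF refl], goal_cases)
    case (1 I)
    then have I: "I \<subseteq> A" by simp
    show ?case
      unfolding \<eta> base_weight_reverse[OF A I, folded N_def] c_d_weight_reverse[OF A I, folded N_def]
      by (simp add: mult_ac sq)
  qed
qed

section \<open>From multi-indices to subsets\<close>

lemma sp_eq_0_iff: "sp z k = 0 \<longleftrightarrow> (\<exists>l<k. br (z + of_nat l * \<delta>) = 0)"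
  by (auto simp: shifted_prod_def)

lemma prod_br_interval:
  assumes "k \<le> m"
  shows "(\<Prod>a\<in>{k..<m}. br (z + of_nat a * \<delta>)) = sp (z + of_nat k * \<delta>) (m - k)"
  unfolding shifted_prod_def
  by (simp add: prod.atLeastLessThan_shift_0[of _ k] lessThan_atLeast0 algebra_simps)

lemma prod_telescope:
  assumes "k \<le> m" "\<And>b. \<lbrakk>k \<le> b; b \<le> m\<rbrakk> \<Longrightarrow> br (z - of_nat b * \<delta>) \<noteq> 0"
  shows "(\<Prod>b\<in>{k..<m}. br (z - of_nat b * \<delta> - \<delta>) / br (z - of_nat b * \<delta>))
    = br (z - of_nat m * \<delta>) / br (z - of_nat k * \<delta>)"
  using assms
proof (induction m rule: dec_induct)
  case base
  then show ?case by simp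
next
  case (step m)
  have e: "z - of_nat m * \<delta> - \<delta> = z - of_nat (Suc m) * \<delta>" by (simp add: algebra_simps)
  have "br (z - of_nat m * \<delta>) \<noteq> 0" using step by simp
  moreover have "(\<Prod>b\<in>{k..<m}. br (z - of_nat b * \<delta> - \<delta>) / br (z - of_nat b * \<delta>))
    = br (z - of_nat m * \<delta>) / br (z - of_nat k * \<delta>)"
    using step by simp
  ultimately show ?case using step(1) by (simp add: prod.atLeastLessThan_Suc e del: of_nat_Suc)
qed

lemma prod_pairs:
  fixes f :: "nat \<Rightarrow> nat \<Rightarrow> complex"
  shows "(\<Prod>i=1..n. \<Prod>j=1..n. f i j) = (\<Prod>i=1..n. f i i) * (\<Prod>j=1..n. \<Prod>i=1..<j. f i j * f j i)"
proof (induction n)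
  case (Suc n)
  have "{1..<Suc n} = {1..n}" by auto
  then show ?case using Suc by (simp add: prod.distrib mult_ac)
qed simp

text \<open>Indexes the points \<open>x\<^sub>i + a \<delta>\<close>. For a multi-index \<open>\<gamma>\<close> below \<open>m\<close> it is a union of initial segments of the blocks.\<close>
definition block :: "nat \<Rightarrow> (nat \<Rightarrow> nat) \<Rightarrow> (nat \<times> nat) set" where
  "block n \<gamma> = Sigma {1..n} (\<lambda>i. {..<\<gamma> i})"

definition block_point :: "(nat \<Rightarrow> complex) \<Rightarrow> nat \<times> nat \<Rightarrow> complex" where
  "block_point x p = x (fst p) + of_nat (snd p) * \<delta>"

lemma finite_block [simp]: "finite (block n \<gamma>)"
  by (simp add: block_def)

lemma card_block [simp]: "card (block n \<gamma>) = msize n \<gamma>"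
  by (simp add: block_def msize_def)

text \<open>Up to the sign \<open>(-1)\<close> to the power \<open>q\<close>, both sides are the shifted product of length \<open>p + q + 1\<close> starting at \<open>X - q \<delta>\<close>, cut
into pieces of lengths \<open>p\<close>, 1, \<open>q\<close> and \<open>q\<close>, 1, \<open>p\<close>.\<close>
lemma pair_identity:
  "sp (X - of_nat q * \<delta>) p * sp (- X - of_nat p * \<delta>) q * br (X + of_nat p * \<delta> - of_nat q * \<delta>)
    = br X * sp (\<delta> + X) p * sp (\<delta> - X) q"
proof -
  define Y where "Y = X - of_nat q * \<delta>"
  have e1: "sp (- X - of_nat p * \<delta>) q = (-1) ^ q * sp (Y + of_nat (Suc p) * \<delta>) q"
    by (subst sp_reflect) (simp add: Y_def algebra_simps)
  have e2: "sp (\<delta> - X) q = (-1) ^ q * sp Y q"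
    by (subst sp_reflect) (simp add: Y_def algebra_simps)
  have "sp Y p * br (Y + of_nat p * \<delta>) * sp (Y + of_nat (Suc p) * \<delta>) q = sp Y (Suc p + q)"
    unfolding sp_add[of Y "Suc p" q] sp_Suc by simp
  also have "\<dots> = sp Y (q + Suc p)" by (simp add: add.commute)
  also have "\<dots> = sp Y q * (br X * sp (X + \<delta>) p)"
    unfolding sp_add[of Y q "Suc p"] sp_Suc_left by (simp add: Y_def)
  finally have e3: "sp Y p * br (Y + of_nat p * \<delta>) * sp (Y + of_nat (Suc p) * \<delta>) q = sp Y q * (br X * sp (X + \<delta>) p)" .
  have e4: "X + of_nat p * \<delta> - of_nat q * \<delta> = Y + of_nat p * \<delta>" "\<delta> + X = X + \<delta>"
    by (simp_all add: Y_def)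
  show ?thesis
    unfolding e1 e2 e4 Y_def[symmetric] using arg_cong[OF e3, of "\<lambda>z. (-1) ^ q * z"] by (simp only: mult_ac)
qed

text \<open>The denominators on the left, completed by the factor \<open>[y + (r + \<gamma>) \<delta>]\<close> that lies between them, form one shifted product
of length \<open>m + 1\<close> starting at \<open>y + r \<delta>\<close>.\<close>
lemma well_poised_identity:
  fixes y :: complex and m r \<gamma> :: nat
  assumes \<gamma>: "\<gamma> \<le> m" and y: "br y \<noteq> 0" and n1: "sp (\<delta> + y) m \<noteq> 0" and n2: "sp (\<delta> + y + of_nat m * \<delta>) r \<noteq> 0"
  shows "(\<Prod>a<\<gamma>. inverse (br (y + of_nat r * \<delta> + of_nat a * \<delta>)))
      * (\<Prod>a\<in>{\<gamma>..<m}. inverse (br (y + of_nat (Suc r) * \<delta> + of_nat a * \<delta>)))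
    = inverse (sp (\<delta> + y) m) * (br (of_nat (r + \<gamma>) * \<delta> + y) / br y) * (sp y r / sp (\<delta> + y + of_nat m * \<delta>) r)"
proof -
  define z where "z = y + of_nat r * \<delta>"
  define D where "D = sp z \<gamma> * sp (z + of_nat (Suc \<gamma>) * \<delta>) (m - \<gamma>)"
  have lhs: "(\<Prod>a<\<gamma>. inverse (br (y + of_nat r * \<delta> + of_nat a * \<delta>)))
      * (\<Prod>a\<in>{\<gamma>..<m}. inverse (br (y + of_nat (Suc r) * \<delta> + of_nat a * \<delta>))) = inverse D"
  proof -
    have "y + of_nat (Suc r) * \<delta> + of_nat \<gamma> * \<delta> = z + of_nat (Suc \<gamma>) * \<delta>"
      by (simp add: z_def algebra_simps)
    then have "(\<Prod>a\<in>{\<gamma>..<m}. br (y + of_nat (Suc r) * \<delta> + of_nat a * \<delta>)) = sp (z + of_nat (Suc \<gamma>) * \<delta>) (m - \<gamma>)"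
      using prod_br_interval[OF \<gamma>, of "y + of_nat (Suc r) * \<delta>"] by simp
    then show ?thesis
      by (simp add: D_def z_def shifted_prod_def prod_inversef[unfolded o_def])
  qed
  have "D * br (z + of_nat \<gamma> * \<delta>) = sp z (Suc m)"
  proof -
    have "sp z (Suc m) = sp z (Suc \<gamma> + (m - \<gamma>))" using \<gamma> by simp
    also have "\<dots> = D * br (z + of_nat \<gamma> * \<delta>)"
      unfolding sp_add[of z "Suc \<gamma>"] sp_Suc D_def by (simp only: mult_ac)
    finally show ?thesis by simp
  qed
  moreover have "sp y r * sp z (Suc m) = br y * (sp (\<delta> + y) m * sp (\<delta> + y + of_nat m * \<delta>) r)"
  proof -
    have "sp y r * sp z (Suc m) = sp y (r + Suc m)" unfolding sp_add z_def ..
    also have "\<dots> = sp y (Suc (m + r))" by (simp add: add.commute)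
    also have "\<dots> = br y * (sp (\<delta> + y) m * sp (\<delta> + y + of_nat m * \<delta>) r)"
      unfolding sp_Suc_left sp_add by (simp add: ac_simps)
    finally show ?thesis .
  qed
  ultimately have key: "sp y r * (D * br (z + of_nat \<gamma> * \<delta>)) = br y * (sp (\<delta> + y) m * sp (\<delta> + y + of_nat m * \<delta>) r)"
    by simp
  then have nz: "sp y r \<noteq> 0" "D \<noteq> 0" "br (z + of_nat \<gamma> * \<delta>) \<noteq> 0"
    using y n1 n2 by auto
  have e: "of_nat (r + \<gamma>) * \<delta> + y = z + of_nat \<gamma> * \<delta>" by (simp add: z_def algebra_simps)
  show ?thesis
    unfolding lhs e using key nz y n1 n2 by (simp add: field_simps)
qed

lemma prod_block:
  "(\<Prod>p\<in>block n \<gamma>. f (block_point x p)) = (\<Prod>i=1..n. \<Prod>a<\<gamma> i. f (x i + of_nat a * \<delta>))"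
  unfolding block_def block_point_def by (simp add: prod.Sigma split_beta)

lemma block_diff: "block n m - block n \<gamma> = Sigma {1..n} (\<lambda>i. {\<gamma> i..<m i})"
  by (auto simp: block_def)

lemma prod_block_diff:
  "(\<Prod>p\<in>block n m - block n \<gamma>. f (block_point x p)) = (\<Prod>i=1..n. \<Prod>a\<in>{\<gamma> i..<m i}. f (x i + of_nat a * \<delta>))"
  unfolding block_diff block_point_def by (simp add: prod.Sigma split_beta)

lemma msize_mono: "(\<And>i. i \<in> {1..n} \<Longrightarrow> \<gamma> i \<le> m i) \<Longrightarrow> msize n \<gamma> \<le> msize n m"
  unfolding msize_def by (rule sum_mono)

lemma c_weight_block:
  assumes \<gamma>: "\<And>i. i \<in> {1..n} \<Longrightarrow> \<gamma> i \<le> m i" and nz: "sp (\<delta> + s - c) (msize n \<gamma>) \<noteq> 0"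
  shows "c_weight (block_point x) (block n m) s c (block n \<gamma>)
    = sp (\<delta> + s - c) (msize n m) * ((\<Prod>i=1..n. sp (c + x i) (\<gamma> i)) / sp (\<delta> + s - c) (msize n \<gamma>))"
proof -
  have "sp (\<delta> + s - c) (msize n m) = sp (\<delta> + s - c) (msize n \<gamma>)
      * sp (\<delta> + s - c + of_nat (msize n \<gamma>) * \<delta>) (msize n m - msize n \<gamma>)"
    using sp_add[of "\<delta> + s - c" "msize n \<gamma>" "msize n m - msize n \<gamma>"] msize_mono[of n \<gamma> m] \<gamma> by simp
  moreover have "(\<Prod>p\<in>block n \<gamma>. br (c + block_point x p)) = (\<Prod>i=1..n. sp (c + x i) (\<gamma> i))"
    unfolding prod_block[where f = "\<lambda>z. br (c + z)"] shifted_prod_def by (simp only: add.assoc)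
  ultimately show ?thesis using nz by (simp add: c_weight_def)
qed

lemma d_weight_block:
  assumes \<gamma>: "\<And>i. i \<in> {1..n} \<Longrightarrow> \<gamma> i \<le> m i"
    and nz: "\<And>i. i \<in> {1..n} \<Longrightarrow> sp (\<delta> + s - d + x i) (\<gamma> i) \<noteq> 0"
  shows "d_weight (block_point x) (block n m) s d (block n \<gamma>)
    = (\<Prod>i=1..n. sp (\<delta> + s - d + x i) (m i)) * (sp d (msize n \<gamma>) / (\<Prod>i=1..n. sp (\<delta> + s - d + x i) (\<gamma> i)))"
proof -
  have "(\<Prod>p\<in>block n m - block n \<gamma>. br (\<delta> + s - d + block_point x p))
      = (\<Prod>i=1..n. sp (\<delta> + s - d + x i) (m i) / sp (\<delta> + s - d + x i) (\<gamma> i))"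
    unfolding prod_block_diff[where f = "\<lambda>z. br (\<delta> + s - d + z)"]
  proof (rule prod.cong[OF refl])
    fix i assume i: "i \<in> {1..n}"
    have "(\<Prod>a\<in>{\<gamma> i..<m i}. br (\<delta> + s - d + (x i + of_nat a * \<delta>)))
        = sp (\<delta> + s - d + x i + of_nat (\<gamma> i) * \<delta>) (m i - \<gamma> i)"
      unfolding prod_br_interval[OF \<gamma>[OF i], symmetric] by (simp only: add.assoc)
    moreover have "sp (\<delta> + s - d + x i) (m i)
        = sp (\<delta> + s - d + x i) (\<gamma> i) * sp (\<delta> + s - d + x i + of_nat (\<gamma> i) * \<delta>) (m i - \<gamma> i)"
      using sp_add[of "\<delta> + s - d + x i" "\<gamma> i" "m i - \<gamma> i"] \<gamma>[OF i] by simp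
    ultimately show "(\<Prod>a\<in>{\<gamma> i..<m i}. br (\<delta> + s - d + (x i + of_nat a * \<delta>)))
        = sp (\<delta> + s - d + x i) (m i) / sp (\<delta> + s - d + x i) (\<gamma> i)"
      using nz[OF i] by simp
  qed
  then show ?thesis by (simp add: d_weight_def prod_dividef)
qed

text \<open>The denominators that involve only the points: all \<open>x\<^sub>i - x\<^sub>j + l \<delta>\<close> with \<open>- m\<^sub>j \<le> l \<le> m\<^sub>i\<close>, except \<open>[0]\<close> itself.\<close>
definition spread :: "nat \<Rightarrow> (nat \<Rightarrow> nat) \<Rightarrow> (nat \<Rightarrow> complex) \<Rightarrow> bool" where
  "spread n m x \<longleftrightarrow> (\<forall>i\<in>{1..n}. \<forall>j\<in>{1..n}. \<forall>a\<le>m i. \<forall>b\<le>m j. i \<noteq> j \<or> a \<noteq> b \<longrightarrow>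
     br (x i - x j + of_nat a * \<delta> - of_nat b * \<delta>) \<noteq> 0)"

text \<open>For two blocks the factors \<open>[x\<^sub>p - x\<^sub>q - \<delta>] / [x\<^sub>p - x\<^sub>q]\<close> telescope along the second block. What remains is compared with
the Vandermonde-type quotient one pair of blocks at a time by \<open>pair_identity\<close>; the diagonal pairs produce the sign.\<close>
lemma base_weight_block:
  assumes \<gamma>: "\<And>i. i \<in> {1..n} \<Longrightarrow> \<gamma> i \<le> m i" and x: "spread n m x"
    and y: "\<And>i. i \<in> {1..n} \<Longrightarrow> br (s + x i) \<noteq> 0"
    and n1: "\<And>i. i \<in> {1..n} \<Longrightarrow> sp (\<delta> + s + x i) (m i) \<noteq> 0"
    and n2: "\<And>i. i \<in> {1..n} \<Longrightarrow> sp (\<delta> + s - (- of_nat (m i) * \<delta>) + x i) (msize n \<gamma>) \<noteq> 0"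
  shows "base_weight (block_point x) (block n m) s (block n \<gamma>)
    = inverse (\<Prod>i=1..n. sp (\<delta> + s + x i) (m i))
      * (Delta br n (\<lambda>i. x i + of_nat (\<gamma> i) * \<delta>) / Delta br n x
       * (\<Prod>i=1..n. br (of_nat (msize n \<gamma> + \<gamma> i) * \<delta> + s + x i) / br (s + x i))
       * (\<Prod>j=1..n. sp (s + x j) (msize n \<gamma>) / sp (\<delta> + s - (- of_nat (m j) * \<delta>) + x j) (msize n \<gamma>)
            * (\<Prod>i=1..n. sp (- of_nat (m j) * \<delta> + x i - x j) (\<gamma> i) / sp (\<delta> + x i - x j) (\<gamma> i))))"
proof -
  define r where "r = msize n \<gamma>"
  define P where "P i j = sp (x i - x j - of_nat (\<gamma> j) * \<delta>) (\<gamma> i) / sp (\<delta> + x i - x j) (\<gamma> i)" for i j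
  define D where "D = Delta br n (\<lambda>i. x i + of_nat (\<gamma> i) * \<delta>) / Delta br n x"
  define Q where "Q i j = sp (- of_nat (m j) * \<delta> + x i - x j) (\<gamma> i)" for i j
  have xnz: "br (x i - x j + of_nat a * \<delta> - of_nat b * \<delta>) \<noteq> 0"
    if "i \<in> {1..n}" "j \<in> {1..n}" "a \<le> m i" "b \<le> m j" "i \<noteq> j \<or> a \<noteq> b" for i j a b
    using x that unfolding spread_def by blast
  have xnz': "br (x i - x j + of_nat a * \<delta> - of_nat b * \<delta>) \<noteq> 0"
    if "i \<in> {1..n}" "j \<in> {1..n}" "a < \<gamma> i" "\<gamma> j \<le> b" "b \<le> m j" for i j a b
    using that \<gamma>[of i] by (intro xnz) auto
  have spnz1: "sp (\<delta> + x i - x j) (\<gamma> i) \<noteq> 0" if "i \<in> {1..n}" "j \<in> {1..n}" for i j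
  proof -
    have "br (\<delta> + x i - x j + of_nat l * \<delta>) \<noteq> 0" if "l < \<gamma> i" for l
      using xnz[of i j "Suc l" 0] that \<gamma>[OF \<open>i \<in> _\<close>] \<open>i \<in> _\<close> \<open>j \<in> _\<close> by (simp add: algebra_simps)
    then show ?thesis by (auto simp: sp_eq_0_iff)
  qed
  have spnz2: "sp (x i - x j - of_nat (\<gamma> j) * \<delta>) (\<gamma> i) \<noteq> 0" if "i \<in> {1..n}" "j \<in> {1..n}" for i j
  proof -
    have "br (x i - x j - of_nat (\<gamma> j) * \<delta> + of_nat l * \<delta>) \<noteq> 0" if "l < \<gamma> i" for l
      using xnz'[of i j l "\<gamma> j"] that \<gamma>[OF \<open>j \<in> _\<close>] \<open>i \<in> _\<close> \<open>j \<in> _\<close> by (simp add: algebra_simps)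
    then show ?thesis by (auto simp: sp_eq_0_iff)
  qed
  have diagonal: "P i i = (-1) ^ \<gamma> i" if "i \<in> {1..n}" for i
  proof -
    have "sp (x i - x i - of_nat (\<gamma> i) * \<delta>) (\<gamma> i) = (-1) ^ \<gamma> i * sp \<delta> (\<gamma> i)"
      by (subst sp_reflect) simp
    then show ?thesis using spnz1[OF that that] by (simp add: P_def)
  qed
  have offdiag: "P i j * P j i = br (x i - x j) / br (x i + of_nat (\<gamma> i) * \<delta> - (x j + of_nat (\<gamma> j) * \<delta>))"
    if "i \<in> {1..n}" "j \<in> {1..n}" "i \<noteq> j" for i j
  proof -
    have "br (x i - x j + of_nat (\<gamma> i) * \<delta> - of_nat (\<gamma> j) * \<delta>) \<noteq> 0"
      using xnz \<gamma> that by blast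
    moreover have "x i + of_nat (\<gamma> i) * \<delta> - (x j + of_nat (\<gamma> j) * \<delta>) = x i - x j + of_nat (\<gamma> i) * \<delta> - of_nat (\<gamma> j) * \<delta>"
      by simp
    moreover have "\<delta> + x i - x j = \<delta> + (x i - x j)" "\<delta> + x j - x i = \<delta> - (x i - x j)" "x j - x i - of_nat (\<gamma> i) * \<delta> = - (x i - x j) - of_nat (\<gamma> i) * \<delta>"
      by simp_all
    ultimately show ?thesis
      using pair_identity[of "x i - x j" "\<gamma> j" "\<gamma> i"] spnz1[OF that(1,2)] spnz1[OF that(2,1)]
      unfolding P_def by (simp only: times_divide_times_eq divide_eq_eq eq_divide_eq frac_eq_eq mult_eq_0_iff simp_thms if_False) (simp add: mult_ac)
  qed
  have P: "(\<Prod>i=1..n. \<Prod>j=1..n. P i j) * D = (-1) ^ r"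
  proof -
    have "(\<Prod>i=1..n. P i i) = (-1) ^ r"
      using diagonal by (simp add: r_def msize_def power_sum)
    moreover have "(\<Prod>j=1..n. \<Prod>i=1..<j. P i j * P j i) * D = 1"
    proof -
      have "(\<Prod>j=1..n. \<Prod>i=1..<j. P i j * P j i) = Delta br n x / Delta br n (\<lambda>i. x i + of_nat (\<gamma> i) * \<delta>)"
        unfolding Delta_def prod_dividef[symmetric] using offdiag by (intro prod.cong refl) auto
      moreover have "Delta br n x \<noteq> 0"
        unfolding Delta_def using xnz[of _ _ 0 0] by auto
      moreover have "Delta br n (\<lambda>i. x i + of_nat (\<gamma> i) * \<delta>) \<noteq> 0"
      proof -
        have "br (x i + of_nat (\<gamma> i) * \<delta> - (x j + of_nat (\<gamma> j) * \<delta>)) \<noteq> 0" if "i \<in> {1..n}" "j \<in> {1..n}" "i \<noteq> j" for i j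
          using xnz[OF that(1,2) \<gamma>[OF that(1)] \<gamma>[OF that(2)]] that(3) by (simp add: algebra_simps)
        then show ?thesis unfolding Delta_def by auto
      qed
      ultimately show ?thesis by (simp add: D_def)
    qed
    ultimately show ?thesis unfolding prod_pairs by (simp add: mult.assoc)
  qed
  have cross: "(\<Prod>p\<in>block n \<gamma>. \<Prod>q\<in>block n m - block n \<gamma>.
        br (block_point x p - block_point x q - \<delta>) / br (block_point x p - block_point x q))
      = (\<Prod>i=1..n. \<Prod>j=1..n. Q i j / sp (x i - x j - of_nat (\<gamma> j) * \<delta>) (\<gamma> i))"
  proof -
    have "(\<Prod>p\<in>block n \<gamma>. \<Prod>q\<in>block n m - block n \<gamma>.
        br (block_point x p - block_point x q - \<delta>) / br (block_point x p - block_point x q))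
      = (\<Prod>i=1..n. \<Prod>a<\<gamma> i. \<Prod>j=1..n. \<Prod>b\<in>{\<gamma> j..<m j}.
          br (x i + of_nat a * \<delta> - (x j + of_nat b * \<delta>) - \<delta>) / br (x i + of_nat a * \<delta> - (x j + of_nat b * \<delta>)))"
      unfolding prod_block_diff[where f = "\<lambda>z. br (block_point x _ - z - \<delta>) / br (block_point x _ - z)"]
      by (rule prod_block[where f = "\<lambda>w. \<Prod>j=1..n. \<Prod>b\<in>{\<gamma> j..<m j}. br (w - (x j + of_nat b * \<delta>) - \<delta>) / br (w - (x j + of_nat b * \<delta>))"])
    also have "\<dots> = (\<Prod>i=1..n. \<Prod>a<\<gamma> i. \<Prod>j=1..n.
        br (- of_nat (m j) * \<delta> + x i - x j + of_nat a * \<delta>) / br (x i - x j - of_nat (\<gamma> j) * \<delta> + of_nat a * \<delta>))"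
    proof (intro prod.cong refl)
      fix i a j assume i: "i \<in> {1..n}" and a: "a \<in> {..<\<gamma> i}" and j: "j \<in> {1..n}"
      define z where "z = x i - x j + of_nat a * \<delta>"
      have "br (z - of_nat b * \<delta>) \<noteq> 0" if "\<gamma> j \<le> b" "b \<le> m j" for b
        using xnz'[OF i j _ that] a by (simp add: z_def)
      from prod_telescope[OF \<gamma>[OF j] this]
      have "(\<Prod>b\<in>{\<gamma> j..<m j}. br (z - of_nat b * \<delta> - \<delta>) / br (z - of_nat b * \<delta>))
          = br (z - of_nat (m j) * \<delta>) / br (z - of_nat (\<gamma> j) * \<delta>)" .
      moreover have "x i + of_nat a * \<delta> - (x j + of_nat b * \<delta>) = z - of_nat b * \<delta>" for b
        by (simp add: z_def)
      moreover have "- of_nat (m j) * \<delta> + x i - x j + of_nat a * \<delta> = z - of_nat (m j) * \<delta>"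
        "x i - x j - of_nat (\<gamma> j) * \<delta> + of_nat a * \<delta> = z - of_nat (\<gamma> j) * \<delta>"
        by (simp_all add: z_def)
      ultimately show "(\<Prod>b\<in>{\<gamma> j..<m j}.
          br (x i + of_nat a * \<delta> - (x j + of_nat b * \<delta>) - \<delta>) / br (x i + of_nat a * \<delta> - (x j + of_nat b * \<delta>)))
        = br (- of_nat (m j) * \<delta> + x i - x j + of_nat a * \<delta>) / br (x i - x j - of_nat (\<gamma> j) * \<delta> + of_nat a * \<delta>)"
        by (simp only:)
    qed
    also have "\<dots> = (\<Prod>i=1..n. \<Prod>j=1..n. Q i j / sp (x i - x j - of_nat (\<gamma> j) * \<delta>) (\<gamma> i))"
      unfolding Q_def shifted_prod_def prod_dividef[symmetric]
      by (intro prod.cong[OF refl] prod.swap)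
    finally show ?thesis .
  qed
  have wp: "(\<Prod>p\<in>block n \<gamma>. inverse (br (s + block_point x p + of_nat r * \<delta>)))
        * (\<Prod>p\<in>block n m - block n \<gamma>. inverse (br (s + block_point x p + of_nat (Suc r) * \<delta>)))
      = inverse (\<Prod>i=1..n. sp (\<delta> + s + x i) (m i))
        * (\<Prod>i=1..n. br (of_nat (r + \<gamma> i) * \<delta> + s + x i) / br (s + x i))
        * (\<Prod>i=1..n. sp (s + x i) r / sp (\<delta> + s - (- of_nat (m i) * \<delta>) + x i) r)"
  proof -
    have "(\<Prod>p\<in>block n \<gamma>. inverse (br (s + block_point x p + of_nat r * \<delta>)))
        * (\<Prod>p\<in>block n m - block n \<gamma>. inverse (br (s + block_point x p + of_nat (Suc r) * \<delta>)))
      = (\<Prod>i=1..n. (\<Prod>a<\<gamma> i. inverse (br (s + x i + of_nat r * \<delta> + of_nat a * \<delta>)))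
          * (\<Prod>a\<in>{\<gamma> i..<m i}. inverse (br (s + x i + of_nat (Suc r) * \<delta> + of_nat a * \<delta>))))"
      unfolding prod_block[where f = "\<lambda>z. inverse (br (s + z + of_nat r * \<delta>))"]
        prod_block_diff[where f = "\<lambda>z. inverse (br (s + z + of_nat (Suc r) * \<delta>))"] prod.distrib
      by (simp only: add_ac)
    also have "\<dots> = (\<Prod>i=1..n. inverse (sp (\<delta> + s + x i) (m i))
        * (br (of_nat (r + \<gamma> i) * \<delta> + s + x i) / br (s + x i))
        * (sp (s + x i) r / sp (\<delta> + s - (- of_nat (m i) * \<delta>) + x i) r))"
    proof (rule prod.cong[OF refl])
      fix i assume i: "i \<in> {1..n}"
      have e: "\<delta> + s - (- of_nat (m i) * \<delta>) + x i = \<delta> + (s + x i) + of_nat (m i) * \<delta>"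
        "\<delta> + s + x i = \<delta> + (s + x i)" "of_nat (r + \<gamma> i) * \<delta> + s + x i = of_nat (r + \<gamma> i) * \<delta> + (s + x i)"
        by simp_all
      show "(\<Prod>a<\<gamma> i. inverse (br (s + x i + of_nat r * \<delta> + of_nat a * \<delta>)))
          * (\<Prod>a\<in>{\<gamma> i..<m i}. inverse (br (s + x i + of_nat (Suc r) * \<delta> + of_nat a * \<delta>)))
        = inverse (sp (\<delta> + s + x i) (m i)) * (br (of_nat (r + \<gamma> i) * \<delta> + s + x i) / br (s + x i))
        * (sp (s + x i) r / sp (\<delta> + s - (- of_nat (m i) * \<delta>) + x i) r)"
        using well_poised_identity[OF \<gamma>[OF i] y[OF i], of r] n1[OF i] n2[OF i] unfolding e unfolding r_def by blast
    qed
    finally show ?thesis unfolding prod.distrib prod_inversef[unfolded o_def] .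
  qed
  have "(-1) ^ r * (\<Prod>i=1..n. \<Prod>j=1..n. Q i j / sp (x i - x j - of_nat (\<gamma> j) * \<delta>) (\<gamma> i))
      = D * (\<Prod>j=1..n. \<Prod>i=1..n. Q i j / sp (\<delta> + x i - x j) (\<gamma> i))"
  proof -
    have "(\<Prod>i=1..n. \<Prod>j=1..n. P i j) * (\<Prod>i=1..n. \<Prod>j=1..n. Q i j / sp (x i - x j - of_nat (\<gamma> j) * \<delta>) (\<gamma> i))
        = (\<Prod>i=1..n. \<Prod>j=1..n. Q i j / sp (\<delta> + x i - x j) (\<gamma> i))"
      unfolding prod.distrib[symmetric] P_def using spnz2 by (intro prod.cong refl) simp
    also have "\<dots> = (\<Prod>j=1..n. \<Prod>i=1..n. Q i j / sp (\<delta> + x i - x j) (\<gamma> i))"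
      by (rule prod.swap)
    finally show ?thesis unfolding P[symmetric] by (simp add: mult_ac)
  qed
  then have crossD: "(-1) ^ r * (\<Prod>p\<in>block n \<gamma>. \<Prod>q\<in>block n m - block n \<gamma>.
        br (block_point x p - block_point x q - \<delta>) / br (block_point x p - block_point x q))
      = D * (\<Prod>j=1..n. \<Prod>i=1..n. Q i j / sp (\<delta> + x i - x j) (\<gamma> i))"
    unfolding cross .
  show ?thesis
    unfolding base_weight_def card_block r_def[symmetric] crossD mult.assoc wp[unfolded mult.assoc]
    unfolding prod.distrib D_def[symmetric] Q_def by (simp only: mult_ac)
qed


lemma generic_spread:
  assumes "generic br \<delta> n m (s, c, d, x)"
  shows "spread n m x"
  unfolding spread_def
proof (intro ballI allI impI)
  fix i j a b assume i: "i \<in> {1..n}" and j: "j \<in> {1..n}" and a: "a \<le> m i" and b: "b \<le> m j" and ne: "i \<noteq> j \<or> a \<noteq> b"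
  have "restrict m {1..n} \<in> {1..n} \<rightarrow>\<^sub>E UNIV" "\<forall>i\<in>{1..n}. restrict m {1..n} i \<le> m i" by auto
  then have sp: "sp (\<delta> + x k - x l) (m k) \<noteq> 0" if "k \<in> {1..n}" "l \<in> {1..n}" for k l
    using assms that unfolding generic.simps Let_def by (metis restrict_apply')
  have up: "br (x k - x l + of_nat e * \<delta>) \<noteq> 0" if "k \<in> {1..n}" "l \<in> {1..n}" "0 < e" "e \<le> m k" for k l e
  proof -
    have "br (\<delta> + x k - x l + of_nat (e - 1) * \<delta>) \<noteq> 0"
    proof -
      have "e - 1 < m k" using that(3,4) by simp
      then show ?thesis using sp[OF that(1,2)] unfolding sp_eq_0_iff by blast
    qed
    moreover have "\<delta> + x k - x l + of_nat (e - 1) * \<delta> = x k - x l + of_nat e * \<delta>"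
      using that(3) by (cases e) (simp_all add: algebra_simps)
    ultimately show ?thesis by metis
  qed
  consider "a = b" "i < j" | "a = b" "j < i" | "b < a" | "a < b" using ne by linarith
  then show "br (x i - x j + of_nat a * \<delta> - of_nat b * \<delta>) \<noteq> 0"
  proof cases
    case 1
    then show ?thesis using assms i j by (auto simp: Delta_def Let_def)
  next
    case 2
    then have "br (x j - x i) \<noteq> 0" using assms i j by (auto simp: Delta_def Let_def)
    then show ?thesis using 2 br_minus_commute[of "x i" "x j"] by simp
  next
    case 3
    have "x i - x j + of_nat a * \<delta> - of_nat b * \<delta> = x i - x j + of_nat (a - b) * \<delta>"
      using 3 by (simp add: of_nat_diff algebra_simps)
    moreover have "br (x i - x j + of_nat (a - b) * \<delta>) \<noteq> 0"
      using 3 i j a by (intro up) auto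
    ultimately show ?thesis by metis
  next
    case 4
    have "x i - x j + of_nat a * \<delta> - of_nat b * \<delta> = - (x j - x i + of_nat (b - a) * \<delta>)"
      using 4 by (simp add: of_nat_diff algebra_simps)
    moreover have "br (x j - x i + of_nat (b - a) * \<delta>) \<noteq> 0"
      using 4 i j b by (intro up) auto
    ultimately show ?thesis by (metis odd neg_equal_0_iff_equal)
  qed
qed

lemma generic_regular:
  assumes g: "generic br \<delta> n m (s, c, d, x)"
  shows "regular (block_point x) (block n m) s"
proof -
  have "restrict m {1..n} \<in> {1..n} \<rightarrow>\<^sub>E UNIV" "\<forall>i\<in>{1..n}. restrict m {1..n} i \<le> m i" by auto
  moreover have "msize n (restrict m {1..n}) = msize n m" by (simp add: msize_def)
  ultimately have sp: "sp (\<delta> + s - (- of_nat (m j) * \<delta>) + x j) (msize n m) \<noteq> 0" "sp (\<delta> + s + x j) (m j) \<noteq> 0"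
    if "j \<in> {1..n}" for j
    using g that unfolding generic.simps Let_def by metis+
  have shift: "br (s + x j + of_nat l * \<delta>) \<noteq> 0" if "j \<in> {1..n}" "0 < l" "l \<le> m j + msize n m" for j l
  proof -
    have e: "\<delta> + s - (- of_nat (m j) * \<delta>) + x j = \<delta> + s + x j + of_nat (m j) * \<delta>" by simp
    have "sp (\<delta> + s + x j) (m j + msize n m) \<noteq> 0"
      using sp[OF that(1)] unfolding e sp_add by (simp only: mult_eq_0_iff simp_thms)
    moreover have "l - 1 < m j + msize n m" using that by simp
    ultimately have "br (\<delta> + s + x j + of_nat (l - 1) * \<delta>) \<noteq> 0"
      unfolding sp_eq_0_iff by blast
    moreover have "\<delta> + s + x j + of_nat (l - 1) * \<delta> = s + x j + of_nat l * \<delta>"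
      using that(2) by (cases l) (simp_all add: algebra_simps)
    ultimately show ?thesis by metis
  qed
  have "br (block_point x p - block_point x q) \<noteq> 0" if "p \<in> block n m" "q \<in> block n m" "p \<noteq> q" for p q
  proof -
    have "br (x (fst p) - x (fst q) + of_nat (snd p) * \<delta> - of_nat (snd q) * \<delta>) \<noteq> 0"
      using generic_spread[OF g] that unfolding spread_def by (auto simp: block_def prod_eq_iff)
    moreover have "block_point x p - block_point x q
        = x (fst p) - x (fst q) + of_nat (snd p) * \<delta> - of_nat (snd q) * \<delta>"
      by (simp add: block_point_def)
    ultimately show ?thesis by simp
  qed
  moreover have "br (s + block_point x p + of_nat r * \<delta>) \<noteq> 0" if "p \<in> block n m" "r \<in> {1..msize n m}" for p r
  proof -
    have "s + block_point x p + of_nat r * \<delta> = s + x (fst p) + of_nat (snd p + r) * \<delta>"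
      by (simp add: block_point_def algebra_simps)
    moreover have "br (s + x (fst p) + of_nat (snd p + r) * \<delta>) \<noteq> 0"
      using that by (intro shift) (auto simp: block_def)
    ultimately show ?thesis by metis
  qed
  ultimately show ?thesis by (simp add: regular_def)
qed

text \<open>If \<open>p\<close> is the successor of \<open>q\<close> in a block, then \<open>x\<^sub>p - x\<^sub>q - \<delta> = 0\<close>.\<close>
lemma base_weight_eq_0:
  assumes I: "I \<subseteq> block n m" and p: "(i, Suc a) \<in> I" "(i, a) \<notin> I"
  shows "base_weight (block_point x) (block n m) s I = 0"
proof -
  have fin: "finite I" using I finite_block finite_subset by blast
  have "(i, a) \<in> block n m - I" using assms by (auto simp: block_def)
  moreover have "br (block_point x (i, Suc a) - block_point x (i, a) - \<delta>) = 0"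
    by (simp add: block_point_def algebra_simps)
  ultimately have "(\<Prod>q\<in>block n m - I. br (block_point x (i, Suc a) - block_point x q - \<delta>)
      / br (block_point x (i, Suc a) - block_point x q)) = 0"
    by (intro prod_zero bexI[of _ "(i, a)"]) auto
  then have "(\<Prod>p\<in>I. \<Prod>q\<in>block n m - I. br (block_point x p - block_point x q - \<delta>)
      / br (block_point x p - block_point x q)) = 0"
    by (intro prod_zero[OF fin] bexI[OF _ p(1)])
  then show ?thesis by (simp add: base_weight_def)
qed

lemma downward_closed_block:
  assumes I: "I \<subseteq> block n m" and down: "\<And>i a. (i, Suc a) \<in> I \<Longrightarrow> (i, a) \<in> I"
  shows "\<exists>\<gamma>\<in>{1..n} \<rightarrow>\<^sub>E UNIV. (\<forall>i\<in>{1..n}. \<gamma> i \<le> m i) \<and> I = block n \<gamma>"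
proof (intro bexI conjI ballI)
  define \<gamma> where "\<gamma> = (\<lambda>i\<in>{1..n}. card {a. (i, a) \<in> I})"
  have set: "{a. (i, a) \<in> I} = {..<card {a. (i, a) \<in> I}}" for i
  proof -
    have fin: "finite {a. (i, a) \<in> I}"
      by (rule finite_subset[of _ "{..<m i}"]) (use I in \<open>auto simp: block_def\<close>)
    have le: "(i, b) \<in> I" if "(i, a) \<in> I" "b \<le> a" for a b
      using that(2,1)
    proof (induction a rule: dec_induct)
      case base
      then show ?case .
    next
      case (step a)
      from step.prems have "(i, a) \<in> I" by (rule down)
      then show ?case by (rule step.IH)
    qed
    show ?thesis
    proof (cases "{a. (i, a) \<in> I} = {}")
      case True
      then show ?thesis by simp
    next
      case False
      define M where "M = Max {a. (i, a) \<in> I}"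
      have M: "(i, M) \<in> I" using Max_in[OF fin False] by (simp add: M_def)
      have "a \<le> M" if "(i, a) \<in> I" for a
        using Max_ge[OF fin] that by (simp add: M_def)
      then have "(i, a) \<in> I \<longleftrightarrow> a < Suc M" for a
        using le[OF M] by (metis less_Suc_eq_le)
      then have "{a. (i, a) \<in> I} = {..<Suc M}" by blast
      then show ?thesis by (metis card_lessThan)
    qed
  qed
  show "\<gamma> \<in> {1..n} \<rightarrow>\<^sub>E UNIV" by (simp add: \<gamma>_def)
  show "\<gamma> i \<le> m i" if "i \<in> {1..n}" for i
  proof -
    have "{a. (i, a) \<in> I} \<subseteq> {..<m i}" using I by (auto simp: block_def)
    then show ?thesis using card_mono[of "{..<m i}"] that by (fastforce simp: \<gamma>_def)
  qed
  show "I = block n \<gamma>"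
  proof (rule Set.set_eqI)
    fix p :: "nat \<times> nat"
    obtain i a where p: "p = (i, a)" by (cases p)
    have "(i, a) \<in> I \<longleftrightarrow> a < card {a. (i, a) \<in> I}"
      by (metis set lessThan_iff mem_Collect_eq)
    moreover have "(i, a) \<in> I \<Longrightarrow> i \<in> {1..n}"
      using I by (auto simp: block_def)
    ultimately show "p \<in> I \<longleftrightarrow> p \<in> block n \<gamma>"
      unfolding p block_def \<gamma>_def by auto
  qed
qed

lemma prod_upto_2: "(\<Prod>k=0..2. f k) = f 0 * f 1 * f (2 :: nat)"
  by (simp add: numeral_2_eq_2 atLeast0_atMost_Suc mult_ac)

text \<open>The series terminates at \<open>m\<close>, so it is a finite sum over multi-indices; these are the unions of initial segments, and all other
subsets have weight zero.\<close>
lemma E_tilde_eq_subset_series: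
  assumes g: "generic br \<delta> n m (s, c, d, x)"
  shows "E_tilde br \<delta> n m (s, c, d, x)
    = subset_series (block_point x) (block n m) s (c 0) (c 1) (c 2) (d 0) (d 1) (d 2)"
proof -
  let ?X = "block_point x" and ?A = "block n m"
  define T0 where "T0 \<gamma> = Delta br n (\<lambda>i. x i + of_nat (\<gamma> i) * \<delta>) / Delta br n x
       * (\<Prod>i=1..n. br (of_nat (msize n \<gamma> + \<gamma> i) * \<delta> + s + x i) / br (s + x i))
       * (\<Prod>j=1..n.
            sp (s + x j) (msize n \<gamma>) / sp (\<delta> + s - (- of_nat (m j) * \<delta>) + x j) (msize n \<gamma>)
            * (\<Prod>i=1..n. sp (- of_nat (m j) * \<delta> + x i - x j) (\<gamma> i) / sp (\<delta> + x i - x j) (\<gamma> i)))" for \<gamma>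
  define T where "T \<gamma> = T0 \<gamma>
       * (\<Prod>k=0..2.
            sp (d k) (msize n \<gamma>) / sp (\<delta> + s - c k) (msize n \<gamma>)
            * (\<Prod>i=1..n. sp (c k + x i) (\<gamma> i) / sp (\<delta> + s - d k + x i) (\<gamma> i)))" for \<gamma>
  define U where "U I = base_weight ?X ?A s I * (c_weight ?X ?A s (c 1) I * (c_weight ?X ?A s (c 2) I *
     (c_weight ?X ?A s (c 0) I * (d_weight ?X ?A s (d 0) I * (d_weight ?X ?A s (d 1) I * d_weight ?X ?A s (d 2) I)))))" for I
  define K where "K = (\<Prod>k=0..2. sp (\<delta> + s - c k) (msize n m) * (\<Prod>i=1..n. sp (\<delta> + s - d k + x i) (m i)))
     / (\<Prod>i=1..n. sp (\<delta> + s + x i) (m i))"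
  define \<Gamma> where "\<Gamma> = (\<Pi>\<^sub>E i\<in>{1..n}. {..m i})"
  have fin\<Gamma>: "finite \<Gamma>" unfolding \<Gamma>_def by (intro finite_PiE) auto
  have "(\<Sum>\<^sub>\<infinity>\<gamma>\<in>{1..n} \<rightarrow>\<^sub>E UNIV. T \<gamma>) = (\<Sum>\<^sub>\<infinity>\<gamma>\<in>\<Gamma>. T \<gamma>)"
  proof (rule infsum_cong_neutral)
    fix \<gamma> assume "\<gamma> \<in> ({1..n} \<rightarrow>\<^sub>E UNIV) - \<Gamma>"
    then obtain i where i: "i \<in> {1..n}" "m i < \<gamma> i"
      unfolding \<Gamma>_def by (auto simp: PiE_iff not_le)
    have "sp (- of_nat (m i) * \<delta> + x i - x i) (\<gamma> i) = 0"
      unfolding sp_eq_0_iff using i by (intro exI[of _ "m i"]) simp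
    then have "(\<Prod>k=1..n. sp (- of_nat (m i) * \<delta> + x k - x i) (\<gamma> k) / sp (\<delta> + x k - x i) (\<gamma> k)) = 0"
      using i by (intro prod_zero bexI[of _ i]) auto
    then have "(\<Prod>j=1..n. sp (s + x j) (msize n \<gamma>) / sp (\<delta> + s - (- of_nat (m j) * \<delta>) + x j) (msize n \<gamma>)
            * (\<Prod>i=1..n. sp (- of_nat (m j) * \<delta> + x i - x j) (\<gamma> i) / sp (\<delta> + x i - x j) (\<gamma> i))) = 0"
      by (intro prod_zero bexI[OF _ i(1)]) (simp, simp only: mult_zero_right)
    then show "T \<gamma> = 0" unfolding T_def T0_def by (simp only: mult_zero_left mult_zero_right)
  qed (auto simp: \<Gamma>_def)
  moreover have "E_series br \<delta> n m (s, c, d, x) = (\<Sum>\<^sub>\<infinity>\<gamma>\<in>{1..n} \<rightarrow>\<^sub>E UNIV. T \<gamma>)"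
    unfolding E_series.simps Let_def T_def T0_def ..
  moreover have "E_tilde br \<delta> n m (s, c, d, x) = K * E_series br \<delta> n m (s, c, d, x)"
    unfolding E_tilde.simps Let_def K_def ..
  moreover have "(\<Sum>\<^sub>\<infinity>\<gamma>\<in>\<Gamma>. T \<gamma>) = (\<Sum>\<gamma>\<in>\<Gamma>. T \<gamma>)"
    by (rule infsum_finite[OF fin\<Gamma>])
  ultimately have "E_tilde br \<delta> n m (s, c, d, x) = K * (\<Sum>\<gamma>\<in>\<Gamma>. T \<gamma>)"
    by (simp only:)
  also have "\<dots> = (\<Sum>\<gamma>\<in>\<Gamma>. U (block n \<gamma>))"
    unfolding sum_distrib_left
  proof (rule sum.cong[OF refl])
    fix \<gamma> assume "\<gamma> \<in> \<Gamma>"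
    then have ext: "\<gamma> \<in> {1..n} \<rightarrow>\<^sub>E UNIV" and "\<forall>i\<in>{1..n}. \<gamma> i \<le> m i"
      by (auto simp: \<Gamma>_def PiE_iff)
    then have \<gamma>: "\<gamma> i \<le> m i" if "i \<in> {1..n}" for i
      using that by blast
    have nz: "br (s + x i) \<noteq> 0" "sp (\<delta> + s + x i) (m i) \<noteq> 0"
      "sp (\<delta> + s - (- of_nat (m i) * \<delta>) + x i) (msize n \<gamma>) \<noteq> 0" if "i \<in> {1..n}" for i
      using g that \<gamma> ext unfolding generic.simps Let_def by blast+
    have nzk: "sp (\<delta> + s - c k) (msize n \<gamma>) \<noteq> 0" "i \<in> {1..n} \<Longrightarrow> sp (\<delta> + s - d k + x i) (\<gamma> i) \<noteq> 0"
      if "k \<in> {0..2}" for k i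
      using g that \<gamma> ext unfolding generic.simps Let_def by blast+
    have c_weight: "c_weight ?X ?A s (c k) (block n \<gamma>)
      = sp (\<delta> + s - c k) (msize n m) * ((\<Prod>i=1..n. sp (c k + x i) (\<gamma> i)) / sp (\<delta> + s - c k) (msize n \<gamma>))"
      and d_weight: "d_weight ?X ?A s (d k) (block n \<gamma>)
      = (\<Prod>i=1..n. sp (\<delta> + s - d k + x i) (m i)) * (sp (d k) (msize n \<gamma>) / (\<Prod>i=1..n. sp (\<delta> + s - d k + x i) (\<gamma> i)))"
      if "k \<in> {0..2}" for k
      using c_weight_block[OF \<gamma> nzk(1)[OF that]] d_weight_block[OF \<gamma> nzk(2)[OF that]] by simp_all
    have "U (block n \<gamma>) = base_weight ?X ?A s (block n \<gamma>)
        * (\<Prod>k=0..2. c_weight ?X ?A s (c k) (block n \<gamma>) * d_weight ?X ?A s (d k) (block n \<gamma>))"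
      unfolding U_def prod_upto_2 by (simp only: mult_ac)
    also have "(\<Prod>k=0..2. c_weight ?X ?A s (c k) (block n \<gamma>) * d_weight ?X ?A s (d k) (block n \<gamma>))
      = (\<Prod>k=0..2. (sp (\<delta> + s - c k) (msize n m) * (\<Prod>i=1..n. sp (\<delta> + s - d k + x i) (m i)))
          * (sp (d k) (msize n \<gamma>) / sp (\<delta> + s - c k) (msize n \<gamma>)
            * (\<Prod>i=1..n. sp (c k + x i) (\<gamma> i) / sp (\<delta> + s - d k + x i) (\<gamma> i))))"
      by (rule prod.cong[OF refl]) (simp add: c_weight d_weight prod_dividef)
    also have "\<dots> = (\<Prod>k=0..2. sp (\<delta> + s - c k) (msize n m) * (\<Prod>i=1..n. sp (\<delta> + s - d k + x i) (m i)))
        * (\<Prod>k=0..2. sp (d k) (msize n \<gamma>) / sp (\<delta> + s - c k) (msize n \<gamma>)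
            * (\<Prod>i=1..n. sp (c k + x i) (\<gamma> i) / sp (\<delta> + s - d k + x i) (\<gamma> i)))"
      by (rule prod.distrib)
    finally have "U (block n \<gamma>) = base_weight ?X ?A s (block n \<gamma>) * \<dots>" .
    moreover have "base_weight ?X ?A s (block n \<gamma>) = inverse (\<Prod>i=1..n. sp (\<delta> + s + x i) (m i)) * T0 \<gamma>"
      unfolding T0_def by (rule base_weight_block[OF \<gamma> generic_spread[OF g] nz])
    ultimately show "K * T \<gamma> = U (block n \<gamma>)"
      unfolding K_def T_def
      by (simp only: divide_inverse[of _ "\<Prod>i=1..n. sp (\<delta> + s + x i) (m i)"] mult_ac)
  qed
  also have "\<dots> = (\<Sum>I\<in>block n ` \<Gamma>. U I)"
  proof -
    have "inj_on (block n) \<Gamma>"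
    proof (rule inj_onI)
      fix \<gamma> \<gamma>' assume *: "\<gamma> \<in> \<Gamma>" "\<gamma>' \<in> \<Gamma>" "block n \<gamma> = block n \<gamma>'"
      show "\<gamma> = \<gamma>'"
      proof (rule PiE_ext[OF *(1,2)[unfolded \<Gamma>_def]])
        fix i assume i: "i \<in> {1..n}"
        have "{..<\<gamma> i} = {..<\<gamma>' i}"
          using *(3) i by (auto simp: block_def set_eq_iff)
        then show "\<gamma> i = \<gamma>' i" by simp
      qed
    qed
    then show ?thesis by (simp add: sum.reindex)
  qed
  also have "\<dots> = (\<Sum>I\<in>Pow ?A. U I)"
  proof (rule sum.mono_neutral_left)
    show "finite (Pow ?A)" by simp
    show "block n ` \<Gamma> \<subseteq> Pow ?A"
      by (auto simp: block_def \<Gamma>_def PiE_iff intro: less_le_trans)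
    show "\<forall>I\<in>Pow ?A - block n ` \<Gamma>. U I = 0"
    proof
      fix I assume I: "I \<in> Pow ?A - block n ` \<Gamma>"
      show "U I = 0"
      proof (rule ccontr)
        assume "U I \<noteq> 0"
        then have "base_weight ?X ?A s I \<noteq> 0" by (auto simp: U_def)
        then have down: "(i, a) \<in> I" if "(i, Suc a) \<in> I" for i a
          using base_weight_eq_0[of I n m i a x s] that I by blast
        have sub: "I \<subseteq> ?A" using I by blast
        obtain \<gamma> where \<gamma>: "\<gamma> \<in> {1..n} \<rightarrow>\<^sub>E UNIV" "\<And>i. i \<in> {1..n} \<Longrightarrow> \<gamma> i \<le> m i" "I = block n \<gamma>"
          using downward_closed_block[OF sub down] by blast
        have "\<gamma> \<in> \<Gamma>" unfolding \<Gamma>_def using \<gamma>(1,2) by (simp add: PiE_iff)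
        then show False using I \<gamma>(3) by blast
      qed
    qed
  qed
  finally show ?thesis by (simp add: subset_series_def U_def)
qed

section \<open>Coordinates permuted by the symmetric group\<close>

text \<open>The balancing condition makes \<open>s\<close> a function of the six coordinates, and \<open>d_offset\<close> is the amount by which \<open>d\<^sub>k\<close> exceeds the
coordinate \<open>u\<^bsub>4 + k\<^esub>\<close>. The offset is chosen such that b1 exchanges \<open>u\<^sub>3\<close> and \<open>u\<^sub>4\<close> and fixes the others.\<close>
definition s_coord :: "nat \<Rightarrow> (nat \<Rightarrow> complex) \<Rightarrow> complex" where
  "s_coord N u = u 1 + u 2 + u 3 - (\<Sum>i=1..6. u i) / 3 - (1 + 2 * of_nat N) * \<delta> / 3"

definition d_offset :: "nat \<Rightarrow> (nat \<Rightarrow> complex) \<Rightarrow> complex" where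
  "d_offset N u = 2 * s_coord N u + (1 + of_nat N) * \<delta> - (u 1 + u 2 + u 3)"

definition coord_series :: "('a \<Rightarrow> complex) \<Rightarrow> 'a set \<Rightarrow> (nat \<Rightarrow> complex) \<Rightarrow> complex" where
  "coord_series x A u = subset_series x A (s_coord (card A) u) (u 3) (u 2) (u 1)
     (u 4 + d_offset (card A) u) (u 5 + d_offset (card A) u) (u 6 + d_offset (card A) u)"

definition all_regular :: "('a \<Rightarrow> complex) \<Rightarrow> 'a set \<Rightarrow> (nat \<Rightarrow> complex) \<Rightarrow> bool" where
  "all_regular x A u \<longleftrightarrow> (\<forall>p. p permutes {1..6} \<longrightarrow> regular x A (s_coord (card A) (u \<circ> p)))"

definition dual_shift :: "nat \<Rightarrow> (nat \<Rightarrow> complex) \<Rightarrow> complex" where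
  "dual_shift N u = (2 - 2 * of_nat N) * \<delta> / 3 - (\<Sum>i=1..6. u i) / 3"

lemma sum_upto_6:
  fixes u :: "nat \<Rightarrow> complex"
  shows "(\<Sum>i=1..6. u i) = u 1 + u 2 + u 3 + u 4 + u 5 + u 6"
  by (simp add: eval_nat_numeral)

lemma sum_compose_permutes:
  fixes u :: "nat \<Rightarrow> complex"
  assumes "p permutes S"
  shows "(\<Sum>i\<in>S. (u \<circ> p) i) = (\<Sum>i\<in>S. u i)"
  using sum.permute[OF assms, of u] by (simp add: o_def)

lemma coord_series_alt:
  "coord_series x A u = (\<Sum>I\<in>Pow A. base_weight x A (s_coord (card A) u) I
     * ((\<Prod>k\<in>{1, 2, 3}. c_weight x A (s_coord (card A) u) (u k) I)
     * (\<Prod>k\<in>{4, 5, 6}. d_weight x A (s_coord (card A) u) (u k + d_offset (card A) u) I)))"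
  unfolding coord_series_def subset_series_def by (simp add: mult_ac)

lemma s_coord_alt: "s_coord N u = (\<Sum>k\<in>{1, 2, 3}. u k) - (\<Sum>k\<in>{1..6}. u k) / 3 - (1 + 2 * of_nat N) * \<delta> / 3"
  by (simp add: s_coord_def)

lemma coord_series_permutes_within:
  assumes p: "p permutes {1, 2, 3} \<and> (\<forall>k\<in>{4, 5, 6}. p k = k) \<or> p permutes {4, 5, 6} \<and> (\<forall>k\<in>{1, 2, 3}. p k = k)"
    and p6: "p permutes {1..6}"
  shows "coord_series x A (u \<circ> p) = coord_series x A u"
proof -
  have inv: "(\<Prod>k\<in>{1, 2, 3}. f (u (p k))) = (\<Prod>k\<in>{1, 2, 3}. f (u k))"
    "(\<Prod>k\<in>{4, 5, 6}. f (u (p k))) = (\<Prod>k\<in>{4, 5, 6}. f (u k))"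
    "(\<Sum>k\<in>{1, 2, 3}. u (p k)) = (\<Sum>k\<in>{1, 2, 3}. u k)" for f :: "complex \<Rightarrow> complex"
  proof -
    consider "p permutes {1, 2, 3}" "\<forall>k\<in>{4, 5, 6}. p k = k" | "p permutes {4, 5, 6}" "\<forall>k\<in>{1, 2, 3}. p k = k"
      using p by blast
    then show "(\<Prod>k\<in>{1, 2, 3}. f (u (p k))) = (\<Prod>k\<in>{1, 2, 3}. f (u k))"
      "(\<Prod>k\<in>{4, 5, 6}. f (u (p k))) = (\<Prod>k\<in>{4, 5, 6}. f (u k))"
      "(\<Sum>k\<in>{1, 2, 3}. u (p k)) = (\<Sum>k\<in>{1, 2, 3}. u k)"
    proof (atomize (full), cases)
      case 1
      show "(\<Prod>k\<in>{1, 2, 3}. f (u (p k))) = (\<Prod>k\<in>{1, 2, 3}. f (u k)) \<and>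
        (\<Prod>k\<in>{4, 5, 6}. f (u (p k))) = (\<Prod>k\<in>{4, 5, 6}. f (u k)) \<and>
        (\<Sum>k\<in>{1, 2, 3}. u (p k)) = (\<Sum>k\<in>{1, 2, 3}. u k)"
        using prod.permute[OF 1(1), of "\<lambda>k. f (u k)"] sum.permute[OF 1(1), of u] 1(2) by (simp add: o_def)
    next
      case 2
      show "(\<Prod>k\<in>{1, 2, 3}. f (u (p k))) = (\<Prod>k\<in>{1, 2, 3}. f (u k)) \<and>
        (\<Prod>k\<in>{4, 5, 6}. f (u (p k))) = (\<Prod>k\<in>{4, 5, 6}. f (u k)) \<and>
        (\<Sum>k\<in>{1, 2, 3}. u (p k)) = (\<Sum>k\<in>{1, 2, 3}. u k)"
        using prod.permute[OF 2(1), of "\<lambda>k. f (u k)"] 2(2) by (simp add: o_def)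
    qed
  qed
  have s: "s_coord N (u \<circ> p) = s_coord N u" for N
    unfolding s_coord_alt sum_compose_permutes[OF p6] using inv(3) by (simp add: o_def)
  have e: "d_offset N (u \<circ> p) = d_offset N u" for N
  proof -
    have "(u \<circ> p) 1 + (u \<circ> p) 2 + (u \<circ> p) 3 = u 1 + u 2 + u 3"
      using inv(3) by (simp add: add.assoc)
    then show ?thesis unfolding d_offset_def s by (simp only:)
  qed
  show ?thesis
    unfolding coord_series_alt s e unfolding o_apply
    by (rule sum.cong[OF refl]) (simp only: inv(1)[of "\<lambda>z. c_weight x A _ z _"] inv(2)[of "\<lambda>z. d_weight x A _ (z + _) _"])
qed

lemma coord_series_transpose_within:
  assumes "a \<in> {1, 2, 3} \<and> b \<in> {1, 2, 3} \<or> a \<in> {4, 5, 6} \<and> b \<in> {4, 5, 6}"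
  shows "coord_series x A (u \<circ> perm_swap a b) = coord_series x A u"
proof (rule coord_series_permutes_within)
  show "perm_swap a b permutes {1, 2, 3} \<and> (\<forall>k\<in>{4, 5, 6}. perm_swap a b k = k) \<or>
    perm_swap a b permutes {4, 5, 6} \<and> (\<forall>k\<in>{1, 2, 3}. perm_swap a b k = k)"
    using assms
  proof
    assume "a \<in> {1, 2, 3} \<and> b \<in> {1, 2, 3}"
    then show ?thesis by (intro disjI1 conjI permutes_swap_id) (auto simp: Transposition.transpose_def)
  next
    assume "a \<in> {4, 5, 6} \<and> b \<in> {4, 5, 6}"
    then show ?thesis by (intro disjI2 conjI permutes_swap_id) (auto simp: Transposition.transpose_def)
  qed
  show "perm_swap a b permutes {1..6}"
    using assms by (intro permutes_swap_id) auto
qed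

text \<open>This is the Bailey transformation with \<open>\<epsilon> = u\<^sub>4 - u\<^sub>3\<close>.\<close>
lemma coord_series_transpose_3_4:
  assumes A: "finite A" and reg: "regular x A (s_coord (card A) u)"
    and reg': "regular x A (s_coord (card A) (u \<circ> perm_swap 3 4))"
  shows "coord_series x A (u \<circ> perm_swap 3 4) = coord_series x A u"
proof -
  define N where "N = card A"
  define s where "s = s_coord N u"
  define e where "e = d_offset N u"
  define \<epsilon> where "\<epsilon> = u 4 - u 3"
  let ?v = "u \<circ> perm_swap 3 4"
  have v: "?v 1 = u 1" "?v 2 = u 2" "?v 3 = u 4" "?v 4 = u 3" "?v 5 = u 5" "?v 6 = u 6"
    by (simp_all add: Transposition.transpose_def)
  have s3: "3 * s = 3 * (u 1 + u 2 + u 3) - (u 1 + u 2 + u 3 + u 4 + u 5 + u 6) - (1 + 2 * of_nat N) * \<delta>"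
    unfolding s_def s_coord_def sum_upto_6 by (simp add: field_simps)
  have e: "e = 2 * s + (1 + of_nat N) * \<delta> - (u 1 + u 2 + u 3)"
    by (simp add: e_def d_offset_def s_def)
  have s': "s_coord N ?v = s + \<epsilon>"
    unfolding s_def s_coord_def sum_upto_6 v \<epsilon>_def by (simp add: field_simps)
  have e': "d_offset N ?v = e + \<epsilon>"
    unfolding d_offset_def s' v e by (simp add: \<epsilon>_def algebra_simps)
  have \<epsilon>: "\<epsilon> = s + \<delta> - u 3 - (u 5 + e) - (u 6 + e)"
    using s3 unfolding e \<epsilon>_def by (simp add: algebra_simps)
  have bal: "u 3 + u 2 + u 1 + (u 4 + e + (u 5 + e) + (u 6 + e)) = (2 + of_nat (card A)) * \<delta> + 3 * s"
    using s3 unfolding e N_def[symmetric] by algebra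
  have "subset_series x A s (u 3) (u 2) (u 1) (u 4 + e) (u 5 + e) (u 6 + e)
      = subset_series x A (s + \<epsilon>) (u 3 + \<epsilon>) (u 2) (u 1) (u 4 + e) (u 5 + e + \<epsilon>) (u 6 + e + \<epsilon>)"
    by (rule bailey_subsets[OF A _ _ \<epsilon> bal]) (use reg reg' s' in \<open>simp_all add: s_def N_def\<close>)
  moreover have "u 3 + \<epsilon> = u 4" "u 3 + (e + \<epsilon>) = u 4 + e" by (simp_all add: \<epsilon>_def)
  ultimately show ?thesis
    unfolding coord_series_def N_def[symmetric] s' e' v s_def[symmetric] e_def[symmetric] by (simp only: add.assoc)
qed

text \<open>A transposition that mixes \<open>{1, 2, 3}\<close> and \<open>{4, 5, 6}\<close> is conjugate to \<open>(3 4)\<close> by a permutation preserving both sets, under which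
the series is symmetric without any condition.\<close>
lemma coord_series_transpose:
  assumes A: "finite A" and reg: "all_regular x A u" and a: "a \<in> {1..6}" and b: "b \<in> {1..6}"
  shows "coord_series x A (u \<circ> perm_swap a b) = coord_series x A u"
proof -
  have cross: "coord_series x A (u \<circ> perm_swap a b) = coord_series x A u"
    if ab: "a \<in> {1, 2, 3}" "b \<in> {4, 5, 6}" for a b
  proof -
    define v where "v = u \<circ> perm_swap a 3 \<circ> perm_swap b 4"
    have eq: "perm_swap a b = perm_swap a 3 \<circ> perm_swap b 4 \<circ> perm_swap 3 4 \<circ> perm_swap b 4 \<circ> perm_swap a 3"
      using ab by (auto simp: fun_eq_iff Transposition.transpose_def)
    have perm: "perm_swap a 3 \<circ> perm_swap b 4 permutes {1..6}"
      "perm_swap a 3 \<circ> perm_swap b 4 \<circ> perm_swap 3 4 permutes {1..6}"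
      using ab by (intro permutes_compose permutes_swap_id; auto)+
    have "coord_series x A (u \<circ> perm_swap a b) = coord_series x A (v \<circ> perm_swap 3 4)"
      unfolding eq o_assoc v_def[symmetric] using ab by (simp add: coord_series_transpose_within)
    also have "\<dots> = coord_series x A v"
      using reg[unfolded all_regular_def, rule_format, OF perm(1)]
        reg[unfolded all_regular_def, rule_format, OF perm(2)]
      unfolding v_def o_assoc by (intro coord_series_transpose_3_4 A)
    also have "\<dots> = coord_series x A u"
      unfolding v_def using ab by (simp add: coord_series_transpose_within)
    finally show ?thesis .
  qed
  have "a \<in> {1, 2, 3} \<or> a \<in> {4, 5, 6}" "b \<in> {1, 2, 3} \<or> b \<in> {4, 5, 6}"
    using a b by auto
  then show ?thesis
    using cross[of a b] cross[of b a] coord_series_transpose_within[of a b] by (metis transpose_commute)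
qed

lemma all_regular_compose: "all_regular x A u \<Longrightarrow> p permutes {1..6} \<Longrightarrow> all_regular x A (u \<circ> p)"
  unfolding all_regular_def by (metis o_assoc permutes_compose)

lemma coord_series_permutes:
  assumes A: "finite A" and reg: "all_regular x A u" and p: "p permutes {1..6}"
  shows "coord_series x A (u \<circ> p) = coord_series x A u"
  using finite_atLeastAtMost p
proof (induction rule: permutes_rev_induct)
  case id
  then show ?case by simp
next
  case (swap a b p)
  have "coord_series x A (u \<circ> p \<circ> perm_swap a b) = coord_series x A (u \<circ> p)"
    by (rule coord_series_transpose[OF A all_regular_compose[OF reg \<open>p permutes _\<close>] swap(1,2)])
  also have "\<dots> = coord_series x A u" by (rule swap.IH)
  finally show ?case by (simp only: o_assoc)
qed

section \<open>Reversal in coordinates\<close>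

text \<open>The shift of all coordinates followed by \<open>(1 6)(2 5)(3 4)\<close> exchanges the roles of the \<open>c\<^sub>k\<close> and \<open>d\<^sub>k\<close> exactly as the reversal
of the summation does.\<close>
lemma coord_series_reverse:
  assumes A: "finite A"
  defines "w \<equiv> perm_swap 1 6 \<circ> perm_swap 2 5 \<circ> perm_swap 3 4"
  shows "coord_series (\<lambda>i. (of_nat (card A) - 1) * \<delta> - x i) A ((\<lambda>i. u i + dual_shift (card A) u) \<circ> w) = coord_series x A u"
proof -
  define N where "N = card A"
  define s where "s = s_coord N u"
  define e where "e = d_offset N u"
  define \<eta> where "\<eta> = dual_shift N u"
  let ?v = "(\<lambda>i. u i + \<eta>) \<circ> w"
  have v: "?v 1 = u 6 + \<eta>" "?v 2 = u 5 + \<eta>" "?v 3 = u 4 + \<eta>" "?v 4 = u 3 + \<eta>" "?v 5 = u 2 + \<eta>" "?v 6 = u 1 + \<eta>"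
    by (simp_all add: Transposition.transpose_def w_def)
  have s3: "3 * s = 3 * (u 1 + u 2 + u 3) - (u 1 + u 2 + u 3 + u 4 + u 5 + u 6) - (1 + 2 * of_nat N) * \<delta>"
    unfolding s_def s_coord_def sum_upto_6 by (simp add: field_simps)
  have e: "e = 2 * s + (1 + of_nat N) * \<delta> - (u 1 + u 2 + u 3)"
    by (simp add: e_def d_offset_def s_def)
  have "3 * \<eta> = (2 - 2 * of_nat N) * \<delta> - (u 1 + u 2 + u 3 + u 4 + u 5 + u 6)"
    unfolding \<eta>_def dual_shift_def sum_upto_6 by (simp add: field_simps)
  then have \<eta>: "\<eta> = s + \<delta> - (u 1 + u 2 + u 3)"
    using s3 by algebra
  have "3 * s_coord N ?v = 3 * (u 6 + u 5 + u 4 + 3 * \<eta>) - (u 1 + u 2 + u 3 + u 4 + u 5 + u 6 + 6 * \<eta>) - (1 + 2 * of_nat N) * \<delta>"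
    unfolding s_coord_def sum_upto_6 v by (simp add: field_simps)
  then have s': "s_coord N ?v = - s - 2 * of_nat N * \<delta>"
    using s3 unfolding \<eta> by algebra
  have e': "d_offset N ?v + \<eta> = - s - of_nat N * \<delta>"
    using s3 unfolding d_offset_def s' v unfolding \<eta> by algebra
  have \<eta>e: "\<eta> = e + (- s - of_nat N * \<delta>)"
    unfolding \<eta> e by (simp add: algebra_simps)
  have c: "u i + \<eta> = u i + e + (- s - of_nat N * \<delta>)" for i
    unfolding \<eta>e by simp
  have d: "u i + \<eta> + d_offset N ?v = u i + (- s - of_nat N * \<delta>)" for i
    unfolding e'[symmetric] by simp
  show ?thesis
    unfolding coord_series_def N_def[symmetric] \<eta>_def[symmetric] s' v d
    unfolding c subset_series_reverse[OF A, folded N_def] s_def e_def ..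
qed

section \<open>Removing genericity along the orbit\<close>

text \<open>The entries sum to zero, and no three of them do. Moving along this direction therefore changes \<open>s\<close> at every point of
the orbit, while the amount by which b2 shifts the coordinates stays the same.\<close>
definition line_dir :: "nat \<Rightarrow> complex" where
  "line_dir i = (if i = 6 then - 5 else 1)"

lemma s_coord_line:
  assumes p: "p permutes {1..6}"
  shows "s_coord N ((\<lambda>i. u i + t * line_dir i) \<circ> p) = s_coord N (u \<circ> p) + (line_dir (p 1) + line_dir (p 2) + line_dir (p 3)) * t"
    and "line_dir (p 1) + line_dir (p 2) + line_dir (p 3) \<noteq> 0"
proof -
  have "(\<Sum>i=1..6. ((\<lambda>i. u i + t * line_dir i) \<circ> p) i) = (\<Sum>i=1..6. u i + t * line_dir i)"
    by (rule sum_compose_permutes[OF p])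
  also have "\<dots> = (\<Sum>i=1..6. u i)"
    unfolding sum_upto_6 by (simp add: line_dir_def algebra_simps)
  finally have "(\<Sum>i=1..6. ((\<lambda>i. u i + t * line_dir i) \<circ> p) i) = (\<Sum>i=1..6. (u \<circ> p) i)"
    unfolding sum_compose_permutes[OF p] .
  then show "s_coord N ((\<lambda>i. u i + t * line_dir i) \<circ> p) = s_coord N (u \<circ> p) + (line_dir (p 1) + line_dir (p 2) + line_dir (p 3)) * t"
    unfolding s_coord_def by (simp add: algebra_simps)
  have "inj p" using p permutes_inj by blast
  then have "p 1 \<noteq> p 2" "p 1 \<noteq> p 3" "p 2 \<noteq> p 3"
    by (simp_all add: inj_eq)
  then show "line_dir (p 1) + line_dir (p 2) + line_dir (p 3) \<noteq> 0"
    by (auto simp: line_dir_def)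
qed

lemma countable_not_all_regular:
  assumes A: "finite A" and x: "\<And>i j. \<lbrakk>i \<in> A; j \<in> A; i \<noteq> j\<rbrakk> \<Longrightarrow> br (x i - x j) \<noteq> 0"
  shows "countable {t. \<not> all_regular x A (\<lambda>i. u i + t * line_dir i)}"
proof -
  define N where "N = card A"
  \<comment> \<open>One affine function of \<open>t\<close> with nonzero slope for each point of the orbit and each denominator.\<close>
  define B where "B = (\<Union>p\<in>{p. p permutes {1..6}}. \<Union>i\<in>A. \<Union>r\<in>{1..N}.
     {t. br (s_coord N (u \<circ> p) + x i + of_nat r * \<delta> + (line_dir (p 1) + line_dir (p 2) + line_dir (p 3)) * t) = 0})"
  have "countable B"
    unfolding B_def
  proof (intro countable_UN countable_affine_zeros)
    show "countable {p. p permutes {1..6 :: nat}}"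
      by (intro countable_finite finite_permutations) simp
    show "countable A" using A by (rule countable_finite)
    show "line_dir (p 1) + line_dir (p 2) + line_dir (p 3) \<noteq> 0" if "p \<in> {p. p permutes {1..6}}" for p
      using s_coord_line(2) that by blast
  qed simp
  moreover have "{t. \<not> all_regular x A (\<lambda>i. u i + t * line_dir i)} \<subseteq> B"
  proof
    fix t assume "t \<in> {t. \<not> all_regular x A (\<lambda>i. u i + t * line_dir i)}"
    then obtain p i r where p: "p permutes {1..6}" "i \<in> A" "r \<in> {1..N}"
      "br (s_coord N ((\<lambda>i. u i + t * line_dir i) \<circ> p) + x i + of_nat r * \<delta>) = 0"
      unfolding all_regular_def regular_def N_def using x by blast
    have e: "s_coord N ((\<lambda>i. u i + t * line_dir i) \<circ> p) + x i + of_nat r * \<delta>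
      = s_coord N (u \<circ> p) + x i + of_nat r * \<delta> + (line_dir (p 1) + line_dir (p 2) + line_dir (p 3)) * t"
      unfolding s_coord_line(1)[OF p(1)] by simp
    show "t \<in> B" using p(1-3) p(4)[unfolded e] unfolding B_def by blast
  qed
  ultimately show ?thesis by (rule countable_subset[rotated])
qed

lemma isCont_subset_series_all:
  assumes A: "finite A" and reg: "regular x A (s a)"
    and "isCont s a" "isCont c0 a" "isCont c1 a" "isCont c2 a" "isCont d0 a" "isCont d1 a" "isCont d2 a"
  shows "isCont (\<lambda>t. subset_series x A (s t) (c0 t) (c1 t) (c2 t) (d0 t) (d1 t) (d2 t)) a"
proof -
  have base_weight: "isCont (\<lambda>t. base_weight x A (s t) I) a" if I: "I \<in> Pow A" for I
  proof -
    have n1: "br (s a + x i + of_nat (card I) * \<delta>) \<noteq> 0" if i: "i \<in> I" for i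
    proof -
      have "finite I" using A I by (auto intro: finite_subset)
      then have "0 < card I" using i by (auto simp: card_gt_0_iff)
      moreover have "card I \<le> card A" using A I by (simp add: card_mono)
      ultimately have "card I \<in> {1..card A}" by simp
      moreover have "i \<in> A" using I i by blast
      ultimately show ?thesis using reg unfolding regular_def by blast
    qed
    have n2: "br (s a + x j + of_nat (Suc (card I)) * \<delta>) \<noteq> 0" if j: "j \<in> A - I" for j
    proof -
      have "card I < card A" using I j A by (intro psubset_card_mono) auto
      then have "Suc (card I) \<in> {1..card A}" by simp
      then show ?thesis using reg j unfolding regular_def by blast
    qed
    show ?thesis
      unfolding base_weight_def by (intro continuous_intros assms n1 n2)
  qed
  have c_weight: "isCont (\<lambda>t. c_weight x A (s t) (c t) I) a" "isCont (\<lambda>t. d_weight x A (s t) (c t) I) a" if "isCont c a" for c I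
    unfolding c_weight_def d_weight_def by (intro continuous_intros assms that)+
  show ?thesis
    unfolding subset_series_def by (intro continuous_intros base_weight c_weight assms)
qed

lemma isCont_coord_series:
  assumes A: "finite A" and reg: "regular x A (s_coord (card A) (v 0))" and v: "\<And>i. isCont (\<lambda>t. v t i) 0"
  shows "isCont (\<lambda>t. coord_series x A (v t)) (0 :: complex)"
proof -
  have s: "isCont (\<lambda>t. s_coord N (v t)) 0" for N
    unfolding s_coord_def by (intro continuous_intros v) simp_all
  have e: "isCont (\<lambda>t. d_offset N (v t)) 0" for N
    unfolding d_offset_def by (intro continuous_intros v s)
  show ?thesis
    unfolding coord_series_def by (rule isCont_subset_series_all[where s = "\<lambda>t. s_coord (card A) (v t)" and a = 0, OF A reg]) (intro s v continuous_intros e)+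
qed

text \<open>Only the two ends have to be regular: off a countable set of points of the line all intermediate parameters are
regular too.\<close>
lemma coord_series_invariant:
  assumes A: "finite A" and p: "p permutes {1..6}"
    and reg: "regular x A (s_coord (card A) u)" and reg': "regular x A (s_coord (card A) (u \<circ> p))"
  shows "coord_series x A (u \<circ> p) = coord_series x A u"
proof -
  define v where "v t = (\<lambda>i. u i + t * line_dir i)" for t
  have v0: "v 0 = u" by (simp add: v_def)
  have "coord_series x A (v 0 \<circ> p) = coord_series x A (v 0)"
  proof (rule cont_eq_off_countable[where a = 0 and f = "\<lambda>t. coord_series x A (v t \<circ> p)" and g = "\<lambda>t. coord_series x A (v t)"])
    show "countable {t. \<not> all_regular x A (v t)}"
      unfolding v_def using reg by (intro countable_not_all_regular A) (simp add: regular_def)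
    show "isCont (\<lambda>t. coord_series x A (v t \<circ> p)) 0" "isCont (\<lambda>t. coord_series x A (v t)) 0"
      using reg reg' by (intro isCont_coord_series A; simp add: v_def)+
    show "coord_series x A (v t \<circ> p) = coord_series x A (v t)" if "t \<notin> {t. \<not> all_regular x A (v t)}" for t
      using that by (intro coord_series_permutes A p) simp
  qed
  then show ?thesis by (simp add: v0)
qed

lemma coord_series_dual_invariant:
  fixes x :: "'a \<Rightarrow> complex"
  assumes A: "finite A" and p: "p permutes {1..6}"
    and reg: "regular x A (s_coord (card A) u)"
  defines "x' \<equiv> \<lambda>i. (of_nat (card A) - 1) * \<delta> - x i"
    and "u' \<equiv> \<lambda>i. u i + dual_shift (card A) u"
  assumes reg': "regular x' A (s_coord (card A) (u' \<circ> p))"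
  shows "coord_series x' A (u' \<circ> p) = coord_series x A u"
proof -
  define v where "v t = (\<lambda>i. u i + t * line_dir i)" for t
  define v' where "v' t = (\<lambda>i. u' i + t * line_dir i)" for t
  define w :: "nat \<Rightarrow> nat" where "w = perm_swap 1 6 \<circ> perm_swap 2 5 \<circ> perm_swap 3 4"
  have w: "w permutes {1..6}"
    unfolding w_def by (intro permutes_compose permutes_swap_id) auto
  have v0: "v 0 = u" "v' 0 = u'" by (simp_all add: v_def v'_def)
  have dual: "v' t = (\<lambda>i. v t i + dual_shift (card A) (v t))" for t
  proof -
    have sum: "(\<Sum>i=1..6. v t i) = (\<Sum>i=1..6. u i)"
      unfolding sum_upto_6 v_def by (simp add: line_dir_def algebra_simps)
    show ?thesis unfolding dual_shift_def sum v'_def u'_def by (rule ext) (simp add: v_def)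
  qed
  have "coord_series x' A (v' 0 \<circ> p) = coord_series x A (v 0)"
  proof (rule cont_eq_off_countable[where a = 0 and f = "\<lambda>t. coord_series x' A (v' t \<circ> p)" and g = "\<lambda>t. coord_series x A (v t)"])
    show "countable {t. \<not> all_regular x' A (v' t)}"
      unfolding v'_def using reg' by (intro countable_not_all_regular A) (simp add: regular_def)
    show "isCont (\<lambda>t. coord_series x' A (v' t \<circ> p)) 0" "isCont (\<lambda>t. coord_series x A (v t)) 0"
      using reg reg' by (intro isCont_coord_series A; simp add: v_def v'_def)+
    show "coord_series x' A (v' t \<circ> p) = coord_series x A (v t)" if "t \<notin> {t. \<not> all_regular x' A (v' t)}" for t
    proof -
      have "coord_series x' A (v' t \<circ> p) = coord_series x' A (v' t \<circ> w)"
        using that coord_series_permutes[OF A _ p] coord_series_permutes[OF A _ w] by simp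
      also have "\<dots> = coord_series x A (v t)"
        unfolding dual x'_def w_def by (rule coord_series_reverse[OF A])
      finally show ?thesis .
    qed
  qed
  then show ?thesis by (simp add: v0)
qed

section \<open>Relabelling the points\<close>

lemma subset_series_reindex:
  assumes A: "finite A" and f: "bij_betw f A A"
  shows "subset_series (\<lambda>i. x (f i)) A s c0 c1 c2 d0 d1 d2 = subset_series x A s c0 c1 c2 d0 d1 d2"
proof -
  have inj: "inj_on f A" and im: "f ` A = A" using f by (auto simp: bij_betw_def)
  have bij: "bij_betw (image f) (Pow A) (Pow A)"
    using f by (rule bij_betw_Pow)
  show ?thesis
    unfolding subset_series_def
  proof (rule sum.reindex_bij_betw[OF bij, THEN subst], rule sum.cong[OF refl])
    fix I assume "I \<in> Pow A"
    then have I: "I \<subseteq> A" by simp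
    have injI: "inj_on f I" "inj_on f (A - I)" using inj I by (auto intro: inj_on_subset)
    have card: "card (f ` I) = card I" using injI(1) by (rule card_image)
    have diff: "A - f ` I = f ` (A - I)" using inj_on_image_set_diff[OF inj _ I] im by auto
    have base_weight: "base_weight (\<lambda>i. x (f i)) A s I = base_weight x A s (f ` I)"
      unfolding base_weight_def card diff by (simp add: prod.reindex[OF injI(1)] prod.reindex[OF injI(2)])
    have c_weight: "c_weight (\<lambda>i. x (f i)) A s c I = c_weight x A s c (f ` I)" for c
      unfolding c_weight_def card by (simp add: prod.reindex[OF injI(1)])
    have d_weight: "d_weight (\<lambda>i. x (f i)) A s d I = d_weight x A s d (f ` I)" for d
      unfolding d_weight_def card diff by (simp add: prod.reindex[OF injI(2)])
    show "base_weight (\<lambda>i. x (f i)) A s I * (c_weight (\<lambda>i. x (f i)) A s c1 I * (c_weight (\<lambda>i. x (f i)) A s c2 I *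
        (c_weight (\<lambda>i. x (f i)) A s c0 I * (d_weight (\<lambda>i. x (f i)) A s d0 I * (d_weight (\<lambda>i. x (f i)) A s d1 I * d_weight (\<lambda>i. x (f i)) A s d2 I)))))
      = base_weight x A s (f ` I) * (c_weight x A s c1 (f ` I) * (c_weight x A s c2 (f ` I) *
        (c_weight x A s c0 (f ` I) * (d_weight x A s d0 (f ` I) * (d_weight x A s d1 (f ` I) * d_weight x A s d2 (f ` I))))))"
      unfolding base_weight c_weight d_weight ..
  qed
qed

lemma regular_reindex:
  assumes f: "bij_betw f A A" and reg: "regular x A s"
  shows "regular (\<lambda>i. x (f i)) A s"
proof -
  have "f i \<in> A" "i \<noteq> j \<Longrightarrow> f i \<noteq> f j" if "i \<in> A" "j \<in> A" for i j
    using f that by (auto simp: bij_betw_def inj_on_eq_iff)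
  then show ?thesis using reg unfolding regular_def by metis
qed

section \<open>The action on parameters\<close>

text \<open>Extensional functions make \<open>to_coords\<close> and \<open>of_coords\<close> inverse to each other on the balancing hyperplane.\<close>
definition to_coords :: "nat \<Rightarrow> params \<Rightarrow> nat \<Rightarrow> complex" where
  "to_coords N p = (case p of (s, c, d, x) \<Rightarrow>
     (\<lambda>k\<in>{1..6}. if k \<le> 3 then c (3 - k) else d (k - 4) + (c 0 + c 1 + c 2) - 2 * s - (1 + of_nat N) * \<delta>))"

definition of_coords :: "nat \<Rightarrow> (nat \<Rightarrow> complex) \<times> (nat \<Rightarrow> complex) \<Rightarrow> params" where
  "of_coords N q = (case q of (u, x) \<Rightarrow>
     (s_coord N u, \<lambda>k\<in>{0..2}. u (3 - k), \<lambda>k\<in>{0..2}. u (4 + k) + d_offset N u, x))"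

lemma to_coords_simps [simp]:
  "to_coords N (s, c, d, x) 1 = c 2" "to_coords N (s, c, d, x) (Suc 0) = c 2"
  "to_coords N (s, c, d, x) 2 = c 1" "to_coords N (s, c, d, x) 3 = c 0"
  "to_coords N (s, c, d, x) 4 = d 0 + (c 0 + c 1 + c 2) - 2 * s - (1 + of_nat N) * \<delta>"
  "to_coords N (s, c, d, x) 5 = d 1 + (c 0 + c 1 + c 2) - 2 * s - (1 + of_nat N) * \<delta>"
  "to_coords N (s, c, d, x) 6 = d 2 + (c 0 + c 1 + c 2) - 2 * s - (1 + of_nat N) * \<delta>"
  by (simp_all add: to_coords_def numeral_2_eq_2)

lemma to_coords_extensional [simp]:
  "to_coords N p \<in> extensional {1..6}" "to_coords N p \<in> extensional {Suc 0..6}"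
  by (simp_all add: to_coords_def split: prod.splits)

lemma eq_upto_6I:
  fixes f g :: "nat \<Rightarrow> complex"
  assumes "f \<in> extensional {1..6}" "g \<in> extensional {1..6}"
    "f 1 = g 1" "f 2 = g 2" "f 3 = g 3" "f 4 = g 4" "f 5 = g 5" "f 6 = g 6"
  shows "f = g"
proof (rule extensionalityI[OF assms(1,2)])
  fix i :: nat assume "i \<in> {1..6}"
  then have "i = 1 \<or> i = 2 \<or> i = 3 \<or> i = 4 \<or> i = 5 \<or> i = 6" by auto
  then show "f i = g i" using assms(3-8) by auto
qed

lemma s_coord_3: "3 * s_coord N u = 3 * (u 1 + u 2 + u 3) - (u 1 + u 2 + u 3 + u 4 + u 5 + u 6) - (1 + 2 * of_nat N) * \<delta>"
  unfolding s_coord_def sum_upto_6 by (simp add: field_simps)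

lemma dual_shift_3: "3 * dual_shift N u = (2 - 2 * of_nat N) * \<delta> - (u 1 + u 2 + u 3 + u 4 + u 5 + u 6)"
  unfolding dual_shift_def sum_upto_6 by (simp add: field_simps)

lemma balanced_eq:
  assumes "(s, c, d, x) \<in> balanced_params \<delta> n m"
  shows "c 0 + c 1 + c 2 + (d 0 + d 1 + d 2) = (2 + of_nat (msize n m)) * \<delta> + 3 * s"
  using assms by (simp add: balanced_params_def)

lemma s_coord_to_coords:
  assumes "(s, c, d, x) \<in> balanced_params \<delta> n m"
  shows "s_coord (msize n m) (to_coords (msize n m) (s, c, d, x)) = s"
proof -
  have "3 * s_coord (msize n m) (to_coords (msize n m) (s, c, d, x)) = 3 * s"
    unfolding s_coord_3 to_coords_simps using balanced_eq[OF assms] by algebra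
  then show ?thesis by simp
qed

lemma of_coords_to_coords:
  assumes p: "(s, c, d, x) \<in> balanced_params \<delta> n m"
  shows "of_coords (msize n m) (to_coords (msize n m) (s, c, d, x), x) = (s, c, d, x)"
proof -
  have ext: "c \<in> extensional {0..2}" "d \<in> extensional {0..2}"
    using p by (auto simp: balanced_params_def PiE_def)
  have "restrict (\<lambda>k. to_coords (msize n m) (s, c, d, x) (3 - k)) {0..2} = c"
  proof (rule extensionalityI[OF restrict_extensional ext(1)])
    fix k :: nat assume k: "k \<in> {0..2}"
    then have "k = 0 \<or> k = 1 \<or> k = 2" by auto
    then have "to_coords (msize n m) (s, c, d, x) (3 - k) = c k" by (elim disjE) simp_all
    then show "restrict (\<lambda>k. to_coords (msize n m) (s, c, d, x) (3 - k)) {0..2} k = c k" using k by simp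
  qed
  moreover have "restrict (\<lambda>k. to_coords (msize n m) (s, c, d, x) (4 + k)
      + d_offset (msize n m) (to_coords (msize n m) (s, c, d, x))) {0..2} = d"
  proof (rule extensionalityI[OF restrict_extensional ext(2)])
    fix k :: nat assume k: "k \<in> {0..2}"
    then have "k = 0 \<or> k = 1 \<or> k = 2" by auto
    then have "to_coords (msize n m) (s, c, d, x) (4 + k)
        + d_offset (msize n m) (to_coords (msize n m) (s, c, d, x)) = d k"
      unfolding d_offset_def s_coord_to_coords[OF p] by (elim disjE) simp_all
    then show "restrict (\<lambda>k. to_coords (msize n m) (s, c, d, x) (4 + k)
        + d_offset (msize n m) (to_coords (msize n m) (s, c, d, x))) {0..2} k = d k" using k by simp
  qed
  ultimately show ?thesis by (simp add: of_coords_def s_coord_to_coords[OF p])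
qed

lemma to_coords_of_coords:
  assumes u: "u \<in> extensional {1..6}"
  shows "to_coords N (of_coords N (u, x)) = u"
  by (rule eq_upto_6I[OF _ u])
    (simp_all add: of_coords_def d_offset_def algebra_simps)

lemma of_coords_balanced:
  assumes "x \<in> extensional {1..n}"
  shows "of_coords (msize n m) (u, x) \<in> balanced_params \<delta> n m"
proof -
  have "u 3 + u 2 + u 1 + (u 4 + d_offset N u + (u 5 + d_offset N u) + (u 6 + d_offset N u))
      = (2 + of_nat N) * \<delta> + 3 * s_coord N u" for N
    using s_coord_3[of N u] unfolding d_offset_def by algebra
  then show ?thesis
    using assms by (simp add: of_coords_def balanced_params_def PiE_def)
qed

lemma of_coords_eqI:
  assumes "(s, c, d, x) \<in> balanced_params \<delta> n m" "to_coords (msize n m) (s, c, d, x) = u"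
  shows "of_coords (msize n m) (u, x) = (s, c, d, x)"
  using of_coords_to_coords[OF assms(1)] assms(2) by simp

definition dual_point :: "nat \<Rightarrow> (nat \<Rightarrow> nat) \<Rightarrow> (nat \<Rightarrow> complex) \<Rightarrow> nat \<Rightarrow> complex" where
  "dual_point n m x = (\<lambda>i\<in>{1..n}. - of_nat (m i) * \<delta> - x i + of_nat (msize n m) * \<delta>)"

text \<open>The inverse of \<open>\<pi>\<close> makes this a left action.\<close>
definition coord_action :: "nat \<Rightarrow> (nat \<Rightarrow> nat) \<Rightarrow> (nat \<Rightarrow> nat) \<times> (nat \<Rightarrow> nat)
    \<Rightarrow> (nat \<Rightarrow> complex) \<times> (nat \<Rightarrow> complex) \<Rightarrow> (nat \<Rightarrow> complex) \<times> (nat \<Rightarrow> complex)" where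
  "coord_action n m = (\<lambda>(\<pi>, \<tau>) (u, x). if \<tau> = id then (u \<circ> inv_into UNIV \<pi>, x)
     else (\<lambda>i\<in>{1..6}. u (inv_into UNIV \<pi> i) + dual_shift (msize n m) u, dual_point n m x))"

definition param_action :: "nat \<Rightarrow> (nat \<Rightarrow> nat) \<Rightarrow> (nat \<Rightarrow> nat) \<times> (nat \<Rightarrow> nat) \<Rightarrow> params \<Rightarrow> params" where
  "param_action n m g p = of_coords (msize n m)
     (coord_action n m g (to_coords (msize n m) p, snd (snd (snd p))))"

lemma dual_point_dual_point: "x \<in> extensional {1..n} \<Longrightarrow> dual_point n m (dual_point n m x) = x"
  by (rule extensionalityI[of _ "{1..n}"]) (simp_all add: dual_point_def)

lemma coord_action_closed:
  assumes "\<pi> permutes {1..6}" "u \<in> extensional {1..6}" "x \<in> extensional {1..n}"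
  shows "coord_action n m (\<pi>, \<tau>) (u, x) \<in> extensional {1..6} \<times> extensional {1..n}"
  using assms compose_permutes_extensional[OF assms(2) permutes_inv[OF assms(1)]]
  by (simp add: coord_action_def dual_point_def)

lemma dual_shift_compose:
  "p permutes {1..6} \<Longrightarrow> dual_shift N (u \<circ> p) = dual_shift N u"
  unfolding dual_shift_def by (subst sum_compose_permutes) simp_all

text \<open>The shift changes sign because b2 reflects the sum of the coordinates; thus b2 is an involution.\<close>
lemma dual_shift_dual:
  assumes p: "p permutes {1..6}"
  shows "dual_shift N (\<lambda>i\<in>{1..6}. u (p i) + dual_shift N u) = - dual_shift N u"
proof -
  have "(\<Sum>i=1..6. (\<lambda>i\<in>{1..6}. u (p i) + dual_shift N u) i) = (\<Sum>i=1..6. (u \<circ> p) i + dual_shift N u)"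
    by (intro sum.cong) auto
  also have "\<dots> = (\<Sum>i=1..6. u i) + 6 * dual_shift N u"
    unfolding sum.distrib sum_compose_permutes[OF p] by simp
  moreover have sum3: "3 * dual_shift N v = (2 - 2 * of_nat N) * \<delta> - (\<Sum>i=1..6. v i)" for v
    unfolding dual_shift_def by (simp add: field_simps)
  ultimately have "3 * dual_shift N (\<lambda>i\<in>{1..6}. u (p i) + dual_shift N u)
      = (2 - 2 * of_nat N) * \<delta> - (\<Sum>i=1..6. u i) - 6 * dual_shift N u"
    by simp
  also have "\<dots> = 3 * - dual_shift N u" using sum3[of u] by algebra
  finally show ?thesis by (simp only: mult_cancel_left) simp
qed

lemma coord_action_mult:
  assumes \<pi>: "\<pi> permutes {1..6}" "\<pi>' permutes {1..6}"
    and \<tau>: "\<tau> permutes {1..2}" "\<tau>' permutes {1..2}"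
    and u: "u \<in> extensional {1..6}" and x: "x \<in> extensional {1..n}"
  shows "coord_action n m (\<pi> \<circ> \<pi>', \<tau> \<circ> \<tau>') (u, x) = coord_action n m (\<pi>, \<tau>) (coord_action n m (\<pi>', \<tau>') (u, x))"
proof -
  have inv: "inv_into UNIV (\<pi> \<circ> \<pi>') = inv_into UNIV \<pi>' \<circ> inv_into UNIV \<pi>"
    using \<pi> by (intro o_inv_distrib permutes_bij)
  have inv_perm: "inv_into UNIV \<pi> permutes {1..6}" "inv_into UNIV \<pi>' permutes {1..6}"
    using \<pi> by (simp_all add: permutes_inv)
  have mem: "inv_into UNIV \<pi> i \<in> {1..6} \<longleftrightarrow> i \<in> {1..6}" for i
    by (rule permutes_in_image[OF inv_perm(1)])
  have ne: "perm_swap 1 (2 :: nat) \<noteq> id"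
    by (metis id_apply one_eq_numeral_iff semiring_norm(85) transpose_apply_first)
  have ss: "perm_swap 1 (2 :: nat) \<circ> perm_swap 1 2 = id" by simp
  have u_out: "u i = undefined" if "i \<notin> {1..6}" for i
    using u that by (simp add: extensional_def)
  consider "\<tau> = id" "\<tau>' = id" | "\<tau> = id" "\<tau>' = perm_swap 1 2"
    | "\<tau> = perm_swap 1 2" "\<tau>' = id" | "\<tau> = perm_swap 1 2" "\<tau>' = perm_swap 1 2"
    using \<tau> unfolding permutes_two by blast
  then show ?thesis
  proof cases
    case 1
    then show ?thesis by (simp add: coord_action_def inv o_assoc)
  next
    case 2
    then show ?thesis using mem ne by (auto simp: coord_action_def inv fun_eq_iff)
  next
    case 3
    then show ?thesis using ne by (simp add: coord_action_def inv dual_shift_compose[OF inv_perm(2)])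
  next
    case 4
    have "u \<circ> (inv_into UNIV \<pi>' \<circ> inv_into UNIV \<pi>) = (\<lambda>i\<in>{1..6}. (\<lambda>i\<in>{1..6}. u (inv_into UNIV \<pi>' i) + dual_shift (msize n m) u) (inv_into UNIV \<pi> i) + - dual_shift (msize n m) u)"
    proof
      fix i
      show "(u \<circ> (inv_into UNIV \<pi>' \<circ> inv_into UNIV \<pi>)) i = (\<lambda>i\<in>{1..6}. (\<lambda>i\<in>{1..6}. u (inv_into UNIV \<pi>' i) + dual_shift (msize n m) u) (inv_into UNIV \<pi> i) + - dual_shift (msize n m) u) i"
      proof (cases "i \<in> {1..6}")
        case True
        then have "inv_into UNIV \<pi> i \<in> {1..6}" using mem by simp
        then show ?thesis using True by simp
      next
        case False
        then have "inv_into UNIV \<pi>' (inv_into UNIV \<pi> i) \<notin> {1..6}"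
          using mem permutes_in_image[OF inv_perm(2)] by simp
        then have "(u \<circ> (inv_into UNIV \<pi>' \<circ> inv_into UNIV \<pi>)) i = undefined"
          using u_out by (simp only: o_apply)
        then show ?thesis using False by (simp only: restrict_apply if_False)
      qed
    qed
    moreover define w where "w = (\<lambda>i\<in>{1..6}. u (inv_into UNIV \<pi>' i) + dual_shift (msize n m) u)"
    ultimately have w: "u \<circ> (inv_into UNIV \<pi>' \<circ> inv_into UNIV \<pi>)
        = (\<lambda>i\<in>{1..6}. w (inv_into UNIV \<pi> i) + dual_shift (msize n m) w)"
      using dual_shift_dual[OF inv_perm(2)] by (simp only: w_def)
    have "coord_action n m (\<pi> \<circ> \<pi>', \<tau> \<circ> \<tau>') (u, x) = (u \<circ> (inv_into UNIV \<pi>' \<circ> inv_into UNIV \<pi>), x)"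
      using 4 ss by (simp add: coord_action_def inv)
    moreover have "coord_action n m (\<pi>', \<tau>') (u, x) = (w, dual_point n m x)"
      using 4 ne by (simp add: coord_action_def w_def)
    moreover have "coord_action n m (\<pi>, \<tau>) (w, dual_point n m x)
        = (\<lambda>i\<in>{1..6}. w (inv_into UNIV \<pi> i) + dual_shift (msize n m) w, x)"
      using 4 ne by (simp add: coord_action_def dual_point_dual_point[OF x])
    ultimately show ?thesis unfolding w by (simp only:)
  qed
qed

lemma snd_of_coords: "snd (snd (snd (of_coords N (u, x)))) = x"
  by (simp add: of_coords_def)

lemma balanced_x_extensional: "p \<in> balanced_params \<delta> n m \<Longrightarrow> snd (snd (snd p)) \<in> extensional {1..n}"
  by (auto simp: balanced_params_def PiE_def)

abbreviation "sym_product \<equiv> sym_group 6 \<times>\<times> sym_group 2"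

lemma sym_product_group_action:
  "group_action sym_product (balanced_params \<delta> n m) (\<lambda>g. restrict (param_action n m g) (balanced_params \<delta> n m))"
proof (rule group_actionI)
  show "group sym_product"
    by (intro DirProd_group sym_group_is_group)
  fix p assume p: "p \<in> balanced_params \<delta> n m"
  define u where "u = to_coords (msize n m) p"
  define x where "x = snd (snd (snd p))"
  have u: "u \<in> extensional {1..6}" by (simp add: u_def)
  have x: "x \<in> extensional {1..n}" unfolding x_def by (rule balanced_x_extensional[OF p])
  show "param_action n m \<one>\<^bsub>sym_product\<^esub> p = p"
    using of_coords_to_coords p by (cases p) (simp add: param_action_def coord_action_def sym_group_def)
  fix g assume g: "g \<in> carrier sym_product"
  then obtain \<pi> \<tau> where g': "g = (\<pi>, \<tau>)" "\<pi> permutes {1..6}" "\<tau> permutes {1..2}"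
    by (auto simp: sym_group_def)
  obtain u' x' where ux: "coord_action n m g (u, x) = (u', x')" by fastforce
  have ux': "u' \<in> extensional {1..6}" "x' \<in> extensional {1..n}"
    using coord_action_closed[OF g'(2) u x, of m \<tau>] ux g'(1) by auto
  have act: "param_action n m g p = of_coords (msize n m) (u', x')"
    by (simp add: param_action_def u_def[symmetric] x_def[symmetric] ux)
  show "param_action n m g p \<in> balanced_params \<delta> n m"
    unfolding act using ux'(2) by (rule of_coords_balanced)
  fix h assume "h \<in> carrier sym_product"
  then obtain \<pi>' \<tau>' where h': "h = (\<pi>', \<tau>')" "\<pi>' permutes {1..6}" "\<tau>' permutes {1..2}"
    by (auto simp: sym_group_def)
  have "coord_action n m (h \<otimes>\<^bsub>sym_product\<^esub> g) (u, x) = coord_action n m h (u', x')"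
    using coord_action_mult[OF h'(2) g'(2) h'(3) g'(3) u x, of m] ux g'(1) h'(1)
    by (simp add: sym_group_def)
  then show "param_action n m (h \<otimes>\<^bsub>sym_product\<^esub> g) p = param_action n m h (param_action n m g p)"
    unfolding act
    by (simp add: param_action_def to_coords_of_coords[OF ux'(1)] snd_of_coords u_def[symmetric] x_def[symmetric])
qed

lemma param_action_swap:
  assumes p: "(s, c, d, x) \<in> balanced_params \<delta> n m" and q: "(s', c', d', x) \<in> balanced_params \<delta> n m"
    and ab: "a \<in> {1..6}" "b \<in> {1..6}"
    and eq: "\<And>k. k \<in> {1, 2, 3, 4, 5, 6} \<Longrightarrow>
      to_coords (msize n m) (s', c', d', x) k = to_coords (msize n m) (s, c, d, x) (perm_swap a b k)"
  shows "param_action n m (perm_swap a b, id) (s, c, d, x) = (s', c', d', x)"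
proof -
  have "perm_swap a b permutes {1..6}" using ab by (rule permutes_swap_id)
  then have "to_coords (msize n m) (s, c, d, x) \<circ> perm_swap a b \<in> extensional {1..6}"
    by (intro compose_permutes_extensional) simp_all
  then have "to_coords (msize n m) (s', c', d', x) = to_coords (msize n m) (s, c, d, x) \<circ> perm_swap a b"
    by (rule eq_upto_6I[OF to_coords_extensional(1)]) (simp_all only: o_apply eq insert_iff simp_thms)
  then show ?thesis
    using of_coords_eqI[OF q] by (simp add: param_action_def coord_action_def)
qed

lemma param_action_generators:
  assumes p: "p \<in> balanced_params \<delta> n m"
  shows "param_action n m (perm_swap 1 2, id) p = s_map 1 p"
    "param_action n m (perm_swap 2 3, id) p = s_map 0 p"
    "param_action n m (perm_swap 3 4, id) p = b1_map \<delta> p"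
    "param_action n m (perm_swap 4 5, id) p = t_map 0 p"
    "param_action n m (perm_swap 5 6, id) p = t_map 1 p"
    "param_action n m (id, perm_swap 1 2) p = b2_map \<delta> n m p"
proof -
  obtain s c d x where p': "p = (s, c, d, x)" by (cases p)
  note b = p[unfolded p']
  have ext: "c \<in> extensional {0..2}" "d \<in> extensional {0..2}" "x \<in> extensional {1..n}"
    using b by (auto simp: balanced_params_def PiE_def)
  note eq = balanced_eq[OF b]
  show "param_action n m (perm_swap 1 2, id) p = s_map 1 p"
    unfolding p' s_map.simps one_add_one add_0
  proof (rule param_action_swap[OF b])
    show "(s, c(1 := c 2, 2 := c 1), d, x) \<in> balanced_params \<delta> n m"
      using b by (simp add: balanced_params_def PiE_def extensional_def add_ac)
  qed (auto simp: Transposition.transpose_def)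
  show "param_action n m (perm_swap 2 3, id) p = s_map 0 p"
    unfolding p' s_map.simps one_add_one add_0
  proof (rule param_action_swap[OF b])
    show "(s, c(0 := c 1, 1 := c 0), d, x) \<in> balanced_params \<delta> n m"
      using b by (simp add: balanced_params_def PiE_def extensional_def add_ac)
  qed (auto simp: Transposition.transpose_def)
  show "param_action n m (perm_swap 4 5, id) p = t_map 0 p"
    unfolding p' t_map.simps one_add_one add_0
  proof (rule param_action_swap[OF b])
    show "(s, c, d(0 := d 1, 1 := d 0), x) \<in> balanced_params \<delta> n m"
      using b by (simp add: balanced_params_def PiE_def extensional_def add_ac)
  qed (auto simp: Transposition.transpose_def)
  show "param_action n m (perm_swap 5 6, id) p = t_map 1 p"
    unfolding p' t_map.simps one_add_one add_0
  proof (rule param_action_swap[OF b])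
    show "(s, c, d(1 := d 2, 2 := d 1), x) \<in> balanced_params \<delta> n m"
      using b by (simp add: balanced_params_def PiE_def extensional_def add_ac)
  qed (auto simp: Transposition.transpose_def)
  show "param_action n m (perm_swap 3 4, id) p = b1_map \<delta> p"
    unfolding p' b1_map.simps
  proof (rule param_action_swap[OF b])
    show "(2 * s + \<delta> - c 0 - d 1 - d 2, c(0 := s + \<delta> - d 1 - d 2),
        d(1 := s + \<delta> - c 0 - d 2, 2 := s + \<delta> - c 0 - d 1), x) \<in> balanced_params \<delta> n m"
    proof -
      have "s + \<delta> - d 1 - d 2 + c 1 + c 2 + (d 0 + (s + \<delta> - c 0 - d 2) + (s + \<delta> - c 0 - d 1))
          = (2 + of_nat (msize n m)) * \<delta> + 3 * (2 * s + \<delta> - c 0 - d 1 - d 2)"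
        using eq by algebra
      then show ?thesis using ext by (simp add: balanced_params_def PiE_def extensional_def add_ac)
    qed
    have e: "c 0 = d 0 + (s + \<delta> - d 1 - d 2 + c 1 + c 2) - 2 * (2 * s + \<delta> - c 0 - d 1 - d 2) - (1 + of_nat (msize n m)) * \<delta>"
      "s + \<delta> - d 1 - d 2 = d 0 + (c 0 + c 1 + c 2) - 2 * s - (1 + of_nat (msize n m)) * \<delta>"
      using eq by algebra+
    show "to_coords (msize n m) (2 * s + \<delta> - c 0 - d 1 - d 2, c(0 := s + \<delta> - d 1 - d 2),
        d(1 := s + \<delta> - c 0 - d 2, 2 := s + \<delta> - c 0 - d 1), x) k
      = to_coords (msize n m) (s, c, d, x) (perm_swap 3 4 k)" if k: "k \<in> {1, 2, 3, 4, 5, 6}" for k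
    proof -
      consider "k = 1" | "k = 2" | "k = 3" | "k = 4" | "k = 5" | "k = 6" using k by blast
      then show ?thesis
      proof cases
        case 3
        then show ?thesis using e(2) by simp
      next
        case 4
        then show ?thesis using e(1) by simp
      qed (simp_all add: Transposition.transpose_def algebra_simps)
    qed
  qed simp_all
  define \<eta> where "\<eta> = s + \<delta> - (c 0 + c 1 + c 2)"
  have \<eta>: "dual_shift (msize n m) (to_coords (msize n m) (s, c, d, x)) = \<eta>"
  proof -
    have "3 * dual_shift (msize n m) (to_coords (msize n m) (s, c, d, x)) = 3 * \<eta>"
      unfolding dual_shift_3 to_coords_simps \<eta>_def using eq by algebra
    then show ?thesis by simp
  qed
  show "param_action n m (id, perm_swap 1 2) p = b2_map \<delta> n m p"
  proof -
    have ne: "perm_swap 1 (2 :: nat) \<noteq> id"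
      by (metis id_apply one_eq_numeral_iff semiring_norm(85) transpose_apply_first)
    let ?q = "(2 * s + \<delta> - c 0 - c 1 - c 2,
      c(0 := s + \<delta> - c 1 - c 2, 1 := s + \<delta> - c 0 - c 2, 2 := s + \<delta> - c 0 - c 1), d, dual_point n m x)"
    have "s + \<delta> - c 1 - c 2 + (s + \<delta> - c 0 - c 2) + (s + \<delta> - c 0 - c 1) + (d 0 + d 1 + d 2)
        = (2 + of_nat (msize n m)) * \<delta> + 3 * (2 * s + \<delta> - c 0 - c 1 - c 2)"
      using eq by algebra
    then have bq: "?q \<in> balanced_params \<delta> n m"
      using ext by (simp add: balanced_params_def PiE_def extensional_def dual_point_def add_ac)
    have "to_coords (msize n m) ?q = (\<lambda>i\<in>{1..6}. to_coords (msize n m) (s, c, d, x) i + \<eta>)"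
      by (rule eq_upto_6I) (simp_all add: \<eta>_def algebra_simps)
    then show ?thesis
      using of_coords_eqI[OF bq] ne unfolding p' b2_map.simps dual_point_def[symmetric]
      by (simp add: param_action_def coord_action_def \<eta>)
  qed
qed

lemma coord_series_cong:
  assumes x: "\<And>i. i \<in> A \<Longrightarrow> x i = x' i" and u: "\<And>k. k \<in> {1..6} \<Longrightarrow> u k = u' k"
  shows "coord_series x A u = coord_series x' A u'"
proof -
  have s: "s_coord N u = s_coord N u'" for N using u by (simp add: s_coord_def)
  have sh: "d_offset N u = d_offset N u'" for N using u by (simp add: d_offset_def s)
  have base_weight: "base_weight x A t I = base_weight x' A t I" if "I \<subseteq> A" for t I
    unfolding base_weight_def using x that by (intro arg_cong2[where f = "(*)"] prod.cong refl) auto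
  have c_weight: "c_weight x A t c I = c_weight x' A t c I" if "I \<subseteq> A" for t c I
    unfolding c_weight_def using x that by (intro arg_cong2[where f = "(*)"] prod.cong refl) auto
  have d_weight: "d_weight x A t d I = d_weight x' A t d I" if "I \<subseteq> A" for t d I
    unfolding d_weight_def using x by (intro arg_cong2[where f = "(*)"] prod.cong refl) auto
  show ?thesis
    unfolding coord_series_def subset_series_def s sh using u by (intro sum.cong refl) (simp add: base_weight c_weight d_weight)
qed

lemma regular_cong: "(\<And>i. i \<in> A \<Longrightarrow> x i = x' i) \<Longrightarrow> regular x A s = regular x' A s"
  unfolding regular_def by simp

lemma E_tilde_of_coords:
  assumes g: "generic br \<delta> n m (of_coords (msize n m) (u, x))"
  shows "E_tilde br \<delta> n m (of_coords (msize n m) (u, x)) = coord_series (block_point x) (block n m) u"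
    and "regular (block_point x) (block n m) (s_coord (msize n m) u)"
  using E_tilde_eq_subset_series[OF g[unfolded of_coords_def prod.case]] generic_regular[OF g[unfolded of_coords_def prod.case]]
  by (simp_all add: of_coords_def coord_series_def numeral_2_eq_2 numeral_3_eq_3)

text \<open>The map b2 reflects the points, which reverses the order inside every block.\<close>
definition flip_block :: "(nat \<Rightarrow> nat) \<Rightarrow> nat \<times> nat \<Rightarrow> nat \<times> nat" where
  "flip_block m p = (fst p, m (fst p) - Suc (snd p))"

lemma flip_block:
  "bij_betw (flip_block m) (block n m) (block n m)"
  "p \<in> block n m \<Longrightarrow> flip_block m (flip_block m p) = p"
proof -
  show i: "flip_block m (flip_block m p) = p" if "p \<in> block n m" for p
    using that by (auto simp: flip_block_def block_def)
  show "bij_betw (flip_block m) (block n m) (block n m)"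
    by (rule bij_betw_byWitness[where f' = "flip_block m"]) (use i in \<open>auto simp: flip_block_def block_def\<close>)
qed

lemma block_point_dual:
  assumes "p \<in> block n m"
  shows "block_point (dual_point n m x) p = (of_nat (msize n m) - 1) * \<delta> - block_point x (flip_block m p)"
  using assms by (auto simp: block_point_def dual_point_def flip_block_def block_def of_nat_diff algebra_simps)

text \<open>Both ends are generic, so both normalised series are subset sums. For elements acting through b2 the reflected blocks first have to be
relabelled.\<close>
lemma E_tilde_invariant:
  assumes g: "g \<in> carrier sym_product" and p: "p \<in> balanced_params \<delta> n m"
    and gen: "generic br \<delta> n m p" and gen': "generic br \<delta> n m (param_action n m g p)"
  shows "E_tilde br \<delta> n m (param_action n m g p) = E_tilde br \<delta> n m p"
proof -
  define M where "M = msize n m"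
  define A where "A = block n m"
  have A: "finite A" "card A = M" by (simp_all add: A_def M_def)
  obtain s c d x where p': "p = (s, c, d, x)" by (cases p)
  define u where "u = to_coords M p"
  have pu: "p = of_coords M (u, x)"
    using of_coords_to_coords p unfolding p' u_def M_def by simp
  note E = E_tilde_of_coords[OF gen[unfolded pu M_def], folded M_def A_def]
  obtain \<pi> \<tau> where g': "g = (\<pi>, \<tau>)" "\<pi> permutes {1..6}" "\<tau> permutes {1..2}"
    using g by (auto simp: sym_group_def)
  have inv_perm: "inv_into UNIV \<pi> permutes {1..6}" using g'(2) by (rule permutes_inv)
  have act: "param_action n m g p = of_coords M (coord_action n m g (u, x))"
    by (simp add: param_action_def u_def p' M_def)
  show ?thesis
  proof (cases "\<tau> = id")
    case True
    then have act': "param_action n m g p = of_coords M (u \<circ> inv_into UNIV \<pi>, x)"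
      unfolding act by (simp add: coord_action_def g'(1))
    note E' = E_tilde_of_coords[OF gen'[unfolded act' M_def], folded M_def A_def]
    show ?thesis
      unfolding act' unfolding pu E(1) E'(1) using E(2) E'(2) A by (intro coord_series_invariant inv_perm) simp_all
  next
    case False
    define u' where "u' = (\<lambda>i. u i + dual_shift M u) \<circ> inv_into UNIV \<pi>"
    define u'' where "u'' = restrict u' {1..6}"
    define x' where "x' = dual_point n m x"
    define X where "X = (\<lambda>q. (of_nat (card A) - 1) * \<delta> - block_point x q)"
    have act': "param_action n m g p = of_coords M (u'', x')"
      unfolding act using False by (simp add: coord_action_def g'(1) u''_def u'_def x'_def M_def o_def)
    note E' = E_tilde_of_coords[OF gen'[unfolded act' M_def], folded M_def A_def]
    have xX: "block_point x' q = X (flip_block m q)" if "q \<in> A" for q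
      using block_point_dual that by (simp add: X_def x'_def A_def)
    have f: "bij_betw (flip_block m) A A" unfolding A_def by (rule flip_block)
    have s: "s_coord M u'' = s_coord M u'" by (simp add: s_coord_def u''_def)
    have "coord_series (block_point x') A u'' = coord_series (\<lambda>q. X (flip_block m q)) A u'"
      by (rule coord_series_cong) (simp_all add: xX u''_def)
    also have "\<dots> = coord_series X A u'"
      unfolding coord_series_def by (rule subset_series_reindex[OF A(1) f])
    also have "\<dots> = coord_series (block_point x) A u"
      unfolding u'_def X_def A(2)[symmetric]
    proof (rule coord_series_dual_invariant[OF A(1) inv_perm])
      show "regular (block_point x) A (s_coord (card A) u)" using E(2) A(2) by simp
      have "regular (\<lambda>q. block_point x' (flip_block m q)) A (s_coord M u')"
        using E'(2) s by (intro regular_reindex[OF f]) simp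
      moreover have "regular (\<lambda>q. block_point x' (flip_block m q)) A (s_coord M u') = regular X A (s_coord M u')"
      proof (rule regular_cong)
        fix q assume that: "q \<in> A"
        have "flip_block m q \<in> A" using f that by (auto simp: bij_betw_def)
        then show "block_point x' (flip_block m q) = X q" using xX flip_block(2) that by (simp add: A_def)
      qed
      ultimately have "regular X A (s_coord M u')" by simp
      then show "regular (\<lambda>q. (of_nat (card A) - 1) * \<delta> - block_point x q) A
          (s_coord (card A) ((\<lambda>i. u i + dual_shift (card A) u) \<circ> inv_into UNIV \<pi>))"
        by (simp add: X_def u'_def A(2))
    qed
    finally show ?thesis unfolding act' unfolding pu E(1) E'(1) .
  qed
qed

end

section \<open>The Weierstrass sigma function as an infinite product\<close>

locale period_pair =
  fixes \<omega>1 \<omega>2 :: complex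
  assumes independent: "\<omega>1 / \<omega>2 \<notin> \<real>"
begin

abbreviation "periods \<equiv> period_lattice \<omega>1 \<omega>2"
abbreviation "wsigma \<equiv> weierstrass_sigma \<omega>1 \<omega>2"

definition lattice_pt :: "int \<times> int \<Rightarrow> complex" where
  "lattice_pt p = of_int (fst p) * \<omega>1 + of_int (snd p) * \<omega>2"

lemma lattice_eq: "periods = range lattice_pt"
  unfolding period_lattice_def lattice_pt_def image_def by force

lemma norm_bound:
  obtains c where "c > 0" "\<And>a b :: real. c * (\<bar>a\<bar> + \<bar>b\<bar>) \<le> norm (of_real a * \<omega>1 + of_real b * \<omega>2)"
proof -
  define \<tau> where "\<tau> = \<omega>1 / \<omega>2"
  have \<omega>2: "\<omega>2 \<noteq> 0" using independent by auto
  have im: "Im \<tau> \<noteq> 0" using independent by (simp add: \<tau>_def complex_is_Real_iff)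
  define K where "K = 1 / \<bar>Im \<tau>\<bar> + 1 + norm \<tau> / \<bar>Im \<tau>\<bar>"
  have K: "K > 0" unfolding K_def using im by (simp add: add_pos_nonneg)
  have "norm \<omega>2 / K * (\<bar>a\<bar> + \<bar>b\<bar>) \<le> norm (of_real a * \<omega>1 + of_real b * \<omega>2)" for a b :: real
  proof -
    define v where "v = of_real a * \<tau> + of_real b"
    have "\<bar>a\<bar> * \<bar>Im \<tau>\<bar> \<le> norm v"
      using abs_Im_le_cmod[of v] by (simp add: v_def abs_mult)
    then have a: "\<bar>a\<bar> \<le> norm v / \<bar>Im \<tau>\<bar>" using im by (simp add: field_simps)
    have "\<bar>b\<bar> = norm (v - of_real a * \<tau>)" by (simp add: v_def)
    also have "\<dots> \<le> norm v + \<bar>a\<bar> * norm \<tau>"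
      using norm_triangle_ineq4[of v "of_real a * \<tau>"] by (simp add: norm_mult)
    also have "\<dots> \<le> norm v + norm v / \<bar>Im \<tau>\<bar> * norm \<tau>"
      using a by (intro add_left_mono mult_right_mono) auto
    finally have "\<bar>a\<bar> + \<bar>b\<bar> \<le> K * norm v" using a by (simp add: K_def algebra_simps)
    then have "norm \<omega>2 / K * (\<bar>a\<bar> + \<bar>b\<bar>) \<le> norm \<omega>2 / K * (K * norm v)"
      using K by (intro mult_left_mono) auto
    also have "\<dots> = norm (\<omega>2 * v)" using K by (simp add: norm_mult)
    also have "\<omega>2 * v = of_real a * \<omega>1 + of_real b * \<omega>2"
      using \<omega>2 by (simp add: v_def \<tau>_def algebra_simps)
    finally show ?thesis .
  qed
  then show ?thesis using that[of "norm \<omega>2 / K"] K \<omega>2 by auto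
qed

lemma norm_lattice_pt_bound:
  obtains c where "c > 0" "\<And>p. c * (real_of_int \<bar>fst p\<bar> + real_of_int \<bar>snd p\<bar>) \<le> norm (lattice_pt p)"
proof -
  obtain c where c: "c > 0" "\<And>a b :: real. c * (\<bar>a\<bar> + \<bar>b\<bar>) \<le> norm (of_real a * \<omega>1 + of_real b * \<omega>2)"
    by (rule norm_bound) blast
  have "c * (real_of_int \<bar>fst p\<bar> + real_of_int \<bar>snd p\<bar>) \<le> norm (lattice_pt p)" for p
    using c(2)[of "of_int (fst p)" "of_int (snd p)"] by (simp add: lattice_pt_def)
  then show ?thesis using that c(1) by blast
qed

lemma lattice_pt_add: "lattice_pt (a + a', b + b') = lattice_pt (a, b) + lattice_pt (a', b')"
  by (simp add: lattice_pt_def algebra_simps)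

lemma lattice_pt_0: "lattice_pt (0, 0) = 0" by (simp add: lattice_pt_def)

lemma inj_lattice_pt: "inj lattice_pt"
proof (rule injI)
  fix p q assume eq: "lattice_pt p = lattice_pt q"
  obtain c where c: "c > 0" "\<And>p. c * (real_of_int \<bar>fst p\<bar> + real_of_int \<bar>snd p\<bar>) \<le> norm (lattice_pt p)"
    by (rule norm_lattice_pt_bound) blast
  have "lattice_pt (fst p - fst q, snd p - snd q) = 0"
    using eq by (simp add: lattice_pt_def algebra_simps)
  then have "c * (real_of_int \<bar>fst p - fst q\<bar> + real_of_int \<bar>snd p - snd q\<bar>) \<le> 0"
    using c(2)[of "(fst p - fst q, snd p - snd q)"] by simp
  then have "real_of_int \<bar>fst p - fst q\<bar> + real_of_int \<bar>snd p - snd q\<bar> \<le> 0"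
    using c(1) by (simp add: mult_le_0_iff)
  then have "real_of_int \<bar>fst p - fst q\<bar> = 0" "real_of_int \<bar>snd p - snd q\<bar> = 0" by linarith+
  then show "p = q" by (simp add: prod_eq_iff)
qed

lemma lattice_add: "\<omega> \<in> periods \<Longrightarrow> \<omega>' \<in> periods \<Longrightarrow> \<omega> + \<omega>' \<in> periods"
  unfolding lattice_eq by (force simp flip: lattice_pt_add)

lemma lattice_uminus: "\<omega> \<in> periods \<Longrightarrow> - \<omega> \<in> periods"
proof -
  have "- lattice_pt p = lattice_pt (- fst p, - snd p)" for p by (simp add: lattice_pt_def)
  then show "\<omega> \<in> periods \<Longrightarrow> - \<omega> \<in> periods" unfolding lattice_eq by force
qed

lemma lattice_diff: "\<omega> \<in> periods \<Longrightarrow> \<omega>' \<in> periods \<Longrightarrow> \<omega> - \<omega>' \<in> periods"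
  using lattice_add[OF _ lattice_uminus] by fastforce

lemma lattice_0: "0 \<in> periods" unfolding lattice_eq using lattice_pt_0 by (metis rangeI)

lemma countable_lattice: "countable periods" unfolding lattice_eq by simp

lemma finite_lattice_ball: "finite {\<omega> \<in> periods. norm \<omega> < r}"
proof -
  obtain c where c: "c > 0" "\<And>p. c * (real_of_int \<bar>fst p\<bar> + real_of_int \<bar>snd p\<bar>) \<le> norm (lattice_pt p)"
    by (rule norm_lattice_pt_bound) blast
  define N where "N = \<lceil>r / c\<rceil>"
  have "{\<omega> \<in> periods. norm \<omega> < r} \<subseteq> lattice_pt ` ({-N..N} \<times> {-N..N})"
  proof
    fix \<omega> assume "\<omega> \<in> {\<omega> \<in> periods. norm \<omega> < r}"
    then obtain p where p: "\<omega> = lattice_pt p" "norm (lattice_pt p) < r" unfolding lattice_eq by auto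
    have "c * (real_of_int \<bar>fst p\<bar> + real_of_int \<bar>snd p\<bar>) < r" using c(2)[of p] p(2) by linarith
    then have "real_of_int \<bar>fst p\<bar> + real_of_int \<bar>snd p\<bar> < r / c" using c(1) by (simp add: field_simps)
    then have "\<bar>fst p\<bar> \<le> N" "\<bar>snd p\<bar> \<le> N" unfolding N_def by linarith+
    then have "p \<in> {-N..N} \<times> {-N..N}" by (auto simp: mem_Times_iff)
    then show "\<omega> \<in> lattice_pt ` ({-N..N} \<times> {-N..N})" using p(1) by blast
  qed
  then show ?thesis by (rule finite_subset) simp
qed

lemma summable_int_powr: "(\<lambda>i::int. (1 + real_of_int \<bar>i\<bar>) powr (-3/2)) summable_on UNIV"
proof -
  have s: "(\<lambda>n::nat. (1 + real n) powr (-3/2)) summable_on UNIV"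
  proof (subst summable_on_UNIV_nonneg_real_iff)
    have "summable (\<lambda>n. real n powr (-3/2))" by (subst summable_real_powr_iff) simp
    then show "summable (\<lambda>n. (1 + real n) powr (-3/2))"
      by (subst (asm) summable_Suc_iff[symmetric]) (simp add: add.commute)
  qed simp
  have "(\<lambda>i::int. (1 + real_of_int \<bar>i\<bar>) powr (-3/2)) summable_on (range int)"
    using s by (subst summable_on_reindex) (auto simp: o_def inj_on_def)
  moreover have "(\<lambda>i::int. (1 + real_of_int \<bar>i\<bar>) powr (-3/2)) summable_on ((\<lambda>n. - int n) ` {0<..})"
    using summable_on_subset_banach[OF s, of "{0<..}"] by (subst summable_on_reindex) (auto simp: o_def inj_on_def)
  moreover have "range int \<inter> (\<lambda>n. - int n) ` {0<..} = {}" by auto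
  moreover have "range int \<union> (\<lambda>n. - int n) ` {0<..} = UNIV"
  proof -
    have "i \<in> range int \<union> (\<lambda>n. - int n) ` {0<..}" for i
    proof (cases "i \<ge> 0")
      case True
      then show ?thesis by (metis UnI1 nat_0_le rangeI)
    next
      case False
      then have "i = - int (nat (- i))" "nat (- i) \<in> {0<..}" by auto
      then show ?thesis by blast
    qed
    then show ?thesis by blast
  qed
  ultimately show ?thesis by (metis summable_on_Un_disjoint)
qed

text \<open>In terms of the coordinates \<open>(a, b)\<close> of a nonzero period, \<open>(1 + \<bar>a\<bar>) (1 + \<bar>b\<bar>)\<close> is at most a multiple of the square of the norm; so the terms are
dominated by a product of two convergent series.\<close>
lemma summable_lattice: "(\<lambda>\<omega>. 1 / norm \<omega> ^ 3) summable_on (periods - {0})"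
proof -
  define h where "h i = (1 + real_of_int \<bar>i\<bar>) powr (-3/2)" for i
  obtain c where c: "c > 0" "\<And>p. c * (real_of_int \<bar>fst p\<bar> + real_of_int \<bar>snd p\<bar>) \<le> norm (lattice_pt p)"
    by (rule norm_lattice_pt_bound) blast
  have h: "(h has_sum infsum h UNIV) UNIV"
    using summable_int_powr by (simp add: h_def[abs_def])
  have "(\<lambda>p. case p of (a, b) \<Rightarrow> h a * h b) summable_on (UNIV \<times> UNIV)"
  proof (rule summable_on_SigmaI)
    show "((\<lambda>y. case (a, y) of (a, b) \<Rightarrow> h a * h b) has_sum h a * infsum h UNIV) UNIV" for a
      using has_sum_cmult_right[OF h] by simp
    show "(\<lambda>a. h a * infsum h UNIV) summable_on UNIV"
      using h by (intro summable_on_cmult_left) (auto simp: summable_on_def)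
  qed (simp add: h_def)
  then have "(\<lambda>p. h (fst p) * h (snd p)) summable_on UNIV"
    by (simp add: case_prod_unfold)
  then have "(\<lambda>p. h (fst p) * h (snd p)) summable_on (UNIV - {(0, 0)})"
    by (rule summable_on_subset_banach) simp
  then have "(\<lambda>p. (3 / (2 * c)) ^ 3 * (h (fst p) * h (snd p))) summable_on (UNIV - {(0, 0)})"
    by (rule summable_on_cmult_right)
  then have "(\<lambda>p. 1 / norm (lattice_pt p) ^ 3) summable_on (UNIV - {(0, 0)})"
  proof (rule summable_on_comparison_test)
    fix p :: "int \<times> int" assume p: "p \<in> UNIV - {(0, 0)}"
    obtain a b where ab: "p = (a, b)" by (cases p)
    define A where "A = real_of_int \<bar>a\<bar>"
    define B where "B = real_of_int \<bar>b\<bar>"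
    have "a \<noteq> 0 \<or> b \<noteq> 0" using p ab by auto
    then have "\<bar>a\<bar> + \<bar>b\<bar> \<ge> 1" by linarith
    then have AB: "A + B \<ge> 1" "A \<ge> 0" "B \<ge> 0" by (simp_all add: A_def B_def)
    have "(1 + A) * (1 + B) \<le> (3 / 2 * (A + B)) ^ 2"
    proof -
      have "(A + B) * 1 \<le> (A + B) * (A + B)" by (rule mult_left_mono) (use AB in auto)
      moreover have "1 * 1 \<le> (A + B) * (A + B)" by (rule mult_mono) (use AB in auto)
      moreover have "0 \<le> (A - B)\<^sup>2" by simp
      moreover have "0 \<le> A * B" using AB by simp
      ultimately show ?thesis by (simp add: power2_eq_square algebra_simps)
    qed
    then have "((1 + A) * (1 + B)) powr (3/2) \<le> ((3 / 2 * (A + B)) ^ 2) powr (3/2)"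
      using AB by (intro powr_mono2) auto
    also have "\<dots> = (3 / 2 * (A + B)) ^ 3"
    proof -
      define D where "D = 3 / 2 * (A + B)"
      have D: "0 \<le> D" using AB by (simp add: D_def)
      have "(D ^ 2) powr (3/2) = (D powr 2) powr (3/2)" using powr_numeral[OF D, of "Num.Bit0 Num.One"] by simp
      also have "\<dots> = D powr 3" by (simp only: powr_powr) simp
      also have "\<dots> = D ^ 3" using powr_numeral[OF D, of "Num.Bit1 Num.One"] by simp
      finally show ?thesis by (simp only: D_def)
    qed
    also have "\<dots> \<le> (3 / (2 * c) * norm (lattice_pt p)) ^ 3"
    proof (rule power_mono)
      have "c * (A + B) \<le> norm (lattice_pt p)" using c(2)[of p] by (simp add: ab A_def B_def)
      then show "3 / 2 * (A + B) \<le> 3 / (2 * c) * norm (lattice_pt p)" using c(1) by (simp add: field_simps)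
    qed (use AB in simp)
    finally have le: "((1 + A) * (1 + B)) powr (3/2) \<le> (3 / (2 * c)) ^ 3 * norm (lattice_pt p) ^ 3"
      by (simp only: power_mult_distrib)
    have "c * (A + B) \<le> norm (lattice_pt p)" using c(2)[of p] by (simp add: ab A_def B_def)
    moreover have "c * (A + B) > 0" using c(1) AB by simp
    ultimately have n: "norm (lattice_pt p) > 0" by linarith
    have "h a * h b = 1 / ((1 + A) * (1 + B)) powr (3/2)"
      using AB by (simp add: h_def A_def B_def powr_mult powr_minus_divide)
    moreover have "1 / n3 \<le> Q * (1 / P)" if "P \<le> Q * n3" "P > 0" "n3 > 0" for P Q n3 :: real
      using that by (simp add: field_simps)
    moreover have "((1 + A) * (1 + B)) powr (3/2) > 0" using AB by simp
    ultimately show "1 / norm (lattice_pt p) ^ 3 \<le> (3 / (2 * c)) ^ 3 * (h (fst p) * h (snd p))"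
      using le n by (simp only: ab fst_conv snd_conv zero_less_power)
  qed simp
  moreover have "periods - {0} = lattice_pt ` (UNIV - {(0, 0)})"
  proof -
    have "lattice_pt p = 0 \<longleftrightarrow> p = (0, 0)" for p using inj_eq[OF inj_lattice_pt, of p "(0, 0)"] lattice_pt_0 by simp
    then show ?thesis unfolding lattice_eq by auto
  qed
  ultimately show ?thesis
    by (simp add: summable_on_reindex[OF inj_on_subset[OF inj_lattice_pt]] o_def)
qed

abbreviation "efactor \<equiv> weierstrass_factor 2"

lemma wf_alt: "efactor (z / \<omega>) = (1 - z / \<omega>) * exp (z / \<omega> + (z / \<omega>)\<^sup>2 / 2)"
  by (simp add: weierstrass_factor_def numeral_2_eq_2)

text \<open>On a disc finitely many factors are kept as they are. All others are close to 1 and have logarithms dominated by a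
multiple of the summable \<open>1 / \<bar>\<omega>\<bar>\<^sup>3\<close>, so that the sum of the logarithms converges uniformly and is holomorphic.\<close>
lemma sigma_representation:
  assumes R: "R > 0"
  obtains B G where "finite B" "B \<subseteq> periods - {0}" "periods \<inter> cball 0 R \<subseteq> insert 0 B" "G holomorphic_on ball 0 R"
    "\<And>z. z \<in> cball 0 R \<Longrightarrow> wsigma z = z * (\<Prod>\<omega>\<in>B. efactor (z / \<omega>)) * exp (G z)"
    "\<And>z. z \<in> cball 0 R \<Longrightarrow> ((\<lambda>F. z * (\<Prod>\<omega>\<in>F. efactor (z / \<omega>))) \<longlongrightarrow> wsigma z) (finite_subsets_at_top (periods - {0}))"
proof -
  define L where "L = periods - {0}"
  define B where "B = {\<omega> \<in> L. norm \<omega> < 2 * R + 1}"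
  have B: "finite B" "B \<subseteq> L"
    by (rule finite_subset[OF _ finite_lattice_ball[of "2 * R + 1"]]) (auto simp: B_def L_def)
  define g where "g \<omega> z = (if \<omega> \<in> B then 0 else Ln (efactor (z / \<omega>)))" for \<omega> z
  define M where "M \<omega> = 6 * R ^ 3 * (1 / norm \<omega> ^ 3)" for \<omega> :: complex
  define G where "G z = (\<Sum>\<^sub>\<infinity>\<omega>\<in>L. g \<omega> z)" for z
  have far: "norm (efactor (z / \<omega>) - 1) \<le> 3 * (R / norm \<omega>) ^ 3" "norm (efactor (z / \<omega>) - 1) < 1 / 2"
    if "\<omega> \<in> L - B" "z \<in> cball 0 R" for \<omega> z
  proof -
    have \<omega>: "2 * R + 1 \<le> norm \<omega>" using that(1) by (auto simp: B_def)
    then have pos: "norm \<omega> > 0" using R by linarith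
    have le: "norm (z / \<omega>) \<le> R / norm \<omega>" using that(2) by (simp add: norm_divide divide_right_mono)
    also have "\<dots> \<le> 1 / 2" using \<omega> pos by (simp add: field_simps)
    finally have half: "norm (z / \<omega>) \<le> 1 / 2" .
    have b: "norm (efactor (z / \<omega>) - 1) \<le> 3 * norm (z / \<omega>) ^ 3"
      using weierstrass_factor_bound[OF half, of 2] by (simp add: numeral_3_eq_3 numeral_2_eq_2)
    also have "\<dots> \<le> 3 * (R / norm \<omega>) ^ 3" using le by (intro mult_left_mono power_mono) auto
    finally show "norm (efactor (z / \<omega>) - 1) \<le> 3 * (R / norm \<omega>) ^ 3" .
    have "3 * norm (z / \<omega>) ^ 3 \<le> 3 * (1 / 2) ^ 3" using half by (intro mult_left_mono power_mono) auto
    then show "norm (efactor (z / \<omega>) - 1) < 1 / 2" using b by (simp add: power3_eq_cube)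
  qed
  have bound: "norm (g \<omega> z) \<le> M \<omega>" if "\<omega> \<in> L" "z \<in> cball 0 R" for \<omega> z
  proof (cases "\<omega> \<in> B")
    case True
    then show ?thesis using R by (simp add: g_def M_def)
  next
    case False
    then have "norm (Ln (1 + (efactor (z / \<omega>) - 1))) \<le> 2 * norm (efactor (z / \<omega>) - 1)"
      using far that by (intro norm_Ln_le) auto
    also have "\<dots> \<le> 2 * (3 * (R / norm \<omega>) ^ 3)" using far(1)[of \<omega> z] False that by simp
    finally show ?thesis using False by (simp add: g_def M_def power_divide)
  qed
  have ulim: "uniform_limit (cball 0 R) (\<lambda>F z. \<Sum>\<omega>\<in>F. g \<omega> z) G (finite_subsets_at_top L)"
    unfolding G_def
  proof (rule Weierstrass_m_test_general)
    show "M summable_on L"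
      unfolding M_def L_def by (intro summable_on_cmult_right summable_lattice)
  qed (use bound in auto)
  have holo: "g \<omega> holomorphic_on cball 0 R" if "\<omega> \<in> L" for \<omega>
  proof (cases "\<omega> \<in> B")
    case False
    have nonpos: "efactor (z / \<omega>) \<notin> \<real>\<^sub>\<le>\<^sub>0" if z: "z \<in> cball 0 R" for z
    proof
      assume "efactor (z / \<omega>) \<in> \<real>\<^sub>\<le>\<^sub>0"
      then have "Re (efactor (z / \<omega>) - 1) \<le> - 1" by (simp add: complex_nonpos_Reals_iff)
      then have "norm (efactor (z / \<omega>) - 1) \<ge> 1" using abs_Re_le_cmod[of "efactor (z / \<omega>) - 1"] by linarith
      then show False using far(2)[of \<omega> z] False \<open>\<omega> \<in> L\<close> z by simp
    qed
    have "\<omega> \<noteq> 0" using \<open>\<omega> \<in> L\<close> by (simp add: L_def)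
    then have "(\<lambda>z. Ln (efactor (z / \<omega>))) holomorphic_on cball 0 R"
      using nonpos by (intro holomorphic_intros) auto
    then show ?thesis using False by (simp add: g_def[abs_def])
  qed (simp add: g_def[abs_def])
  have Gholo: "G holomorphic_on ball 0 R"
  proof (rule holomorphic_uniform_limit[OF _ ulim])
    show "\<forall>\<^sub>F F in finite_subsets_at_top L. continuous_on (cball 0 R) (\<lambda>z. \<Sum>\<omega>\<in>F. g \<omega> z) \<and>
        (\<lambda>z. \<Sum>\<omega>\<in>F. g \<omega> z) holomorphic_on ball 0 R"
    proof (rule eventually_finite_subsets_at_top_weakI)
      fix F assume F: "finite F" "F \<subseteq> L"
      have "(\<lambda>z. \<Sum>\<omega>\<in>F. g \<omega> z) holomorphic_on cball 0 R"
        using holo F by (intro holomorphic_on_sum) auto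
      then show "continuous_on (cball 0 R) (\<lambda>z. \<Sum>\<omega>\<in>F. g \<omega> z) \<and>
          (\<lambda>z. \<Sum>\<omega>\<in>F. g \<omega> z) holomorphic_on ball 0 R"
        using holomorphic_on_imp_continuous_on holomorphic_on_subset ball_subset_cball by blast
    qed
  qed simp_all
  have lim: "((\<lambda>F. \<Prod>\<omega>\<in>F. efactor (z / \<omega>)) \<longlongrightarrow> (\<Prod>\<omega>\<in>B. efactor (z / \<omega>)) * exp (G z)) (finite_subsets_at_top L)"
    if z: "z \<in> cball 0 R" for z
  proof -
    have "((\<lambda>F. (\<Prod>\<omega>\<in>B. efactor (z / \<omega>)) * exp (\<Sum>\<omega>\<in>F. g \<omega> z)) \<longlongrightarrow> (\<Prod>\<omega>\<in>B. efactor (z / \<omega>)) * exp (G z)) (finite_subsets_at_top L)"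
      by (intro tendsto_intros tendsto_uniform_limitI[OF ulim z])
    moreover have "\<forall>\<^sub>F F in finite_subsets_at_top L.
        (\<Prod>\<omega>\<in>B. efactor (z / \<omega>)) * exp (\<Sum>\<omega>\<in>F. g \<omega> z) = (\<Prod>\<omega>\<in>F. efactor (z / \<omega>))"
      unfolding eventually_finite_subsets_at_top
    proof (intro exI[of _ B] conjI B allI impI)
      fix F assume F: "finite F \<and> B \<subseteq> F \<and> F \<subseteq> L"
      have "(\<Sum>\<omega>\<in>F. g \<omega> z) = (\<Sum>\<omega>\<in>F - B. Ln (efactor (z / \<omega>)))"
        using F by (intro sum.mono_neutral_cong_right) (auto simp: g_def)
      then have "exp (\<Sum>\<omega>\<in>F. g \<omega> z) = (\<Prod>\<omega>\<in>F - B. exp (Ln (efactor (z / \<omega>))))"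
        using F by (simp add: exp_sum)
      also have "\<dots> = (\<Prod>\<omega>\<in>F - B. efactor (z / \<omega>))"
      proof (rule prod.cong[OF refl])
        fix \<omega> assume "\<omega> \<in> F - B"
        then have "norm (efactor (z / \<omega>) - 1) < 1 / 2" using far(2) F z by blast
        then have "efactor (z / \<omega>) \<noteq> 0" by force
        then show "exp (Ln (efactor (z / \<omega>))) = efactor (z / \<omega>)" by simp
      qed
      finally show "(\<Prod>\<omega>\<in>B. efactor (z / \<omega>)) * exp (\<Sum>\<omega>\<in>F. g \<omega> z) = (\<Prod>\<omega>\<in>F. efactor (z / \<omega>))"
        using F prod.subset_diff[of B F "\<lambda>\<omega>. efactor (z / \<omega>)"] by (simp add: mult.commute)
    qed
    ultimately show ?thesis by (rule Lim_transform_eventually)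
  qed
  have wsigma: "wsigma z = z * (\<Prod>\<omega>\<in>B. efactor (z / \<omega>)) * exp (G z)" if z: "z \<in> cball 0 R" for z
    unfolding weierstrass_sigma_def wf_alt[symmetric] L_def[symmetric]
    using tendsto_Lim[OF _ lim[OF z]] by simp
  have "((\<lambda>F. z * (\<Prod>\<omega>\<in>F. efactor (z / \<omega>))) \<longlongrightarrow> wsigma z) (finite_subsets_at_top L)" if z: "z \<in> cball 0 R" for z
    unfolding wsigma[OF z] mult.assoc by (intro tendsto_intros lim z)
  moreover have "periods \<inter> cball 0 R \<subseteq> insert 0 B"
    using R by (auto simp: B_def L_def)
  ultimately show ?thesis using that[of B G] B wsigma Gholo by (simp add: L_def)
qed

text \<open>Every factor of the product other than the one for \<open>\<omega>0\<close> is nonzero at \<open>\<omega>0\<close>.\<close>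
lemma sigma_factor:
  assumes "\<omega>0 \<in> periods"
  obtains r K where "r > 0" "K holomorphic_on ball \<omega>0 r" "\<And>z. z \<in> ball \<omega>0 r \<Longrightarrow> K z \<noteq> 0"
    "\<And>z. z \<in> ball \<omega>0 r \<Longrightarrow> wsigma z = (z - \<omega>0) * K z"
proof -
  define R where "R = norm \<omega>0 + 1"
  have R: "R > 0" by (simp add: R_def add_nonneg_pos)
  obtain B G where B: "finite B" "B \<subseteq> periods - {0}" "periods \<inter> cball 0 R \<subseteq> insert 0 B" "G holomorphic_on ball 0 R"
    "\<And>z. z \<in> cball 0 R \<Longrightarrow> wsigma z = z * (\<Prod>\<omega>\<in>B. efactor (z / \<omega>)) * exp (G z)"
    using sigma_representation[OF R] by metis
  define e where "e \<omega> z = (if \<omega> = 0 then 1 else - exp (\<Sum>k=1..2. (z / \<omega>) ^ k / of_nat k) / \<omega>)" for \<omega> z :: complex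
  define K where "K z = e \<omega>0 z * (\<Prod>\<omega>\<in>insert 0 B - {\<omega>0}. (z - \<omega>) * e \<omega> z) * exp (G z)" for z
  have prod: "wsigma z = (z - \<omega>0) * K z" if "z \<in> ball 0 R" for z
  proof -
    have e: "efactor (z / \<omega>) = (z - \<omega>) * e \<omega> z" if "\<omega> \<in> B" for \<omega>
      using that B(2) by (auto simp: e_def weierstrass_factor_def field_simps)
    have "z * (\<Prod>\<omega>\<in>B. efactor (z / \<omega>)) = (\<Prod>\<omega>\<in>insert 0 B. (z - \<omega>) * e \<omega> z)"
    proof -
      have "0 \<notin> B" using B(2) by auto
      then have "(\<Prod>\<omega>\<in>insert 0 B. (z - \<omega>) * e \<omega> z) = z * (\<Prod>\<omega>\<in>B. (z - \<omega>) * e \<omega> z)"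
        using B(1) by (simp add: e_def)
      then show ?thesis using e by simp
    qed
    also have "\<dots> = (z - \<omega>0) * e \<omega>0 z * (\<Prod>\<omega>\<in>insert 0 B - {\<omega>0}. (z - \<omega>) * e \<omega> z)"
    proof (rule prod.remove)
      show "\<omega>0 \<in> insert 0 B" using B(3) assms by (auto simp: R_def)
    qed (use B(1) in simp)
    finally show ?thesis using B(5)[of z] that by (simp add: K_def mult_ac)
  qed
  have eh: "e \<omega> holomorphic_on A" for \<omega> A
  proof (cases "\<omega> = 0")
    case False
    then have "(\<lambda>z. - exp (\<Sum>k=1..2. (z / \<omega>) ^ k / of_nat k) / \<omega>) holomorphic_on A"
      by (intro holomorphic_intros) auto
    then show ?thesis using False by (simp add: e_def[abs_def])
  qed (simp add: e_def[abs_def])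
  have Kh: "K holomorphic_on ball 0 R"
    unfolding K_def by (intro holomorphic_intros eh B(4))
  have "K \<omega>0 \<noteq> 0"
    using B(1) by (auto simp: K_def e_def)
  moreover have mem: "\<omega>0 \<in> ball 0 R" by (simp add: R_def)
  moreover have "continuous_on (ball 0 R) K" using Kh by (rule holomorphic_on_imp_continuous_on)
  ultimately have "\<exists>d>0. \<forall>z. dist \<omega>0 z < d \<longrightarrow> K z \<noteq> 0"
    using continuous_at_avoid[of \<omega>0 K 0] by (simp add: continuous_on_eq_continuous_at)
  then obtain d where d: "d > 0" "\<And>z. z \<in> ball \<omega>0 d \<Longrightarrow> K z \<noteq> 0" by (auto simp: ball_def)
  define r where "r = min d 1"
  have sub: "ball \<omega>0 r \<subseteq> ball 0 R"
  proof
    fix z assume "z \<in> ball \<omega>0 r"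
    then have "dist \<omega>0 z < 1" by (simp add: r_def)
    then show "z \<in> ball 0 R" using norm_triangle_sub[of z \<omega>0] by (simp add: R_def dist_norm norm_minus_commute)
  qed
  show ?thesis
  proof (rule that[of r K])
    show "r > 0" using d(1) by (simp add: r_def)
    show "K holomorphic_on ball \<omega>0 r" using Kh sub by (rule holomorphic_on_subset)
    show "K z \<noteq> 0" if "z \<in> ball \<omega>0 r" for z using d(2) that by (simp add: r_def)
    show "wsigma z = (z - \<omega>0) * K z" if "z \<in> ball \<omega>0 r" for z using prod sub that by blast
  qed
qed

lemma sigma_eq_0_iff: "wsigma z = 0 \<longleftrightarrow> z \<in> periods"
proof -
  have R: "norm z + 1 > 0" by (simp add: add_nonneg_pos)
  obtain B G where B: "finite B" "B \<subseteq> periods - {0}" "periods \<inter> cball 0 (norm z + 1) \<subseteq> insert 0 B"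
    "\<And>w. w \<in> cball 0 (norm z + 1) \<Longrightarrow> wsigma w = w * (\<Prod>\<omega>\<in>B. efactor (w / \<omega>)) * exp (G w)"
    using sigma_representation[OF R] by metis
  have "wsigma z = 0 \<longleftrightarrow> z = 0 \<or> (\<exists>\<omega>\<in>B. z / \<omega> = 1)"
    using B(4)[of z] B(1) by simp
  also have "\<dots> \<longleftrightarrow> z \<in> insert 0 B"
    using B(2) by auto
  also have "\<dots> \<longleftrightarrow> z \<in> periods"
    using B(2,3) lattice_0 by auto
  finally show ?thesis .
qed

lemma sigma_holomorphic: "wsigma holomorphic_on UNIV"
proof -
  have "wsigma field_differentiable at z" for z
  proof -
    have R: "norm z + 1 > 0" by (simp add: add_nonneg_pos)
    obtain B G where B: "finite B" "B \<subseteq> periods - {0}" "G holomorphic_on ball 0 (norm z + 1)"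
      "\<And>w. w \<in> cball 0 (norm z + 1) \<Longrightarrow> wsigma w = w * (\<Prod>\<omega>\<in>B. efactor (w / \<omega>)) * exp (G w)"
      using sigma_representation[OF R] by metis
    have "(\<lambda>w. w * (\<Prod>\<omega>\<in>B. efactor (w / \<omega>)) * exp (G w)) holomorphic_on ball 0 (norm z + 1)"
      using B(2) by (intro holomorphic_intros B(3)) auto
    then have "wsigma holomorphic_on ball 0 (norm z + 1)"
      by (rule holomorphic_transform) (use B(4) in auto)
    then show ?thesis
      by (rule holomorphic_on_imp_differentiable_at) auto
  qed
  then show ?thesis by (simp add: holomorphic_on_def field_differentiable_at_within)
qed

lemma sigma_tendsto:
  "((\<lambda>F. z * (\<Prod>\<omega>\<in>F. efactor (z / \<omega>))) \<longlongrightarrow> wsigma z) (finite_subsets_at_top (periods - {0}))"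
proof -
  have R: "norm z + 1 > 0" by (simp add: add_nonneg_pos)
  show ?thesis using sigma_representation[OF R] by (metis mem_cball_0 less_add_one less_imp_le)
qed

lemma deriv_sigma_lattice:
  assumes "\<omega> \<in> periods"
  shows "deriv wsigma \<omega> \<noteq> 0"
proof -
  obtain r K where K: "r > 0" "K holomorphic_on ball \<omega> r" "\<And>z. z \<in> ball \<omega> r \<Longrightarrow> K z \<noteq> 0"
    "\<And>z. z \<in> ball \<omega> r \<Longrightarrow> wsigma z = (z - \<omega>) * K z"
    using sigma_factor[OF assms] by metis
  have "(K has_field_derivative deriv K \<omega>) (at \<omega>)"
    using K(1,2) by (intro holomorphic_derivI[of _ "ball \<omega> r"]) auto
  then have "((\<lambda>z. (z - \<omega>) * K z) has_field_derivative K \<omega>) (at \<omega>)"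
    by (auto intro!: derivative_eq_intros)
  then have "(wsigma has_field_derivative K \<omega>) (at \<omega>)"
  proof (rule has_field_derivative_transform_within_open)
    show "\<omega> \<in> ball \<omega> r" using K(1) by simp
  qed (use K(4) in auto)
  then show ?thesis using K(1,3) by (simp add: DERIV_imp_deriv)
qed

section \<open>Periodicity of sigma quotients\<close>

text \<open>Products over boxes of periods exhaust the sigma function; unlike general finite sets they are symmetric and change in a
controlled way under a shift by a generator.\<close>
definition lattice_box :: "nat \<Rightarrow> complex set" where
  "lattice_box n = lattice_pt ` ({- int n..int n} \<times> {- int n..int n})"

definition box_sigma :: "nat \<Rightarrow> complex \<Rightarrow> complex" where
  "box_sigma n z = z * (\<Prod>\<omega>\<in>lattice_box n - {0}. efactor (z / \<omega>))"

lemma finite_box: "finite (lattice_box n)"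
  by (simp add: lattice_box_def)

lemma zero_in_box: "0 \<in> lattice_box n"
  unfolding lattice_box_def using lattice_pt_0 by (force simp: image_def)

lemma box_sigma_tendsto: "(\<lambda>n. box_sigma n z) \<longlonglongrightarrow> wsigma z"
proof -
  have "filterlim (\<lambda>n. lattice_box n - {0}) (finite_subsets_at_top (periods - {0})) sequentially"
    unfolding filterlim_finite_subsets_at_top
  proof (intro allI impI)
    fix X assume X: "finite X \<and> X \<subseteq> periods - {0}"
    have "\<forall>\<^sub>F n in sequentially. \<omega> \<in> lattice_box n" if \<omega>: "\<omega> \<in> X" for \<omega>
    proof -
      have "\<omega> \<in> range lattice_pt" using X \<omega> unfolding lattice_eq by blast
      then obtain a b where ab: "\<omega> = lattice_pt (a, b)" by auto
      have "\<forall>n\<ge>nat (max \<bar>a\<bar> \<bar>b\<bar>). \<omega> \<in> lattice_box n"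
        unfolding ab lattice_box_def by (auto intro!: imageI)
      then show ?thesis unfolding eventually_sequentially by blast
    qed
    then have "\<forall>\<^sub>F n in sequentially. \<forall>\<omega>\<in>X. \<omega> \<in> lattice_box n"
      using X by (intro eventually_ball_finite) auto
    then show "\<forall>\<^sub>F n in sequentially. finite (lattice_box n - {0}) \<and> X \<subseteq> lattice_box n - {0} \<and> lattice_box n - {0} \<subseteq> periods - {0}"
    proof eventually_elim
      case (elim n)
      have "lattice_box n \<subseteq> periods" unfolding lattice_box_def lattice_eq by blast
      then show ?case using elim X finite_box by blast
    qed
  qed
  then show ?thesis
    unfolding box_sigma_def by (rule filterlim_compose[OF sigma_tendsto])
qed

lemma box_sigma_odd: "box_sigma n (- z) = - box_sigma n z"
proof -
  have sym: "- \<omega> \<in> lattice_box n" if \<omega>: "\<omega> \<in> lattice_box n" for \<omega>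
  proof -
    obtain a b where ab: "\<omega> = lattice_pt (a, b)" "a \<in> {- int n..int n}" "b \<in> {- int n..int n}"
      using \<omega> unfolding lattice_box_def by blast
    have "- \<omega> = lattice_pt (- a, - b)" by (simp add: ab lattice_pt_def)
    moreover have "(- a, - b) \<in> {- int n..int n} \<times> {- int n..int n}" using ab by auto
    ultimately show ?thesis unfolding lattice_box_def by blast
  qed
  have "(\<Prod>\<omega>\<in>lattice_box n - {0}. efactor (- z / \<omega>)) = (\<Prod>\<omega>\<in>lattice_box n - {0}. efactor (z / \<omega>))"
    by (rule prod.reindex_bij_witness[of _ uminus uminus]) (auto simp: sym)
  then show ?thesis by (simp add: box_sigma_def)
qed

lemma sigma_odd: "wsigma (- z) = - wsigma z"
proof (rule LIMSEQ_unique)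
  show "(\<lambda>n. box_sigma n (- z)) \<longlonglongrightarrow> wsigma (- z)" by (rule box_sigma_tendsto)
  show "(\<lambda>n. box_sigma n (- z)) \<longlonglongrightarrow> - wsigma z"
    unfolding box_sigma_odd by (intro tendsto_intros box_sigma_tendsto)
qed

lemma box_sigma_factor:
  obtains C \<alpha> \<beta> where "C \<noteq> 0" "\<And>z. box_sigma n z = (\<Prod>\<omega>\<in>lattice_box n. z - \<omega>) * C * exp (\<alpha> * z + \<beta> * z\<^sup>2)"
proof -
  define C where "C = (\<Prod>\<omega>\<in>lattice_box n - {0}. - 1 / \<omega>)"
  define \<alpha> where "\<alpha> = (\<Sum>\<omega>\<in>lattice_box n - {0}. 1 / \<omega>)"
  define \<beta> where "\<beta> = (\<Sum>\<omega>\<in>lattice_box n - {0}. 1 / (2 * \<omega>\<^sup>2))"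
  have "C \<noteq> 0" using finite_box by (simp add: C_def)
  moreover have "box_sigma n z = (\<Prod>\<omega>\<in>lattice_box n. z - \<omega>) * C * exp (\<alpha> * z + \<beta> * z\<^sup>2)" for z
  proof -
    have "(\<Prod>\<omega>\<in>lattice_box n - {0}. efactor (z / \<omega>))
        = (\<Prod>\<omega>\<in>lattice_box n - {0}. (z - \<omega>) * (- 1 / \<omega>) * exp (1 / \<omega> * z + 1 / (2 * \<omega>\<^sup>2) * z\<^sup>2))"
    proof (rule prod.cong[OF refl])
      fix \<omega> assume "\<omega> \<in> lattice_box n - {0}"
      then have "\<omega> \<noteq> 0" by simp
      then have "1 - z / \<omega> = (z - \<omega>) * (- 1 / \<omega>)" "z / \<omega> + (z / \<omega>)\<^sup>2 / 2 = 1 / \<omega> * z + 1 / (2 * \<omega>\<^sup>2) * z\<^sup>2"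
        by (simp_all add: field_simps power2_eq_square)
      then show "efactor (z / \<omega>) = (z - \<omega>) * (- 1 / \<omega>) * exp (1 / \<omega> * z + 1 / (2 * \<omega>\<^sup>2) * z\<^sup>2)"
        unfolding wf_alt by (simp only:)
    qed
    also have "\<dots> = (\<Prod>\<omega>\<in>lattice_box n - {0}. z - \<omega>) * C * exp (\<alpha> * z + \<beta> * z\<^sup>2)"
      unfolding prod.distrib C_def[symmetric] exp_sum[OF finite_Diff[OF finite_box], symmetric]
        sum.distrib \<alpha>_def \<beta>_def sum_distrib_right ..
    moreover have "(\<Prod>\<omega>\<in>lattice_box n. z - \<omega>) = z * (\<Prod>\<omega>\<in>lattice_box n - {0}. z - \<omega>)"
      by (subst prod.remove[OF finite_box zero_in_box]) simp
    ultimately show ?thesis by (simp only: box_sigma_def mult.assoc)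
  qed
  ultimately show ?thesis by (rule that)
qed

definition ratio :: "complex \<Rightarrow> complex \<Rightarrow> complex \<Rightarrow> complex" where
  "ratio y w t = (t\<^sup>2 - y\<^sup>2) / (t\<^sup>2 - w\<^sup>2)"

definition edge :: "complex \<Rightarrow> complex \<Rightarrow> complex \<Rightarrow> nat \<Rightarrow> int \<Rightarrow> complex" where
  "edge y w x n a = (\<Prod>b\<in>{- int n..int n}. ratio y w (x - lattice_pt (a, b)))"

text \<open>The exponential factors of the product contribute an exponential of a quadratic polynomial, and its values at \<open>x + y\<close> and \<open>x - y\<close> add up
to those at \<open>x + w\<close> and \<open>x - w\<close> up to a constant. Hence, up to a factor constant in \<open>x\<close>, the quotient is a rational function.\<close>
lemma box_sigma_quotient:
  obtains E where "\<And>x. box_sigma n (x + y) * box_sigma n (x - y) / (box_sigma n (x + w) * box_sigma n (x - w))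
    = E * (\<Prod>a\<in>{- int n..int n}. edge y w x n a)"
proof -
  obtain C \<alpha> \<beta> where C: "C \<noteq> 0" "\<And>z. box_sigma n z = (\<Prod>\<omega>\<in>lattice_box n. z - \<omega>) * C * exp (\<alpha> * z + \<beta> * z\<^sup>2)"
    using box_sigma_factor by metis
  have pair: "box_sigma n (x + v) * box_sigma n (x - v) = (\<Prod>\<omega>\<in>lattice_box n. (x - \<omega>)\<^sup>2 - v\<^sup>2) * C\<^sup>2
      * (exp (2 * \<alpha> * x + 2 * \<beta> * x\<^sup>2) * exp (2 * \<beta> * v\<^sup>2))" for x v
  proof -
    have "(\<Prod>\<omega>\<in>lattice_box n. (x - \<omega>)\<^sup>2 - v\<^sup>2) = (\<Prod>\<omega>\<in>lattice_box n. x + v - \<omega>) * (\<Prod>\<omega>\<in>lattice_box n. x - v - \<omega>)"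
      unfolding prod.distrib[symmetric] by (simp add: power2_eq_square algebra_simps)
    moreover have "exp (2 * \<alpha> * x + 2 * \<beta> * x\<^sup>2) * exp (2 * \<beta> * v\<^sup>2)
        = exp (\<alpha> * (x + v) + \<beta> * (x + v)\<^sup>2) * exp (\<alpha> * (x - v) + \<beta> * (x - v)\<^sup>2)"
      unfolding exp_add[symmetric] by (simp add: power2_eq_square algebra_simps)
    ultimately show ?thesis unfolding C(2) by (simp add: power2_eq_square mult_ac)
  qed
  have "box_sigma n (x + y) * box_sigma n (x - y) / (box_sigma n (x + w) * box_sigma n (x - w))
    = exp (2 * \<beta> * y\<^sup>2) / exp (2 * \<beta> * w\<^sup>2) * (\<Prod>a\<in>{- int n..int n}. edge y w x n a)" for x
  proof -
    have "(\<Prod>a\<in>{- int n..int n}. edge y w x n a)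
        = (\<Prod>p\<in>{- int n..int n} \<times> {- int n..int n}. ratio y w (x - lattice_pt p))"
      unfolding edge_def by (simp add: prod.cartesian_product split_beta)
    also have "\<dots> = (\<Prod>\<omega>\<in>lattice_box n. ratio y w (x - \<omega>))"
      unfolding lattice_box_def by (subst prod.reindex) (auto intro: inj_on_subset[OF inj_lattice_pt])
    also have "\<dots> = (\<Prod>\<omega>\<in>lattice_box n. (x - \<omega>)\<^sup>2 - y\<^sup>2) / (\<Prod>\<omega>\<in>lattice_box n. (x - \<omega>)\<^sup>2 - w\<^sup>2)"
      unfolding ratio_def by (rule prod_dividef)
    finally show ?thesis
      unfolding pair using C(1) by (simp add: ac_simps)
  qed
  then show ?thesis by (rule that)
qed

lemma prod_shift_int:
  fixes f :: "int \<Rightarrow> complex"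
  shows "(\<Prod>a\<in>{- int n..int n}. f (a - 1)) * f (int n) = (\<Prod>a\<in>{- int n..int n}. f a) * f (- int n - 1)"
proof -
  have "(\<Prod>a\<in>{- int n..int n}. f (a - 1)) = (\<Prod>a\<in>{- int n - 1..int n - 1}. f a)"
    by (rule prod.reindex_bij_witness[of _ "\<lambda>a. a + 1" "\<lambda>a. a - 1"]) auto
  moreover have "{- int n - 1..int n} = insert (int n) {- int n - 1..int n - 1}" by auto
  then have "(\<Prod>a\<in>{- int n - 1..int n}. f a) = f (int n) * (\<Prod>a\<in>{- int n - 1..int n - 1}. f a)"
    by simp
  moreover have "{- int n - 1..int n} = insert (- int n - 1) {- int n..int n}" by auto
  then have "(\<Prod>a\<in>{- int n - 1..int n}. f a) = f (- int n - 1) * (\<Prod>a\<in>{- int n..int n}. f a)"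
    by simp
  ultimately show ?thesis by (simp add: mult.commute)
qed

lemma edge_shift: "edge y w (x + \<omega>1) n a = edge y w x n (a - 1)"
proof -
  have e: "x + \<omega>1 - lattice_pt (a, b) = x - lattice_pt (a - 1, b)" for b by (simp add: lattice_pt_def algebra_simps)
  show ?thesis unfolding edge_def e ..
qed

lemma norm_prod_minus_1_le:
  fixes f :: "'b \<Rightarrow> complex"
  assumes "finite S"
  shows "norm ((\<Prod>i\<in>S. f i) - 1) \<le> exp (\<Sum>i\<in>S. norm (f i - 1)) - 1"
  using assms
proof (induction S rule: finite_induct)
  case (insert i S)
  define P where "P = (\<Prod>i\<in>S. f i)"
  define E where "E = exp (\<Sum>i\<in>S. norm (f i - 1))"
  have "f i * P - 1 = f i * (P - 1) + (f i - 1)" by (simp add: algebra_simps)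
  then have "norm (f i * P - 1) \<le> norm (f i) * norm (P - 1) + norm (f i - 1)"
    by (metis norm_mult norm_triangle_ineq)
  also have "\<dots> \<le> (1 + norm (f i - 1)) * (E - 1) + norm (f i - 1)"
    using insert.IH norm_triangle_sub[of "f i" 1] by (intro add_right_mono mult_mono) (auto simp: P_def E_def)
  also have "\<dots> = (1 + norm (f i - 1)) * E - 1" by (simp add: algebra_simps)
  also have "\<dots> \<le> exp (norm (f i - 1)) * E - 1"
    using exp_ge_add_one_self[of "norm (f i - 1)"] by (intro diff_right_mono mult_right_mono) (auto simp: E_def)
  finally show ?case using insert.hyps by (simp add: P_def E_def exp_add)
qed simp

text \<open>An edge consists of \<open>2 n + 1\<close> points at distance at least a multiple of \<open>n\<close> from \<open>x\<close> once \<open>n\<close> is large, and there \<open>ratio\<close> differs from 1 by a multiple of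
\<open>1 / n\<^sup>2\<close>.\<close>
lemma edge_tendsto:
  assumes g: "\<And>n. real n \<le> real_of_int \<bar>g n\<bar>"
  shows "(\<lambda>n. edge y w x n (g n)) \<longlonglongrightarrow> 1"
proof -
  obtain c where c: "c > 0" "\<And>p. c * (real_of_int \<bar>fst p\<bar> + real_of_int \<bar>snd p\<bar>) \<le> norm (lattice_pt p)"
    by (rule norm_lattice_pt_bound) blast
  define K where "K = 8 * norm (w\<^sup>2 - y\<^sup>2) / c\<^sup>2"
  have K: "K \<ge> 0" by (simp add: K_def)
  have "\<forall>\<^sub>F n in sequentially. real n \<ge> max 1 (max (2 * norm x / c) (4 * norm w / c))"
    by (rule eventually_ge_at_top[THEN eventually_compose_filterlim, OF filterlim_real_sequentially])
  then have "\<forall>\<^sub>F n in sequentially. norm (edge y w x n (g n) - 1) \<le> exp ((2 * real n + 1) / (real n)\<^sup>2 * K) - 1"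
  proof eventually_elim
    case (elim n)
    then have n: "real n \<ge> 1" "c * real n \<ge> 2 * norm x" "c * real n \<ge> 4 * norm w"
      using c(1) by (simp_all add: field_simps)
    have r: "norm (ratio y w (x - lattice_pt (g n, b)) - 1) \<le> K / (real n)\<^sup>2" for b
    proof -
      define t where "t = x - lattice_pt (g n, b)"
      have "c * real n \<le> c * (real_of_int \<bar>g n\<bar> + real_of_int \<bar>b\<bar>)"
        using g[of n] c(1) by (intro mult_left_mono) auto
      also have "\<dots> \<le> norm (lattice_pt (g n, b))" using c(2)[of "(g n, b)"] by simp
      also have "\<dots> \<le> norm t + norm x"
        using norm_triangle_ineq4[of x t] by (simp add: t_def)
      finally have t: "c * real n / 2 \<le> norm t" using n by linarith
      have "(c * real n)\<^sup>2 / 8 \<le> (c * real n / 2)\<^sup>2 - (c * real n / 4)\<^sup>2"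
        using zero_le_power2[of "c * real n"] by (simp add: power_divide)
      also have "\<dots> \<le> (norm t)\<^sup>2 - (norm w)\<^sup>2"
        using t n c(1) by (intro diff_mono power_mono) auto
      also have "\<dots> \<le> norm (t\<^sup>2 - w\<^sup>2)"
        using norm_triangle_ineq2[of "t\<^sup>2" "w\<^sup>2"] by (simp add: norm_power)
      finally have d: "(c * real n)\<^sup>2 / 8 \<le> norm (t\<^sup>2 - w\<^sup>2)" .
      have pos: "(c * real n)\<^sup>2 / 8 > 0" using n c(1) by simp
      then have "t\<^sup>2 - w\<^sup>2 \<noteq> 0" using d by auto
      then have "ratio y w t - 1 = (w\<^sup>2 - y\<^sup>2) / (t\<^sup>2 - w\<^sup>2)" by (simp add: ratio_def field_simps)
      then have "norm (ratio y w t - 1) = norm (w\<^sup>2 - y\<^sup>2) / norm (t\<^sup>2 - w\<^sup>2)" by (simp add: norm_divide)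
      also have "\<dots> \<le> norm (w\<^sup>2 - y\<^sup>2) / ((c * real n)\<^sup>2 / 8)"
        using d pos by (intro divide_left_mono mult_pos_pos) auto
      also have "\<dots> = K / (real n)\<^sup>2" by (simp add: K_def power_mult_distrib)
      finally show ?thesis by (simp add: t_def)
    qed
    have "norm (edge y w x n (g n) - 1)
        \<le> exp (\<Sum>b\<in>{- int n..int n}. norm (ratio y w (x - lattice_pt (g n, b)) - 1)) - 1"
      unfolding edge_def by (rule norm_prod_minus_1_le) simp
    also have "\<dots> \<le> exp (\<Sum>b\<in>{- int n..int n}. K / (real n)\<^sup>2) - 1"
      using r by (intro diff_right_mono) (simp add: sum_mono del: sum_constant)
    also have "\<dots> = exp ((2 * real n + 1) / (real n)\<^sup>2 * K) - 1"
    proof -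
      have "nat (1 + 2 * int n) = 2 * n + 1" by simp
      then show ?thesis by (simp add: algebra_simps)
    qed
    finally show ?case .
  qed
  moreover have "(\<lambda>n. exp ((2 * real n + 1) / (real n)\<^sup>2 * K) - 1) \<longlonglongrightarrow> 0"
  proof -
    have "(\<lambda>n. (2 * real n + 1) / (real n)\<^sup>2) \<longlonglongrightarrow> 0" by real_asymp
    then have "(\<lambda>n. exp ((2 * real n + 1) / (real n)\<^sup>2 * K) - 1) \<longlonglongrightarrow> exp (0 * K) - 1"
      by (intro tendsto_intros)
    then show ?thesis by simp
  qed
  ultimately have "(\<lambda>n. edge y w x n (g n) - 1) \<longlonglongrightarrow> 0"
    by (rule Lim_null_comparison)
  then show ?thesis by (rule LIM_zero_cancel)
qed

definition quot :: "complex \<Rightarrow> complex \<Rightarrow> complex \<Rightarrow> complex" where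
  "quot y w x = wsigma (x + y) * wsigma (x - y) / (wsigma (x + w) * wsigma (x - w))"

lemma lattice_pt_1_0: "\<omega>1 \<in> periods"
  unfolding lattice_eq by (rule range_eqI[of _ _ "(1, 0)"]) (simp add: lattice_pt_def)

text \<open>Shifting by \<open>\<omega>1\<close> replaces one edge of the box by another one.\<close>
lemma quot_add_\<omega>1:
  assumes "x + w \<notin> periods" "x - w \<notin> periods"
  shows "quot y w (x + \<omega>1) = quot y w x"
proof -
  define q where "q n x = box_sigma n (x + y) * box_sigma n (x - y) / (box_sigma n (x + w) * box_sigma n (x - w))" for n x
  have q: "q n (x + \<omega>1) * edge y w x n (int n) = q n x * edge y w x n (- int n - 1)" for n
  proof -
    obtain E where E: "\<And>x. q n x = E * (\<Prod>a\<in>{- int n..int n}. edge y w x n a)"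
      using box_sigma_quotient unfolding q_def by metis
    show ?thesis
      unfolding E edge_shift using prod_shift_int[of "edge y w x n" n] by (simp add: mult.assoc)
  qed
  have lim: "(\<lambda>n. q n x) \<longlonglongrightarrow> quot y w x" if "x + w \<notin> periods" "x - w \<notin> periods" for x
    unfolding q_def quot_def using that by (intro tendsto_intros box_sigma_tendsto) (simp add: sigma_eq_0_iff)
  have off: "x + \<omega>1 + w \<notin> periods" "x + \<omega>1 - w \<notin> periods"
    using assms lattice_diff[OF _ lattice_pt_1_0] by (force simp: algebra_simps)+
  have "(\<lambda>n. q n (x + \<omega>1) * edge y w x n (int n)) \<longlonglongrightarrow> quot y w (x + \<omega>1) * 1"
    by (intro tendsto_mult lim off edge_tendsto) simp
  moreover have "(\<lambda>n. q n x * edge y w x n (- int n - 1)) \<longlonglongrightarrow> quot y w x * 1"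
    by (intro tendsto_mult lim assms edge_tendsto) simp
  ultimately show ?thesis
    unfolding q using LIMSEQ_unique by fastforce
qed

lemma period_lattice_swap: "period_lattice \<omega>2 \<omega>1 = periods"
  unfolding period_lattice_def by (metis add.commute)

lemma weierstrass_sigma_swap: "weierstrass_sigma \<omega>2 \<omega>1 = wsigma"
  by (rule ext) (simp add: weierstrass_sigma_def period_lattice_swap)

lemma quot_add_\<omega>2:
  assumes "x + w \<notin> periods" "x - w \<notin> periods"
  shows "quot y w (x + \<omega>2) = quot y w x"
proof -
  interpret swap: period_pair \<omega>2 \<omega>1
  proof
    show "\<omega>2 / \<omega>1 \<notin> \<real>"
      using independent Reals_inverse[of "\<omega>2 / \<omega>1"] by auto
  qed
  show ?thesis
    using swap.quot_add_\<omega>1[of x w y] assms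
    unfolding swap.quot_def quot_def period_lattice_swap weierstrass_sigma_swap by simp
qed

lemma quot_periodic:
  assumes x: "x + w \<notin> periods" "x - w \<notin> periods" and \<omega>: "\<omega> \<in> periods"
  shows "quot y w (x + \<omega>) = quot y w x"
proof -
  have off: "v + p + w \<notin> periods" "v + p - w \<notin> periods"
    if "v + w \<notin> periods" "v - w \<notin> periods" "p \<in> periods" for v p
    using that lattice_diff[of "v + p + w" p] lattice_diff[of "v + p - w" p] by (auto simp: algebra_simps)
  have multiple: "quot y w (v + of_int a * p) = quot y w v"
    if p: "p \<in> periods" and step: "\<And>v. v + w \<notin> periods \<Longrightarrow> v - w \<notin> periods \<Longrightarrow> quot y w (v + p) = quot y w v"
      and mult: "\<And>a. of_int a * p \<in> periods"
      and v: "v + w \<notin> periods" "v - w \<notin> periods" for p v a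
  proof (induction a rule: int_induct[of _ 0])
    case base
    then show ?case by simp
  next
    case (step1 i)
    have "quot y w (v + of_int i * p + p) = quot y w (v + of_int i * p)"
      by (intro step off v mult)
    then show ?case using step1 by (simp add: algebra_simps)
  next
    case (step2 i)
    have "quot y w (v + of_int (i - 1) * p + p) = quot y w (v + of_int (i - 1) * p)"
      by (intro step off v mult)
    then show ?case using step2 by (simp add: algebra_simps)
  qed
  obtain a b where ab: "\<omega> = lattice_pt (a, b)" using \<omega> unfolding lattice_eq by auto
  have m1: "of_int a * \<omega>1 \<in> periods" for a
    unfolding lattice_eq by (rule range_eqI[of _ _ "(a, 0)"]) (simp add: lattice_pt_def)
  have m2: "of_int a * \<omega>2 \<in> periods" for a
    unfolding lattice_eq by (rule range_eqI[of _ _ "(0, a)"]) (simp add: lattice_pt_def)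
  have "quot y w (x + of_int a * \<omega>1 + of_int b * \<omega>2) = quot y w (x + of_int a * \<omega>1)"
    using m2[of 1] by (intro multiple quot_add_\<omega>2 m2 off x m1) simp_all
  also have "\<dots> = quot y w x"
    using m1[of 1] by (intro multiple quot_add_\<omega>1 m1 x) simp_all
  finally show ?thesis by (simp add: ab lattice_pt_def add.assoc)
qed

section \<open>The three-term relation for sigma\<close>

lemma DERIV_sigma: "(wsigma has_field_derivative deriv wsigma z) (at z)"
  using sigma_holomorphic by (intro holomorphic_derivI[of _ UNIV]) auto

lemma isCont_sigma: "isCont wsigma z"
  using DERIV_sigma by (rule DERIV_isCont)

lemma isCont_sigma_compose: "isCont f a \<Longrightarrow> isCont (\<lambda>t. wsigma (f t)) a"
  by (rule isCont_o2[OF _ isCont_sigma])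

lemma sigma_holomorphic_compose: "f holomorphic_on A \<Longrightarrow> (\<lambda>t. wsigma (f t)) holomorphic_on A"
  using holomorphic_on_compose_gen[of f A wsigma UNIV] sigma_holomorphic by (simp add: o_def)

lemma period_representative:
  obtains \<omega> where "\<omega> \<in> periods" "\<exists>a\<in>{0..1}. \<exists>b\<in>{0..1}. z - \<omega> = of_real a * \<omega>1 + of_real b * \<omega>2"
proof -
  have \<omega>2: "\<omega>2 \<noteq> 0" using independent by auto
  have im: "Im (\<omega>1 / \<omega>2) \<noteq> 0" using independent by (simp add: complex_is_Real_iff)
  define a where "a = Im (z / \<omega>2) / Im (\<omega>1 / \<omega>2)"
  define b where "b = Re (z / \<omega>2) - a * Re (\<omega>1 / \<omega>2)"
  have "\<zeta> = of_real (Im \<zeta> / Im \<tau>) * \<tau> + of_real (Re \<zeta> - Im \<zeta> / Im \<tau> * Re \<tau>)"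
    if "Im \<tau> \<noteq> 0" for \<zeta> \<tau>
    using that by (intro complex_eqI) simp_all
  from this[OF im, of "z / \<omega>2"] have "z / \<omega>2 = of_real a * (\<omega>1 / \<omega>2) + of_real b"
    by (simp only: a_def b_def)
  then have z: "z = of_real a * \<omega>1 + of_real b * \<omega>2" using \<omega>2 by (simp add: field_simps)
  show ?thesis
  proof (rule that)
    show "lattice_pt (\<lfloor>a\<rfloor>, \<lfloor>b\<rfloor>) \<in> periods" unfolding lattice_eq by blast
    have "z - lattice_pt (\<lfloor>a\<rfloor>, \<lfloor>b\<rfloor>) = of_real (frac a) * \<omega>1 + of_real (frac b) * \<omega>2"
      by (simp add: z lattice_pt_def frac_def algebra_simps)
    moreover have "frac a \<in> {0..1}" "frac b \<in> {0..1}"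
      by (simp_all add: frac_lt_1 less_imp_le)
    ultimately show "\<exists>a'\<in>{0..1}. \<exists>b'\<in>{0..1}. z - lattice_pt (\<lfloor>a\<rfloor>, \<lfloor>b\<rfloor>) = of_real a' * \<omega>1 + of_real b' * \<omega>2"
      by blast
  qed
qed

lemma bounded_periodic:
  assumes cont: "continuous_on UNIV F" and per: "\<And>z \<omega>. \<omega> \<in> periods \<Longrightarrow> F (z + \<omega>) = F z"
  shows "bounded (range (F :: complex \<Rightarrow> complex))"
proof -
  define P where "P = (\<lambda>(a, b). of_real a * \<omega>1 + of_real b * \<omega>2) ` ({0..1} \<times> {0..1 :: real})"
  have "compact P"
    unfolding P_def case_prod_unfold
    by (intro compact_continuous_image continuous_intros compact_Times compact_Icc)
  then have "compact (F ` P)"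
    using cont by (intro compact_continuous_image) (rule continuous_on_subset, auto)
  moreover have "range F \<subseteq> F ` P"
  proof
    fix v assume "v \<in> range F"
    then obtain z where z: "v = F z" by blast
    obtain \<omega> where \<omega>: "\<omega> \<in> periods" "\<exists>a\<in>{0..1}. \<exists>b\<in>{0..1}. z - \<omega> = of_real a * \<omega>1 + of_real b * \<omega>2"
      by (rule period_representative)
    then have "z - \<omega> \<in> P" unfolding P_def by force
    moreover have "F (z - \<omega>) = F z" using per[OF \<omega>(1), of "z - \<omega>"] by simp
    ultimately show "v \<in> F ` P" unfolding z by (metis imageI)
  qed
  ultimately show ?thesis using compact_imp_bounded bounded_subset by blast
qed

text \<open>The left side vanishes at every zero of \<open>[x + w] [x - w]\<close>, and these zeros are simple since \<open>2 w\<close> is not a period. So the quotient of the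
two extends to an entire function; it is periodic, hence bounded, hence constant, and its value is found at \<open>x = z\<close>.\<close>
lemma three_term_generic:
  assumes w: "2 * w \<notin> periods" and zw: "z + w \<notin> periods" "z - w \<notin> periods"
  shows "wsigma (x + y) * wsigma (x - y) * (wsigma (z + w) * wsigma (z - w))
    + wsigma (z + x) * wsigma (z - x) * (wsigma (y + w) * wsigma (y - w))
    = wsigma (z + y) * wsigma (z - y) * (wsigma (x + w) * wsigma (x - w))"
proof -
  define N where "N x = wsigma (x + y) * wsigma (x - y) * (wsigma (z + w) * wsigma (z - w))
    + wsigma (z + x) * wsigma (z - x) * (wsigma (y + w) * wsigma (y - w))" for x
  define D where "D x = wsigma (x + w) * wsigma (x - w)" for x
  have D0: "D x = 0 \<longleftrightarrow> x + w \<in> periods \<or> x - w \<in> periods" for x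
    by (simp add: D_def sigma_eq_0_iff)
  have Dper: "D (x + \<omega>) = 0 \<longleftrightarrow> D x = 0" if "\<omega> \<in> periods" for x \<omega>
    unfolding D0 using lattice_add[OF _ that] lattice_diff[OF _ that]
    by (metis add.commute add.left_commute add_diff_eq add_diff_cancel_left' diff_add_eq)
  have Nh: "N holomorphic_on A" and Dh: "D holomorphic_on A" for A
    unfolding N_def D_def by (intro holomorphic_intros sigma_holomorphic_compose)+
  have DN: "(N has_field_derivative deriv N v) (at v)" and DD: "(D has_field_derivative deriv D v) (at v)" for v
    using Nh[of UNIV] Dh[of UNIV] by (auto intro: holomorphic_derivI)
  have ND_per: "N (x + \<omega>) / D (x + \<omega>) = N x / D x" if "\<omega> \<in> periods" "D x \<noteq> 0" for x \<omega>
  proof -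
    have "N x / D x = wsigma (z + w) * wsigma (z - w) * quot y w x - wsigma (y + w) * wsigma (y - w) * quot z w x" for x
    proof -
      have "wsigma (z - x) = - wsigma (x - z)" using sigma_odd[of "x - z"] by simp
      then have "N x = wsigma (z + w) * wsigma (z - w) * (wsigma (x + y) * wsigma (x - y))
          - wsigma (y + w) * wsigma (y - w) * (wsigma (x + z) * wsigma (x - z))"
        by (simp add: N_def ac_simps)
      then show ?thesis by (simp add: D_def quot_def diff_divide_distrib)
    qed
    then show ?thesis using quot_periodic that D0 by simp
  qed
  have countable_D: "countable {x. D x = 0}"
  proof -
    have "{x. D x = 0} \<subseteq> (\<lambda>\<omega>. \<omega> - w) ` periods \<union> (\<lambda>\<omega>. \<omega> + w) ` periods"
      unfolding D0 by force
    then show ?thesis using countable_lattice by (meson countable_Un countable_image countable_subset)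
  qed
  have contN: "isCont N v" and contD: "isCont D v" for v
    using DN DD DERIV_isCont by blast+
  \<comment> \<open>Clearing denominators turns periodicity into an identity without exceptions.\<close>
  have cross: "N (x + \<omega>) * D x = N x * D (x + \<omega>)" if "\<omega> \<in> periods" for x \<omega>
  proof (rule cont_eq_off_countable[where a = x and f = "\<lambda>x. N (x + \<omega>) * D x" and g = "\<lambda>x. N x * D (x + \<omega>)", OF countable_D])
    show "isCont (\<lambda>x. N (x + \<omega>) * D x) x" "isCont (\<lambda>x. N x * D (x + \<omega>)) x"
      by (intro continuous_intros isCont_o2[OF _ contN] isCont_o2[OF _ contD] contN contD)+
    fix t assume "t \<notin> {x. D x = 0}"
    then have "D t \<noteq> 0" "D (t + \<omega>) \<noteq> 0" using Dper[OF that] by auto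
    then show "N (t + \<omega>) * D t = N t * D (t + \<omega>)" using ND_per[OF that, of t] by (simp add: field_simps)
  qed
  have D': "deriv D v = deriv wsigma (v + w) * wsigma (v - w) + wsigma (v + w) * deriv wsigma (v - w)" for v
  proof -
    have "((\<lambda>x. wsigma (x + w)) has_field_derivative deriv wsigma (v + w) * 1) (at v)"
      by (rule DERIV_chain2[OF DERIV_sigma]) (auto intro!: derivative_eq_intros)
    moreover have "((\<lambda>x. wsigma (x - w)) has_field_derivative deriv wsigma (v - w) * 1) (at v)"
      by (rule DERIV_chain2[OF DERIV_sigma]) (auto intro!: derivative_eq_intros)
    ultimately have "(D has_field_derivative deriv wsigma (v + w) * 1 * wsigma (v - w) + deriv wsigma (v - w) * 1 * wsigma (v + w)) (at v)"
      unfolding D_def by (rule DERIV_mult)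
    then show ?thesis by (simp add: DERIV_imp_deriv mult.commute)
  qed
  have diff: "v + w - (v - w) = 2 * w" for v by simp
  have D'_nz: "deriv D v \<noteq> 0" if v: "D v = 0" for v
  proof -
    consider "v + w \<in> periods" | "v - w \<in> periods" using v D0[of v] by blast
    then show ?thesis
    proof cases
      case 1
      then have "v - w \<notin> periods" using lattice_diff[of "v + w" "v - w", unfolded diff] w by blast
      then show ?thesis using 1 deriv_sigma_lattice[OF 1] sigma_eq_0_iff[of "v + w"] sigma_eq_0_iff[of "v - w"] by (simp add: D')
    next
      case 2
      then have "v + w \<notin> periods" using lattice_diff[of "v + w" "v - w", unfolded diff] w by blast
      then show ?thesis using 2 deriv_sigma_lattice[OF 2] sigma_eq_0_iff[of "v + w"] sigma_eq_0_iff[of "v - w"] by (simp add: D')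
    qed
  qed
  have Nw: "N w = 0" "N (- w) = 0"
  proof -
    have e: "w - y = - (y - w)" "- w - y = - (y + w)" "- w + y = y - w" by simp_all
    have "wsigma (w - y) = - wsigma (y - w)" "wsigma (- w - y) = - wsigma (y + w)" "wsigma (- w + y) = wsigma (y - w)"
      unfolding e sigma_odd by simp_all
    then show "N w = 0" "N (- w) = 0" by (simp_all add: N_def add.commute)
  qed
  have N0: "N v = 0" if v: "D v = 0" for v
  proof -
    obtain u \<omega> where u: "v = u + \<omega>" "\<omega> \<in> periods" "N u = 0" "D u = 0"
    proof -
      consider "v + w \<in> periods" | "v - w \<in> periods" using v D0[of v] by blast
      then show ?thesis
      proof cases
        case 1
        then show ?thesis using that[of "- w" "v + w"] Nw D0 lattice_0 by simp
      next
        case 2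
        then show ?thesis using that[of w "v - w"] Nw D0 lattice_0 by simp
      qed
    qed
    have shift: "((\<lambda>x. f (x + \<omega>)) has_field_derivative f' (u + \<omega>)) (at u)"
      if "\<And>v. (f has_field_derivative f' v) (at v)" for f f' :: "complex \<Rightarrow> complex"
      using that[of "u + \<omega>"] by (simp add: DERIV_shift)
    \<comment> \<open>Differentiating the identity at a zero \<open>u\<close> common to \<open>N\<close> and \<open>D\<close> shows that \<open>N\<close> vanishes at \<open>u + \<omega>\<close>.\<close>
    have "((\<lambda>x. N (x + \<omega>) * D x) has_field_derivative deriv N (u + \<omega>) * D u + deriv D u * N (u + \<omega>)) (at u)"
      by (rule DERIV_mult[OF shift[OF DN] DD])
    moreover have "((\<lambda>x. N x * D (x + \<omega>)) has_field_derivative deriv N u * D (u + \<omega>) + deriv D (u + \<omega>) * N u) (at u)"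
      by (rule DERIV_mult[OF DN shift[OF DD]])
    ultimately have "deriv N (u + \<omega>) * D u + deriv D u * N (u + \<omega>) = deriv N u * D (u + \<omega>) + deriv D (u + \<omega>) * N u"
      unfolding cross[OF u(2)] by (rule DERIV_unique)
    then show ?thesis using u v D'_nz[of u] by simp
  qed
  \<comment> \<open>The value at a zero of \<open>D\<close> is the limit given by the quotient of derivatives.\<close>
  define F where "F v = (if D v = 0 then deriv N v / deriv D v else N v / D v)" for v
  have Fh: "F holomorphic_on ball 0 R" for R
  proof (rule no_isolated_singularity')
    define Z where "Z = {v \<in> ball 0 R. D v = 0}"
    have "Z \<subseteq> (\<lambda>\<omega>. \<omega> - w) ` {\<omega> \<in> periods. norm \<omega> < R + norm w} \<union> (\<lambda>\<omega>. \<omega> + w) ` {\<omega> \<in> periods. norm \<omega> < R + norm w}"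
    proof
      fix v assume v: "v \<in> Z"
      then have "norm (v + w) < R + norm w" "norm (v - w) < R + norm w"
        using norm_triangle_ineq[of v w] norm_triangle_ineq4[of v w] by (auto simp: Z_def)
      moreover have "v = (v + w) - w" "v = (v - w) + w" by simp_all
      moreover have "v + w \<in> periods \<or> v - w \<in> periods" using v D0 by (simp add: Z_def)
      ultimately show "v \<in> (\<lambda>\<omega>. \<omega> - w) ` {\<omega> \<in> periods. norm \<omega> < R + norm w} \<union> (\<lambda>\<omega>. \<omega> + w) ` {\<omega> \<in> periods. norm \<omega> < R + norm w}"
        by blast
    qed
    then show Z: "finite Z" by (rule finite_subset) (simp add: finite_lattice_ball)
    have "(\<lambda>v. N v / D v) holomorphic_on (ball 0 R - Z)"
      by (intro holomorphic_intros Nh Dh) (auto simp: Z_def)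
    then show "F holomorphic_on (ball 0 R - Z)"
      by (rule holomorphic_transform) (auto simp: Z_def F_def)
    show "(F \<longlongrightarrow> F v) (at v within ball 0 R)" if v: "v \<in> Z" for v
    proof -
      have "D v = 0" using v by (simp add: Z_def)
      then have "((\<lambda>u. N u / D u) \<longlongrightarrow> F v) (at v)"
        using D'_nz N0 by (intro lhopital_complex_simple[OF DN DD]) (auto simp: F_def)
      moreover have "\<forall>\<^sub>F u in at v. N u / D u = F u"
        unfolding eventually_at_topological
      proof (intro exI[of _ "ball 0 R - (Z - {v})"] conjI ballI impI)
        show "open (ball 0 R - (Z - {v}))" using Z by (intro open_Diff finite_imp_closed) auto
        show "v \<in> ball 0 R - (Z - {v})" using v by (simp add: Z_def)
        show "N u / D u = F u" if "u \<in> ball 0 R - (Z - {v})" "u \<noteq> v" for u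
          using that by (auto simp: F_def Z_def)
      qed
      ultimately have "(F \<longlongrightarrow> F v) (at v)" by (rule Lim_transform_eventually)
      then show ?thesis by (rule tendsto_within_subset) simp
    qed
  qed simp
  have "F holomorphic_on UNIV"
  proof -
    have "F field_differentiable at v" for v
      by (rule holomorphic_on_imp_differentiable_at[OF Fh[of "norm v + 1"]]) auto
    then show ?thesis by (simp add: holomorphic_on_def field_differentiable_at_within)
  qed
  moreover have contF: "continuous_on UNIV F"
    using calculation by (rule holomorphic_on_imp_continuous_on)
  moreover have "F (v + \<omega>) = F v" if "\<omega> \<in> periods" for v \<omega>
  proof (rule cont_eq_off_countable[where a = v and f = "\<lambda>v. F (v + \<omega>)" and g = F, OF countable_D])
    have c: "isCont F v" for v using contF by (simp add: continuous_on_eq_continuous_at)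
    show "isCont (\<lambda>v. F (v + \<omega>)) v" by (intro isCont_o2[OF _ c] continuous_intros)
    show "isCont F v" by (rule c)
    show "F (t + \<omega>) = F t" if "t \<notin> {x. D x = 0}" for t
      using ND_per[OF \<open>\<omega> \<in> periods\<close>] Dper[OF \<open>\<omega> \<in> periods\<close>] that by (simp add: F_def)
  qed
  ultimately have "F constant_on UNIV"
    by (intro Liouville_theorem bounded_periodic)
  then have const: "F x = F z" by (auto simp: constant_on_def)
  have Dz: "D z \<noteq> 0" using zw D0 by simp
  have "N z = wsigma (z + y) * wsigma (z - y) * D z"
    using sigma_eq_0_iff[of 0] lattice_0 by (simp add: N_def D_def)
  then have Fz: "F z = wsigma (z + y) * wsigma (z - y)" using Dz by (simp add: F_def)
  have "N x = F z * D x"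
  proof (cases "D x = 0")
    case True
    then show ?thesis using N0 by simp
  next
    case False
    then show ?thesis using const by (simp add: F_def field_simps)
  qed
  then show ?thesis unfolding Fz N_def D_def .
qed

lemma three_term_sigma:
  "wsigma (x + y) * wsigma (x - y) * (wsigma (z + w) * wsigma (z - w))
    + wsigma (z + x) * wsigma (z - x) * (wsigma (y + w) * wsigma (y - w))
    = wsigma (z + y) * wsigma (z - y) * (wsigma (x + w) * wsigma (x - w))"
proof (rule cont_eq_off_countable[where a = w
      and f = "\<lambda>w. wsigma (x + y) * wsigma (x - y) * (wsigma (z + w) * wsigma (z - w))
        + wsigma (z + x) * wsigma (z - x) * (wsigma (y + w) * wsigma (y - w))"
      and g = "\<lambda>w. wsigma (z + y) * wsigma (z - y) * (wsigma (x + w) * wsigma (x - w))"])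
  define Z where "Z = {w. 2 * w \<in> periods} \<union> {w. z + w \<in> periods} \<union> {w. z - w \<in> periods}"
  have "Z \<subseteq> (\<lambda>\<omega>. \<omega> / 2) ` periods \<union> (\<lambda>\<omega>. \<omega> - z) ` periods \<union> (\<lambda>\<omega>. z - \<omega>) ` periods"
  proof
    fix w assume "w \<in> Z"
    moreover have "w = 2 * w / 2" "w = z + w - z" "w = z - (z - w)" by simp_all
    ultimately show "w \<in> (\<lambda>\<omega>. \<omega> / 2) ` periods \<union> (\<lambda>\<omega>. \<omega> - z) ` periods \<union> (\<lambda>\<omega>. z - \<omega>) ` periods"
      unfolding Z_def by blast
  qed
  moreover have "countable ((\<lambda>\<omega>. \<omega> / 2) ` periods \<union> (\<lambda>\<omega>. \<omega> - z) ` periods \<union> (\<lambda>\<omega>. z - \<omega>) ` periods)"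
    by (intro countable_Un countable_image countable_lattice)
  ultimately show "countable Z" by (rule countable_subset)
  show "wsigma (x + y) * wsigma (x - y) * (wsigma (z + w) * wsigma (z - w))
    + wsigma (z + x) * wsigma (z - x) * (wsigma (y + w) * wsigma (y - w))
    = wsigma (z + y) * wsigma (z - y) * (wsigma (x + w) * wsigma (x - w))" if "w \<notin> Z" for w
    using that by (intro three_term_generic) (auto simp: Z_def)
qed (intro continuous_intros isCont_sigma_compose)+

lemma three_term_function_sigma: "three_term_function wsigma"
proof
  show "wsigma (- z) = - wsigma z" for z by (rule sigma_odd)
  show "wsigma (a + b) * wsigma (a - b) * (wsigma (c + q) * wsigma (c - q))
      + wsigma (b + c) * wsigma (b - c) * (wsigma (a + q) * wsigma (a - q))
      + wsigma (c + a) * wsigma (c - a) * (wsigma (b + q) * wsigma (b - q)) = 0" for a b c q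
  proof -
    have "wsigma (b - c) = - wsigma (c - b)" using sigma_odd[of "c - b"] by simp
    moreover have "wsigma (b + c) = wsigma (c + b)" by (simp only: add.commute)
    ultimately show ?thesis using three_term_sigma[of a b c q] by algebra
  qed
  show "isCont wsigma z" for z by (rule isCont_sigma)
  show "countable {z. wsigma z = 0}" unfolding sigma_eq_0_iff using countable_lattice by simp
qed

end

section \<open>Invariance under the direct product\<close>

theorem theorem3p2:
  fixes \<omega>1 \<omega>2 \<delta> :: complex and n :: nat and m :: "nat \<Rightarrow> nat"
  assumes "\<omega>1 / \<omega>2 \<notin> \<real>"
    and "\<forall>q\<in>\<rat>. \<forall>r\<in>\<rat>. \<delta> \<noteq> q * \<omega>1 + r * \<omega>2"
    and "n \<ge> 2"
  shows "\<exists>\<phi>. group_action (sym_group 6 \<times>\<times> sym_group 2) (balanced_params \<delta> n m) \<phi> \<and>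
    (\<forall>p \<in> balanced_params \<delta> n m.
       \<phi> (perm_swap 1 2, id) p = s_map 1 p \<and>
       \<phi> (perm_swap 2 3, id) p = s_map 0 p \<and>
       \<phi> (perm_swap 3 4, id) p = b1_map \<delta> p \<and>
       \<phi> (perm_swap 4 5, id) p = t_map 0 p \<and>
       \<phi> (perm_swap 5 6, id) p = t_map 1 p \<and>
       \<phi> (id, perm_swap 1 2) p = b2_map \<delta> n m p) \<and>
    (\<forall>g \<in> carrier (sym_group 6 \<times>\<times> sym_group 2). \<forall>p \<in> balanced_params \<delta> n m.
       generic (weierstrass_sigma \<omega>1 \<omega>2) \<delta> n m p \<longrightarrow>
       generic (weierstrass_sigma \<omega>1 \<omega>2) \<delta> n m (\<phi> g p) \<longrightarrow>
       E_tilde (weierstrass_sigma \<omega>1 \<omega>2) \<delta> n m (\<phi> g p) =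
       E_tilde (weierstrass_sigma \<omega>1 \<omega>2) \<delta> n m p)"
proof -
  interpret period_pair \<omega>1 \<omega>2
    by unfold_locales (rule assms(1))
  interpret three_term_function "weierstrass_sigma \<omega>1 \<omega>2" \<delta>
    by (rule three_term_function_sigma)
  let ?P = "balanced_params \<delta> n m"
  show ?thesis
  proof (intro exI conjI ballI impI)
    show "group_action (sym_group 6 \<times>\<times> sym_group 2) ?P (\<lambda>g. restrict (param_action n m g) ?P)"
      by (rule sym_product_group_action)
  qed (simp_all only: restrict_apply if_True param_action_generators E_tilde_invariant)
qed

end
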